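(* Let $k$ be an algebraically closed field of characteristic $0$ and let $A=\mathcal{A}(E,\sigma)$ be a $3$-dimensional cubic AS-regular algebra of Type S$'$, T$'$ or FL, where Type T$'$ is divided into Types T$'_1$, T$'_2$ according to the form of $E$ and Type FL is divided into Types FL$_1$, FL$_2$ according to the form of $\sigma$. Then, up to isomorphism of graded algebras, $A=k\langle x,y\rangle/(g_1,g_2)$ with $g_1,g_2$ as follows, for suitable parameters: - Type S$'$: $g_1=x^2y-\alpha yx^2+(\alpha-1)y^3$, $g_2=xy^2-y^2x$, with $\alpha\in k\setminus\{0\}$. - Type T$'_1$: $g_1=x^2y-\delta^2yx^2+\alpha yxy-\alpha\delta y^2x$, $g_2=xy^2-\delta^2y^2x$, with $\alpha\in k$, $\delta\in k\setminus\{0\}$. - Type T$'_2$: $g_1=x^2y-yx^2+\alpha yxy+(2-\alpha)y^2x+(\alpha-2)y^3$, $g_2=xy^2-y^2x+2y^3$, with $\alpha\in k$. - Type FL$_1$: $g_1=x^2y-\alpha yx^2$, $g_2=xy^2-\beta y^2x$, with $\alpha,\beta\in k$, $\alpha\beta\neq0$. - Type FL$_2$: $g_1=yxy-\alpha x^3$, $g_2=\beta xyx-y^3$, with $\alpha,\beta\in k$, $\alpha\beta\ne0$.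
   Context: A connected graded $k$-algebra $A$ is a $d$-dimensional AS-regular algebra if $\operatorname{gldim}A=d<\infty$, $\operatorname{GKdim}A<\infty$, and $\operatorname{Ext}^i_A(k,A)\cong k$ for $i=d$ and $=0$ for $i\ne d$. A $3$-dimensional cubic AS-regular algebra is a $3$-dimensional AS-regular algebra of the form $k\langle x,y\rangle/(g_1,g_2)$ with $\deg x=\deg y=1$ and $g_1,g_2$ homogeneous of degree $3$. A cubic element $f=\sum c_{ijl}x_ix_jx_l$ ($x_1=x,x_2=y$) is evaluated at $(p,q,r)\in(\mathbb{P}^1)^3$ by $f(p,q,r)=\sum c_{ijl}p_iq_jr_l$ (only its vanishing matters). For $E\subset\mathbb{P}^1\times\mathbb{P}^1$, $\operatorname{Aut}_k^GE$ is the set of automorphisms $\sigma$ of $E$ with $\pi_1\circ\sigma=\pi_2$, where $\pi_1,\pi_2$ are the projections. $A=\mathcal{A}(E,\sigma)$ means that $A=k\langle x,y\rangle/(R)$ where $R$ is the space of all cubic $f$ with $f(p,q,\pi_2\sigma(p,q))=0$ for all $(p,q)\in E$. By Artin–Tate–Van den Bergh every $3$-dimensional cubic AS-regular algebra determines and is determined by a pair $(E,\sigma)$, $\sigma\in\operatorname{Aut}_k^GE$, where $E$ (the point scheme) is $\mathbb{P}^1\times\mathbb{P}^1$ or a curve of bidegree $(2,2)$; explicitly, writing the relations as $(g_1,g_2)^t=M(x,y)^t$ with $M$ a $2\times2$ matrix of elements of degree $2$, $E$ is the zero scheme of $\det M$, the entries of $M$ being regarded as bihomogeneous forms of bidegree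 $(1,1)$ on $\mathbb{P}^1\times\mathbb{P}^1$. For the types below $E$ is reduced. For $\tau\in\operatorname{Aut}_k\mathbb{P}^1=\operatorname{PGL}_2(k)$ (acting on column vectors) put $C_\tau=\{(p,\tau(p)):p\in\mathbb{P}^1\}$, an irreducible curve of bidegree $(1,1)$. Curves of bidegree $(1,0)$ are $\{p\}\times\mathbb{P}^1$ and curves of bidegree $(0,1)$ are $\mathbb{P}^1\times\{q\}$. $E$ and $E'$ are $2$-equivalent if $E'=(\rho\times\rho)(E)$ for some $\rho\in\operatorname{Aut}_k\mathbb{P}^1$. Types of $A$: - Type S$'$: $E$ is the union of an irreducible curve of bidegree $(1,1)$, a curve of bidegree $(1,0)$ and a curve of bidegree $(0,1)$, whose pairwise intersections form three distinct points. - Type T$'$: $E$ is such a union, with a single intersection point common to all three. Type T$'_1$: $E$ is $2$-equivalent to $\mathbb{P}^1\times\{(1,0)\}\cup\{(1,0)\}\times\mathbb{P}^1\cup C_\tau$ with $\tau=\begin{pmatrix}1&0\\0&\delta\end{pmatrix}$ for some $\delta\in k\setminus\{0\}$; Type T$'_2$: the same with $\tau=\begin{pmatrix}1&1\\0&1\end{pmatrix}$. - Type FL: $E$ is the union of two distinct curves of bidegree $(1,0)$ and two distinct curves of bidegree $(0,1)$; then $E=\{P\}\times\mathbb{P}^1\cup\{Q\}\times\mathbb{P}^1\cup\mathbb{P}^1\times\{P\}\cup\mathbb{P}^1\times\{Q\}$ for some $P\ne Q$. Type FL$_1$: $\sigma(P,p)=(p,P)$ and $\sigma(Q,p)=(p,Q)$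 for all $p$; Type FL$_2$: $\sigma(P,p)=(p,Q)$ and $\sigma(Q,p)=(p,P)$ for all $p$. *)

theory Defs
  imports
    "HOL-Algebra.Algebraic_Closure_Type"
    "HOL-Algebra.Embedded_Algebras"
    "HOL-Algebra.QuotRing"
    "HOL-Library.Poly_Mapping"
    "HOL-Library.FuncSet"
    "HOL-Library.Extended_Nat"
    "HOL-Library.Extended_Real"
    "HOL-Library.Liminf_Limsup"
begin

section \<open>Left modules over a noncommutative ring\<close>

text \<open>The locale \<^locale>\<open>module\<close> of the library insists on a commutative base ring; its record type
  is reused here over an arbitrary ring.  The ring fields \<^const>\<open>monoid.mult\<close> and \<^const>\<open>one\<close> of a module
  record play no role.\<close>

locale left_module = R?: ring R + M?: abelian_group M
  for R :: "('a, 'r) ring_scheme" (structure)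
    and M :: "('a, 'm, 'e) module_scheme" (structure) +
  assumes smult_closed:
      "\<lbrakk>a \<in> carrier R; x \<in> carrier M\<rbrakk> \<Longrightarrow> a \<odot>\<^bsub>M\<^esub> x \<in> carrier M"
    and smult_l_distr:
      "\<lbrakk>a \<in> carrier R; b \<in> carrier R; x \<in> carrier M\<rbrakk> \<Longrightarrow>
        (a \<oplus>\<^bsub>R\<^esub> b) \<odot>\<^bsub>M\<^esub> x = a \<odot>\<^bsub>M\<^esub> x \<oplus>\<^bsub>M\<^esub> b \<odot>\<^bsub>M\<^esub> x"
    and smult_r_distr:
      "\<lbrakk>a \<in> carrier R; x \<in> carrier M; y \<in> carrier M\<rbrakk> \<Longrightarrow>
        a \<odot>\<^bsub>M\<^esub> (x \<oplus>\<^bsub>M\<^esub> y) = a \<odot>\<^bsub>M\<^esub> x \<oplus>\<^bsub>M\<^esub> a \<odot>\<^bsub>M\<^esub> y"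
    and smult_assoc:
      "\<lbrakk>a \<in> carrier R; b \<in> carrier R; x \<in> carrier M\<rbrakk> \<Longrightarrow>
        (a \<otimes>\<^bsub>R\<^esub> b) \<odot>\<^bsub>M\<^esub> x = a \<odot>\<^bsub>M\<^esub> (b \<odot>\<^bsub>M\<^esub> x)"
    and smult_one: "x \<in> carrier M \<Longrightarrow> \<one>\<^bsub>R\<^esub> \<odot>\<^bsub>M\<^esub> x = x"

definition lmod_hom ::
    "('a, 'r) ring_scheme \<Rightarrow> ('a, 'm) module \<Rightarrow> ('a, 'n) module \<Rightarrow> ('m \<Rightarrow> 'n) set" where
  "lmod_hom R M N =
     {f \<in> carrier M \<rightarrow>\<^sub>E carrier N.
        (\<forall>x\<in>carrier M. \<forall>y\<in>carrier M. f (x \<oplus>\<^bsub>M\<^esub> y) = f x \<oplus>\<^bsub>N\<^esub> f y) \<and>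
        (\<forall>a\<in>carrier R. \<forall>x\<in>carrier M. f (a \<odot>\<^bsub>M\<^esub> x) = a \<odot>\<^bsub>N\<^esub> f x)}"

definition lmod_isomorphic ::
    "('a, 'r) ring_scheme \<Rightarrow> ('a, 'm) module \<Rightarrow> ('a, 'n) module \<Rightarrow> bool" where
  "lmod_isomorphic R M N \<longleftrightarrow> (\<exists>f \<in> lmod_hom R M N. bij_betw f (carrier M) (carrier N))"

definition regular_lmod :: "('a, 'r) ring_scheme \<Rightarrow> ('a, 'a) module" where
  "regular_lmod R =
     \<lparr>carrier = carrier R, monoid.mult = monoid.mult R, one = \<one>\<^bsub>R\<^esub>, zero = \<zero>\<^bsub>R\<^esub>,
      add = add R, module.smult = monoid.mult R\<rparr>"

text \<open>In HOL one cannot quantify over all types inside a definition, so lifting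
  problems, resolutions and the modules entering the global dimension are taken with carriers inside the infinite type
  \<^typ>\<open>nat \<Rightarrow> 'a\<close>, where \<^typ>\<open>'a\<close> is the type of the ring.  Nothing is lost for a nonzero ring.
  The class of modules of cardinality at most that of this type is closed under submodules,
  quotients and free covers (a free module on a subset of the type has at most that many
  elements), so projectivity and resolutions have their usual meaning; and it contains a copy of
  every cyclic module, so that the global dimension is the usual one by Auslander's theorem.\<close>

definition projective_lmod ::
    "('a, 'r) ring_scheme \<Rightarrow> ('a, nat \<Rightarrow> 'a) module \<Rightarrow> bool" where
  "projective_lmod R P \<longleftrightarrow> left_module R P \<and>
     (\<forall>(N :: ('a, nat \<Rightarrow> 'a) module) (N' :: ('a, nat \<Rightarrow> 'a) module) g f.
        left_module R N \<and> left_module R N' \<and>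
        g \<in> lmod_hom R N N' \<and> g ` carrier N = carrier N' \<and> f \<in> lmod_hom R P N' \<longrightarrow>
        (\<exists>h \<in> lmod_hom R P N. \<forall>x\<in>carrier P. g (h x) = f x))"

text \<open>\<open>\<dots> \<rightarrow> P 2 \<rightarrow> P 1 \<rightarrow> P 0 \<rightarrow> M \<rightarrow> 0\<close> with \<open>bd n : P (n + 1) \<rightarrow> P n\<close> and \<open>\<epsilon> : P 0 \<rightarrow> M\<close>.\<close>

definition projective_resolution ::
    "('a, 'r) ring_scheme \<Rightarrow> (nat \<Rightarrow> ('a, nat \<Rightarrow> 'a) module) \<Rightarrow>
     (nat \<Rightarrow> (nat \<Rightarrow> 'a) \<Rightarrow> (nat \<Rightarrow> 'a)) \<Rightarrow> ((nat \<Rightarrow> 'a) \<Rightarrow> 'm) \<Rightarrow> ('a, 'm) module \<Rightarrow> bool" where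
  "projective_resolution R P bd \<epsilon> M \<longleftrightarrow>
     (\<forall>n. projective_lmod R (P n)) \<and>
     \<epsilon> \<in> lmod_hom R (P 0) M \<and>
     (\<forall>n. bd n \<in> lmod_hom R (P (Suc n)) (P n)) \<and>
     \<epsilon> ` carrier (P 0) = carrier M \<and>
     {x \<in> carrier (P 0). \<epsilon> x = \<zero>\<^bsub>M\<^esub>} = bd 0 ` carrier (P 1) \<and>
     (\<forall>n. {x \<in> carrier (P (Suc n)). bd n x = \<zero>\<^bsub>P n\<^esub>} = bd (Suc n) ` carrier (P (Suc (Suc n))))"

definition proj_dim :: "('a, 'r) ring_scheme \<Rightarrow> ('a, 'm) module \<Rightarrow> enat" where
  "proj_dim R M =
     (INF n \<in> {n. \<exists>P bd \<epsilon>. projective_resolution R P bd \<epsilon> M \<and> (\<forall>i>n. carrier (P i) = {\<zero>\<^bsub>P i\<^esub>})}.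
        enat n)"

definition gldim :: "('a, 'r) ring_scheme \<Rightarrow> enat" where
  "gldim R = (SUP M \<in> {M :: ('a, nat \<Rightarrow> 'a) module. left_module R M}. proj_dim R M)"


section \<open>Connected graded algebras\<close>

text \<open>\<open>scal\<close> is the structure map \<open>k \<rightarrow> A\<close>, where the field \<open>k\<close> is the type \<open>'k\<close>, and \<open>grade n\<close>
  is the homogeneous part of degree \<open>n\<close>.\<close>

record ('k, 'a) graded_algebra = "'a ring" +
  scal :: "'k \<Rightarrow> 'a"
  grade :: "nat \<Rightarrow> 'a set"

definition is_decomp :: "('k, 'a, 'e) graded_algebra_scheme \<Rightarrow> 'a \<Rightarrow> (nat \<Rightarrow> 'a) \<Rightarrow> bool" where
  "is_decomp A a c \<longleftrightarrow>
     (\<forall>n. c n \<in> grade A n) \<and> finite {n. c n \<noteq> \<zero>\<^bsub>A\<^esub>} \<and> a = finsum A c {n. c n \<noteq> \<zero>\<^bsub>A\<^esub>}"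

locale connected_graded_algebra = ring A
  for A :: "('k::field, 'a) graded_algebra" (structure) +
  assumes scal_hom: "scal A \<in> ring_hom ring_of_type_algebra A"
    and scal_inj: "inj (scal A)"
    and scal_central: "a \<in> carrier A \<Longrightarrow> scal A c \<otimes> a = a \<otimes> scal A c"
    and grade_subgroup: "subgroup (grade A n) (add_monoid A)"
    and grade_scal: "a \<in> grade A n \<Longrightarrow> scal A c \<otimes> a \<in> grade A n"
    and grade_mult: "\<lbrakk>a \<in> grade A m; b \<in> grade A n\<rbrakk> \<Longrightarrow> a \<otimes> b \<in> grade A (m + n)"
    and grade_decomp: "a \<in> carrier A \<Longrightarrow> \<exists>!c. is_decomp A a c"
    and connected: "grade A 0 = range (scal A)"

definition hcomp :: "('k, 'a) graded_algebra \<Rightarrow> 'a \<Rightarrow> nat \<Rightarrow> 'a" where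
  "hcomp A a = (THE c. is_decomp A a c)"

text \<open>The left \<open>A\<close>-module \<open>k\<close>, i.e. \<open>A\<close> modulo its part of positive degree, realized on the degree 0
  part of \<open>A\<close>.\<close>

definition residue_lmod :: "('k, 'a) graded_algebra \<Rightarrow> ('a, 'a) module" where
  "residue_lmod A =
     \<lparr>carrier = grade A 0, monoid.mult = monoid.mult A, one = \<one>\<^bsub>A\<^esub>, zero = \<zero>\<^bsub>A\<^esub>, add = add A,
      module.smult = (\<lambda>a x. hcomp A a 0 \<otimes>\<^bsub>A\<^esub> x)\<rparr>"

definition graded_iso ::
    "('k, 'a) graded_algebra \<Rightarrow> ('k, 'b) graded_algebra \<Rightarrow> bool" (infix \<open>\<cong>\<^sub>g\<^sub>r\<close> 50) where
  "A \<cong>\<^sub>g\<^sub>r B \<longleftrightarrow>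
     (\<exists>h \<in> ring_iso A B. (\<forall>c. h (scal A c) = scal B c) \<and> (\<forall>n. h ` grade A n = grade B n))"


section \<open>AS-regular algebras\<close>

text \<open>The \<open>k\<close>-space \<open>Hom\<^sub>A(M, N)\<close> and the cohomology \<open>Ext\<^sup>i\<close> of the complex \<open>Hom\<^sub>A(P, N)\<close>
  for a (deleted) projective resolution \<open>(P, bd)\<close>.\<close>

definition Hom_space ::
    "('k, 'a) graded_algebra \<Rightarrow> ('a, 'm) module \<Rightarrow> ('a, 'n) module \<Rightarrow> ('k, 'm \<Rightarrow> 'n) module" where
  "Hom_space A M N =
     \<lparr>carrier = lmod_hom A M N, monoid.mult = undefined, one = undefined,
      zero = (\<lambda>x\<in>carrier M. \<zero>\<^bsub>N\<^esub>),
      add = (\<lambda>f g. \<lambda>x\<in>carrier M. f x \<oplus>\<^bsub>N\<^esub> g x),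
      module.smult = (\<lambda>c f. \<lambda>x\<in>carrier M. scal A c \<odot>\<^bsub>N\<^esub> f x)\<rparr>"

definition cocycles ::
    "('k, 'a) graded_algebra \<Rightarrow> (nat \<Rightarrow> ('a, 'm) module) \<Rightarrow> (nat \<Rightarrow> 'm \<Rightarrow> 'm) \<Rightarrow>
     ('a, 'n) module \<Rightarrow> nat \<Rightarrow> ('m \<Rightarrow> 'n) set" where
  "cocycles A P bd N i = {f \<in> lmod_hom A (P i) N. \<forall>x\<in>carrier (P (Suc i)). f (bd i x) = \<zero>\<^bsub>N\<^esub>}"

fun coboundaries ::
    "('k, 'a) graded_algebra \<Rightarrow> (nat \<Rightarrow> ('a, 'm) module) \<Rightarrow> (nat \<Rightarrow> 'm \<Rightarrow> 'm) \<Rightarrow>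
     ('a, 'n) module \<Rightarrow> nat \<Rightarrow> ('m \<Rightarrow> 'n) set" where
  "coboundaries A P bd N 0 = {\<lambda>x\<in>carrier (P 0). \<zero>\<^bsub>N\<^esub>}"
| "coboundaries A P bd N (Suc i) =
     (\<lambda>f. \<lambda>x\<in>carrier (P (Suc i)). f (bd i x)) ` lmod_hom A (P i) N"

definition Ext_space ::
    "('k, 'a) graded_algebra \<Rightarrow> (nat \<Rightarrow> ('a, 'm) module) \<Rightarrow> (nat \<Rightarrow> 'm \<Rightarrow> 'm) \<Rightarrow>
     ('a, 'n) module \<Rightarrow> nat \<Rightarrow> ('k, ('m \<Rightarrow> 'n) set) module" where
  "Ext_space A P bd N i =
    (let H = Hom_space A (P i) N; Z = cocycles A P bd N i; B = coboundaries A P bd N i in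
     \<lparr>carrier = {B +>\<^bsub>H\<^esub> f | f. f \<in> Z}, monoid.mult = undefined, one = undefined,
      zero = B, add = set_add H,
      module.smult = (\<lambda>c T. \<Union>f\<in>T. B +>\<^bsub>H\<^esub> (c \<odot>\<^bsub>H\<^esub> f))\<rparr>)"

text \<open>\<open>sup\<^sub>V limsup\<^sub>n (log\<^sub>n dim\<^sub>k (k + V + \<dots> + V\<^sup>n))\<close>, where \<open>V\<close> runs over the spans of finite lists.\<close>

fun monomials_upto :: "('a, 'r) ring_scheme \<Rightarrow> 'a list \<Rightarrow> nat \<Rightarrow> 'a list" where
  "monomials_upto A vs 0 = [\<one>\<^bsub>A\<^esub>]"
| "monomials_upto A vs (Suc n) =
     \<one>\<^bsub>A\<^esub> # concat (map (\<lambda>v. map (\<lambda>w. v \<otimes>\<^bsub>A\<^esub> w) (monomials_upto A vs n)) vs)"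

definition GKdim :: "('k, 'a) graded_algebra \<Rightarrow> ereal" where
  "GKdim A =
     (SUP vs \<in> {vs. set vs \<subseteq> carrier A}.
        limsup (\<lambda>n. ereal (ln (real (ring.dim A (range (scal A))
                      (ring.Span A (range (scal A)) (monomials_upto A vs n)))) / ln (real n))))"

text \<open>\<open>Ext\<close> does not depend on the resolution, and one exists as soon as \<open>gldim A\<close> is finite.\<close>

definition AS_regular :: "nat \<Rightarrow> ('k::field, 'a) graded_algebra \<Rightarrow> bool" where
  "AS_regular d A \<longleftrightarrow>
     connected_graded_algebra A \<and> gldim A = enat d \<and> GKdim A < \<infinity> \<and>
     (\<forall>P bd \<epsilon>. projective_resolution A P bd \<epsilon> (residue_lmod A) \<longrightarrow>
        (\<forall>i. let E = Ext_space A P bd (regular_lmod A) i in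
          if i = d
          then lmod_isomorphic ring_of_type_algebra E (regular_lmod (ring_of_type_algebra :: 'k ring))
          else carrier E = {\<zero>\<^bsub>E\<^esub>}))"


section \<open>The free algebra on two generators\<close>

text \<open>\<open>k\<langle>x, y\<rangle>\<close> is the monoid algebra of the free monoid on two letters.  Words get their own
  type because \<^class>\<open>monoid_add\<close>, the class that \<^type>\<open>poly_mapping\<close> needs for its product,
  writes the monoid operation (here: concatenation) additively.\<close>

datatype letter = Lx | Ly

datatype word = Word (letters: "letter list")

instantiation word :: monoid_add
begin

definition zero_word :: word where "zero_word = Word []"

definition plus_word :: "word \<Rightarrow> word \<Rightarrow> word" where
  "plus_word v w = Word (letters v @ letters w)"

instance
  by standard (simp_all add: zero_word_def plus_word_def)

end

type_synonym 'k free_alg = "word \<Rightarrow>\<^sub>0 'k"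

definition cst :: "'k \<Rightarrow> 'k::zero free_alg" where
  "cst c = Poly_Mapping.single (Word []) c"

definition gx :: "'k::zero_neq_one free_alg" where
  "gx = Poly_Mapping.single (Word [Lx]) 1"

definition gy :: "'k::zero_neq_one free_alg" where
  "gy = Poly_Mapping.single (Word [Ly]) 1"

definition homogeneous :: "nat \<Rightarrow> 'k::zero free_alg \<Rightarrow> bool" where
  "homogeneous n f \<longleftrightarrow> (\<forall>w \<in> Poly_Mapping.keys f. length (letters w) = n)"

text \<open>\<open>presented S\<close> is \<open>k\<langle>x, y\<rangle>/(S)\<close>; the grading is the intended one if all elements of \<open>S\<close>
  are homogeneous.\<close>

definition presented :: "'k::field free_alg set \<Rightarrow> ('k, 'k free_alg set) graded_algebra" where
  "presented S =
    (let F = (ring_of_type_algebra :: 'k free_alg ring); I = genideal F S in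
     ring.extend (F Quot I)
       (graded_algebra.fields (\<lambda>c. I +>\<^bsub>F\<^esub> cst c) (\<lambda>n. {I +>\<^bsub>F\<^esub> f | f. homogeneous n f})))"


section \<open>Geometry of the projective line and of its square\<close>

text \<open>A point of the projective line is the set of all its homogeneous coordinates.\<close>

definition proj_class :: "'k::field \<times> 'k \<Rightarrow> ('k \<times> 'k) set" where
  "proj_class u = {(c * fst u, c * snd u) | c. c \<noteq> 0}"

typedef (overloaded) ('k::field) P1 = "{proj_class u | u :: 'k \<times> 'k. u \<noteq> (0, 0)}"
  morphisms coords Abs_P1
proof -
  have "proj_class (1 :: 'k, 0) \<in> {proj_class u | u :: 'k \<times> 'k. u \<noteq> (0, 0)}"
    by (intro CollectI exI[of _ "(1, 0)"]) simp
  then show ?thesis ..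
qed

definition pt :: "'k::field \<Rightarrow> 'k \<Rightarrow> 'k P1" where
  "pt a b = Abs_P1 (proj_class (a, b))"

text \<open>The action of the matrix with rows \<open>(a, b)\<close> and \<open>(c, d)\<close> on column vectors.\<close>

definition proj_map :: "'k::field \<Rightarrow> 'k \<Rightarrow> 'k \<Rightarrow> 'k \<Rightarrow> 'k P1 \<Rightarrow> 'k P1" where
  "proj_map a b c d p =
     (THE q. \<forall>(s, t) \<in> coords p. (a * s + b * t, c * s + d * t) \<in> coords q)"

definition Aut_P1 :: "('k::field P1 \<Rightarrow> 'k P1) set" where
  "Aut_P1 = {proj_map a b c d | a b c d. a * d - b * c \<noteq> 0}"

text \<open>Bihomogeneous forms are represented by the functions they induce on coordinate vectors, which
  is harmless over an infinite field.\<close>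

definition biform :: "nat \<Rightarrow> nat \<Rightarrow> ('k::field \<times> 'k \<Rightarrow> 'k \<times> 'k \<Rightarrow> 'k) \<Rightarrow> bool" where
  "biform m n F \<longleftrightarrow>
     (\<exists>c. \<forall>s t s' t'. F (s, t) (s', t') =
        (\<Sum>i\<le>m. \<Sum>j\<le>n. c i j * s ^ i * t ^ (m - i) * s' ^ j * t' ^ (n - j)))"

definition zero_locus :: "('k::field \<times> 'k \<Rightarrow> 'k \<times> 'k \<Rightarrow> 'k) \<Rightarrow> ('k P1 \<times> 'k P1) set" where
  "zero_locus F = {(p, q). \<forall>u \<in> coords p. \<forall>v \<in> coords q. F u v = 0}"

definition irreducible_biform ::
    "nat \<Rightarrow> nat \<Rightarrow> ('k::field \<times> 'k \<Rightarrow> 'k \<times> 'k \<Rightarrow> 'k) \<Rightarrow> bool" where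
  "irreducible_biform m n F \<longleftrightarrow>
     biform m n F \<and> F \<noteq> (\<lambda>u v. 0) \<and> (m, n) \<noteq> (0, 0) \<and>
     (\<forall>a b a' b' G H. biform a b G \<and> biform a' b' H \<and> a + a' = m \<and> b + b' = n \<and>
        F = (\<lambda>u v. G u v * H u v) \<longrightarrow> (a, b) = (0, 0) \<or> (a', b') = (0, 0))"

definition irreducible_curve :: "nat \<Rightarrow> nat \<Rightarrow> ('k::field P1 \<times> 'k P1) set \<Rightarrow> bool" where
  "irreducible_curve m n C \<longleftrightarrow> (\<exists>F. irreducible_biform m n F \<and> C = zero_locus F)"

definition graph_curve :: "('k P1 \<Rightarrow> 'k P1) \<Rightarrow> ('k::field P1 \<times> 'k P1) set" where
  "graph_curve \<tau> = {(p, \<tau> p) | p. True}"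

definition vline :: "'k P1 \<Rightarrow> ('k::field P1 \<times> 'k P1) set" where
  "vline p = {p} \<times> UNIV"

definition hline :: "'k P1 \<Rightarrow> ('k::field P1 \<times> 'k P1) set" where
  "hline q = UNIV \<times> {q}"

text \<open>A map from a closed subset \<open>E\<close> to the projective line is regular if near every point of
  \<open>E\<close> it is given by two forms of the same bidegree.\<close>

definition regular_map_to_P1 ::
    "('k::field P1 \<times> 'k P1) set \<Rightarrow> ('k P1 \<times> 'k P1 \<Rightarrow> 'k P1) \<Rightarrow> bool" where
  "regular_map_to_P1 E \<phi> \<longleftrightarrow>
     (\<forall>e\<in>E. \<exists>m n F G. biform m n F \<and> biform m n G \<and>
        e \<notin> zero_locus F \<inter> zero_locus G \<and>
        (\<forall>(p, q) \<in> E - zero_locus F \<inter> zero_locus G.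
           \<forall>u\<in>coords p. \<forall>v\<in>coords q. (F u v, G u v) \<in> coords (\<phi> (p, q))))"

definition morphism ::
    "('k::field P1 \<times> 'k P1) set \<Rightarrow> ('k P1 \<times> 'k P1 \<Rightarrow> 'k P1 \<times> 'k P1) \<Rightarrow> bool" where
  "morphism E \<sigma> \<longleftrightarrow>
     \<sigma> ` E \<subseteq> E \<and> regular_map_to_P1 E (fst \<circ> \<sigma>) \<and> regular_map_to_P1 E (snd \<circ> \<sigma>)"

text \<open>Automorphisms of the variety (reduced scheme) \<open>E\<close> over \<open>k\<close>; the values of \<open>\<sigma>\<close> off
  \<open>E\<close> are irrelevant.\<close>

definition AutG ::
    "('k::field P1 \<times> 'k P1) set \<Rightarrow> ('k P1 \<times> 'k P1 \<Rightarrow> 'k P1 \<times> 'k P1) set" where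
  "AutG E =
     {\<sigma>. morphism E \<sigma> \<and>
         (\<exists>\<sigma>'. morphism E \<sigma>' \<and> (\<forall>e\<in>E. \<sigma>' (\<sigma> e) = e \<and> \<sigma> (\<sigma>' e) = e)) \<and>
         (\<forall>e\<in>E. fst (\<sigma> e) = snd e)}"

definition two_equivalent ::
    "('k::field P1 \<times> 'k P1) set \<Rightarrow> ('k P1 \<times> 'k P1) set \<Rightarrow> bool" where
  "two_equivalent E E' \<longleftrightarrow> (\<exists>\<rho> \<in> Aut_P1. E' = map_prod \<rho> \<rho> ` E)"


section \<open>Cubic algebras and their geometric data\<close>

fun coordinate :: "letter \<Rightarrow> 'k \<times> 'k \<Rightarrow> 'k" where
  "coordinate Lx u = fst u"
| "coordinate Ly u = snd u"

text \<open>The multilinear form attached to a homogeneous element \<open>f\<close>, evaluated at a list of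
  coordinate vectors whose length is the degree of \<open>f\<close>.\<close>

definition mlin :: "'k::field free_alg \<Rightarrow> ('k \<times> 'k) list \<Rightarrow> 'k" where
  "mlin f us =
     (\<Sum>w \<in> Poly_Mapping.keys f.
        Poly_Mapping.lookup f w * prod_list (map2 coordinate (letters w) us))"

text \<open>\<open>E\<close> is the zero locus of \<open>det M\<close>, where \<open>(g1, g2)\<^sup>t = M (x, y)\<^sup>t\<close>.  Only the underlying set is
  recorded.  For the types below this forces the zero scheme to be reduced: the equations of the
  components of \<open>E\<close> divide \<open>det M\<close> and their bidegrees add up to \<open>(2, 2)\<close>.\<close>

definition point_scheme ::
    "'k::field free_alg \<Rightarrow> 'k free_alg \<Rightarrow> ('k P1 \<times> 'k P1) set \<Rightarrow> bool" where
  "point_scheme g1 g2 E \<longleftrightarrow>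
     (\<exists>m11 m12 m21 m22.
        homogeneous 2 m11 \<and> homogeneous 2 m12 \<and> homogeneous 2 m21 \<and> homogeneous 2 m22 \<and>
        g1 = m11 * gx + m12 * gy \<and> g2 = m21 * gx + m22 * gy \<and>
        E = zero_locus (\<lambda>u v. mlin m11 [u, v] * mlin m22 [u, v] - mlin m12 [u, v] * mlin m21 [u, v]))"

definition relation_space ::
    "('k::field P1 \<times> 'k P1) set \<Rightarrow> ('k P1 \<times> 'k P1 \<Rightarrow> 'k P1 \<times> 'k P1) \<Rightarrow> 'k free_alg set" where
  "relation_space E \<sigma> =
     {f. homogeneous 3 f \<and>
         (\<forall>(p, q) \<in> E. \<forall>u \<in> coords p. \<forall>v \<in> coords q. \<forall>w \<in> coords (snd (\<sigma> (p, q))).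
            mlin f [u, v, w] = 0)}"

definition geometric_algebra ::
    "('k::field P1 \<times> 'k P1) set \<Rightarrow> ('k P1 \<times> 'k P1 \<Rightarrow> 'k P1 \<times> 'k P1) \<Rightarrow>
     ('k, 'k free_alg set) graded_algebra" where
  "geometric_algebra E \<sigma> = presented (relation_space E \<sigma>)"

text \<open>\<open>A = \<A>(E, \<sigma>)\<close> is a 3-dimensional cubic AS-regular algebra with point scheme \<open>E\<close>.\<close>

definition cubic_AS_regular_pair ::
    "('k::field, 'k free_alg set) graded_algebra \<Rightarrow> ('k P1 \<times> 'k P1) set \<Rightarrow>
     ('k P1 \<times> 'k P1 \<Rightarrow> 'k P1 \<times> 'k P1) \<Rightarrow> bool" where
  "cubic_AS_regular_pair A E \<sigma> \<longleftrightarrow>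
     AS_regular 3 A \<and>
     (\<exists>g1 g2. homogeneous 3 g1 \<and> homogeneous 3 g2 \<and> A = presented {g1, g2} \<and>
        point_scheme g1 g2 E) \<and>
     \<sigma> \<in> AutG E \<and> A = geometric_algebra E \<sigma>"


section \<open>Types\<close>

text \<open>\<open>type_S\<close>, \<open>type_T\<close>, \<open>type_T1\<close>, \<open>type_T2\<close> are the types S', T', T'\<open>\<^sub>1\<close>, T'\<open>\<^sub>2\<close>.\<close>

definition type_S :: "('k::field P1 \<times> 'k P1) set \<Rightarrow> bool" where
  "type_S E \<longleftrightarrow>
     (\<exists>C p q. irreducible_curve 1 1 C \<and> E = C \<union> vline p \<union> hline q \<and>
        (\<exists>a b c. C \<inter> vline p = {a} \<and> C \<inter> hline q = {b} \<and> vline p \<inter> hline q = {c} \<and>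
           distinct [a, b, c]))"

definition type_T :: "('k::field P1 \<times> 'k P1) set \<Rightarrow> bool" where
  "type_T E \<longleftrightarrow>
     (\<exists>C p q. irreducible_curve 1 1 C \<and> E = C \<union> vline p \<union> hline q \<and>
        (\<exists>a. C \<inter> vline p = {a} \<and> C \<inter> hline q = {a} \<and> vline p \<inter> hline q = {a}))"

definition type_T1 :: "('k::field P1 \<times> 'k P1) set \<Rightarrow> bool" where
  "type_T1 E \<longleftrightarrow> type_T E \<and>
     (\<exists>\<delta>. \<delta> \<noteq> 0 \<and>
        two_equivalent E (hline (pt 1 0) \<union> vline (pt 1 0) \<union> graph_curve (proj_map 1 0 0 \<delta>)))"

definition type_T2 :: "('k::field P1 \<times> 'k P1) set \<Rightarrow> bool" where
  "type_T2 E \<longleftrightarrow> type_T E \<and>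
     two_equivalent E (hline (pt 1 0) \<union> vline (pt 1 0) \<union> graph_curve (proj_map 1 1 0 1))"

definition type_FL :: "('k::field P1 \<times> 'k P1) set \<Rightarrow> bool" where
  "type_FL E \<longleftrightarrow>
     (\<exists>p p' q q'. p \<noteq> p' \<and> q \<noteq> q' \<and> E = vline p \<union> vline p' \<union> hline q \<union> hline q')"

definition type_FL1 ::
    "('k::field P1 \<times> 'k P1) set \<Rightarrow> ('k P1 \<times> 'k P1 \<Rightarrow> 'k P1 \<times> 'k P1) \<Rightarrow> bool" where
  "type_FL1 E \<sigma> \<longleftrightarrow>
     (\<exists>P Q. P \<noteq> Q \<and> E = vline P \<union> vline Q \<union> hline P \<union> hline Q \<and>
        (\<forall>p. \<sigma> (P, p) = (p, P) \<and> \<sigma> (Q, p) = (p, Q)))"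

definition type_FL2 ::
    "('k::field P1 \<times> 'k P1) set \<Rightarrow> ('k P1 \<times> 'k P1 \<Rightarrow> 'k P1 \<times> 'k P1) \<Rightarrow> bool" where
  "type_FL2 E \<sigma> \<longleftrightarrow>
     (\<exists>P Q. P \<noteq> Q \<and> E = vline P \<union> vline Q \<union> hline P \<union> hline Q \<and>
        (\<forall>p. \<sigma> (P, p) = (p, Q) \<and> \<sigma> (Q, p) = (p, P)))"

end

(*
  An automorphism sigma of E with pi_1 sigma = pi_2 maps the horizontal lines of E to vertical lines of E,
  because they are infinite fibres; so the lines of E lie over the same points.  By the
  identity principle for regular maps on P^1, sigma either swaps the vertical and the horizontal
  line and preserves the conic C (Types S' and T'), or it permutes the three components
  cyclically; for Type FL the alternatives are FL1 and FL2.  In coordinates adapted to E, the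
  vanishing of the two relations on the graph of sigma is a linear system for their eight
  coefficients.  In the non-cyclic cases its solutions are the asserted normal forms.  In the cyclic
  case y^3 is a relation, which is excluded by gldim A = 3.
*)
theory Submission
  imports Defs "HOL-Computational_Algebra.Polynomial"
begin

section \<open>The free algebra\<close>

text \<open>The relations \<open>g1\<close>, \<open>g2\<close> of \<open>A\<close> are given, and
  \<open>A = geometric_algebra E \<sigma>\<close> says that they generate the same ideal as the
  cubics vanishing on the graph of \<open>\<sigma>\<close>. Membership in that ideal already forces
  \<open>g1\<close> and \<open>g2\<close> to vanish on the graph, so the space of all such cubics
  never has to be determined: the linear system confines \<open>g1\<close> and \<open>g2\<close> to
  the span of two explicit cubics, and their independence (a dependence would make
  \<open>det M\<close> vanish identically) makes the two spans equal. The system uses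
  \<open>\<sigma>\<close> on the vertical lines, on \<open>C\<close>, and at one point of each
  horizontal line; the unknown value at that point supplies the free parameter, and injectivity of
  \<open>\<sigma>\<close> keeps it away from forbidden values.

  Excluding a relation \<open>y ^ 3\<close> happens in an ungraded setting, since
  \<open>gldim\<close> ranges over ungraded modules and a resolution obtained from it carries no
  grading. Minimality arguments are therefore replaced by comparing coefficients of words of length
  at most two, which are well defined in \<open>A\<close> because all relations are cubic.\<close>

abbreviation cf :: "'k::zero free_alg \<Rightarrow> letter list \<Rightarrow> 'k" where
  "cf f ls \<equiv> Poly_Mapping.lookup f (Word ls)"

lemma free_alg_eqI: "(\<And>ls. cf f ls = cf g ls) \<Longrightarrow> f = g"
  by (rule poly_mapping_eqI) (metis word.exhaust)

text \<open>Giving a fresh key a value amounts to adding a monomial, so statements additive in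
  \<open>f\<close> need checking on monomials only.\<close>

lemma poly_mapping_add_induct [case_names zero single add]:
  fixes f :: "'a \<Rightarrow>\<^sub>0 'b::comm_monoid_add"
  assumes "P 0" "\<And>w c. P (Poly_Mapping.single w c)" "\<And>f g. P f \<Longrightarrow> P g \<Longrightarrow> P (f + g)"
  shows "P f"
proof (induction f rule: update_induct)
  case const
  then show ?case by (rule assms(1))
next
  case (update f k v)
  have "Poly_Mapping.update k v f = f + Poly_Mapping.single k v"
    by (rule poly_mapping_eqI)
      (use update(1) in \<open>auto simp: lookup_update lookup_add lookup_single when_def in_keys_iff\<close>)
  then show ?case using assms update by metis
qed

lemma cf_single: "cf (Poly_Mapping.single w c) ls = (if w = Word ls then c else 0)"
  by (auto simp: lookup_single when_def)

text \<open>A word is a concatenation of two words in exactly one way per cutting position, and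
  \<open>i\<close> runs over the positions.\<close>

lemma cf_mult:
  fixes f g :: "'k::semiring_0 free_alg"
  shows "cf (f * g) ls = (\<Sum>i\<le>length ls. cf f (take i ls) * cf g (drop i ls))"
proof (induction f arbitrary: g rule: poly_mapping_add_induct)
  case zero
  then show ?case by simp
next
  case (single v c)
  show ?case
  proof (induction g rule: poly_mapping_add_induct)
    case zero
    then show ?case by simp
  next
    case (single w d)
    obtain vs ws where vw: "v = Word vs" "w = Word ws" by (metis word.exhaust)
    \<comment> \<open>For fixed \<open>vs\<close> and \<open>ws\<close> the only possible cut is at
      \<open>length vs\<close>, so the sum collapses to one term.\<close>
    have eq: "vs = take i ls \<and> ws = drop i ls \<longleftrightarrow> i = length vs \<and> vs @ ws = ls" if "i \<le> length ls" for i
      using that by (metis append_eq_conv_conj append_take_drop_id length_take min.absorb2)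
    have "(\<Sum>i\<le>length ls. cf (Poly_Mapping.single v c) (take i ls) * cf (Poly_Mapping.single w d) (drop i ls))
        = (\<Sum>i\<le>length ls. if vs = take i ls \<and> ws = drop i ls then c * d else 0)"
      by (rule sum.cong) (auto simp: cf_single vw)
    also have "\<dots> = (\<Sum>i\<le>length ls. if i = length vs then (if vs @ ws = ls then c * d else 0) else 0)"
      by (rule sum.cong) (simp_all add: eq)
    also have "\<dots> = (if vs @ ws = ls then c * d else 0)"
      by auto
    finally show ?case
      by (auto simp: mult_single cf_single vw plus_word_def)
  next
    case (add f g)
    then show ?case by (simp add: lookup_add distrib_left sum.distrib)
  qed
next
  case (add f1 f2)
  then show ?case by (simp add: lookup_add distrib_right sum.distrib)
qed

lemma cf_cst: "cf (cst c) ls = (if ls = [] then c else 0)"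
  by (auto simp: cst_def cf_single)

lemma cf_gx: "cf gx ls = (if ls = [Lx] then 1 else 0)"
  by (auto simp: gx_def cf_single)

lemma cf_gy: "cf gy ls = (if ls = [Ly] then 1 else 0)"
  by (auto simp: gy_def cf_single)

lemma cf_one: "cf 1 ls = (if ls = [] then 1 else 0)"
  by (auto simp: lookup_one when_def zero_word_def)

lemma cf_cst_mult [simp]: "cf (cst c * f) ls = c * cf f ls"
  for f :: "'k::semiring_0 free_alg"
proof -
  have "cf (cst c * f) ls = (\<Sum>i\<le>length ls. if i = 0 then c * cf f ls else 0)"
    unfolding cf_mult by (rule sum.cong) (auto simp: cf_cst)
  then show ?thesis by simp
qed

lemma cf_mult_cst [simp]: "cf (f * cst c) ls = cf f ls * c"
  for f :: "'k::semiring_0 free_alg"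
proof -
  have "cf (f * cst c) ls = (\<Sum>i\<le>length ls. if i = length ls then cf f ls * c else 0)"
    unfolding cf_mult by (rule sum.cong) (auto simp: cf_cst)
  then show ?thesis by simp
qed

lemma cst_central: "cst c * f = f * cst c" for f :: "'k::field free_alg"
  by (rule free_alg_eqI) (simp add: mult.commute)

lemma cst_add: "cst (a + b) = cst a + cst b" for a :: "'k::field"
  by (simp add: cst_def single_add)

lemma cst_mult: "cst (a * b) = cst a * cst b" for a :: "'k::field"
  by (rule free_alg_eqI) (simp add: cf_cst)

lemma cst_1 [simp]: "cst 1 = (1 :: 'k::field free_alg)"
  by (rule free_alg_eqI) (simp add: cf_cst cf_one)

lemma cst_0 [simp]: "cst 0 = (0 :: 'k::field free_alg)"
  by (rule free_alg_eqI) (simp add: cf_cst)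

lemma cf_mult_Nil [simp]: "cf (f * g) [] = cf f [] * cf g []"
  for f g :: "'k::field free_alg"
  by (simp add: cf_mult)

lemma cf_mult_1: "cf (f * g) [l] = cf f [] * cf g [l] + cf f [l] * cf g []"
  for f g :: "'k::field free_alg"
  by (simp add: cf_mult)

lemma cf_mult_2: "cf (f * g) [l, m] = cf f [] * cf g [l, m] + cf f [l] * cf g [m] + cf f [l, m] * cf g []"
  for f g :: "'k::field free_alg"
  by (simp add: cf_mult numeral_2_eq_2)

lemma cf_mult_3: "cf (f * g) [l, m, n] = cf f [] * cf g [l, m, n] + cf f [l] * cf g [m, n]
    + cf f [l, m] * cf g [n] + cf f [l, m, n] * cf g []"
  for f g :: "'k::field free_alg"
  by (simp add: cf_mult numeral_3_eq_3)

text \<open>Right multiplication by a letter appends it to every word; looking at the last letter of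
  a word therefore undoes it.\<close>

lemma cf_mult_single_snoc:
  "cf (f * Poly_Mapping.single (Word [m]) c) (ls @ [l]) = (if l = m then cf f ls * c else 0)"
  for f :: "'k::semiring_0 free_alg"
proof (induction f rule: poly_mapping_add_induct)
  case (single w d)
  then show ?case by (cases w) (auto simp: mult_single cf_single plus_word_def)
qed (auto simp: lookup_add distrib_right)

lemma cf_mult_gx [simp]: "cf (f * gx) (ls @ [l]) = (if l = Lx then cf f ls else 0)"
  for f :: "'k::field free_alg"
  by (simp add: gx_def cf_mult_single_snoc)

lemma cf_mult_gy [simp]: "cf (f * gy) (ls @ [l]) = (if l = Ly then cf f ls else 0)"
  for f :: "'k::field free_alg"
  by (simp add: gy_def cf_mult_single_snoc)

section \<open>Homogeneous elements and the decomposition by the last letter\<close>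

lemma homogeneous_iff: "homogeneous n f \<longleftrightarrow> (\<forall>ls. length ls \<noteq> n \<longrightarrow> cf f ls = 0)"
  unfolding homogeneous_def by (metis in_keys_iff word.collapse word.sel)

lemma homogeneous_add: "homogeneous n f \<Longrightarrow> homogeneous n g \<Longrightarrow> homogeneous n (f + g)"
  for f :: "'k::field free_alg"
  by (simp add: homogeneous_iff lookup_add)

lemma homogeneous_cst: "homogeneous n f \<Longrightarrow> homogeneous n (cst c * f)"
  for f :: "'k::field free_alg"
  by (simp add: homogeneous_iff)

lemma homogeneous_mult: "homogeneous m f \<Longrightarrow> homogeneous n g \<Longrightarrow> homogeneous (m + n) (f * g)"
  for f :: "'k::field free_alg"
  unfolding homogeneous_def using keys_mult[of f g]
  by (fastforce simp: plus_word_def)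

lemma homogeneous_sum:
  "(\<And>i. i \<in> S \<Longrightarrow> homogeneous n (f i)) \<Longrightarrow> homogeneous n (\<Sum>i\<in>S. f i)"
  for f :: "'a \<Rightarrow> 'k::field free_alg"
  by (simp add: homogeneous_iff lookup_sum)

lemma homogeneous_gx [simp]: "homogeneous 1 (gx :: 'k::field free_alg)"
  by (auto simp: homogeneous_iff cf_gx)

lemma homogeneous_gy [simp]: "homogeneous 1 (gy :: 'k::field free_alg)"
  by (auto simp: homogeneous_iff cf_gy)

lemma homogeneous_0: "homogeneous n (0 :: 'k::field free_alg)"
  by (simp add: homogeneous_iff)

lemma length_3_cases:
  assumes "length ls = 3" obtains i j l where "ls = [i, j, l]"
  using assms by (metis length_0_conv length_Suc_conv numeral_3_eq_3)

lemma homogeneous_3_eqI: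
  assumes "homogeneous 3 f" "homogeneous 3 g" "\<And>i j l. cf f [i, j, l] = cf g [i, j, l]"
  shows "f = g"
proof (rule free_alg_eqI)
  fix ls show "cf f ls = cf g ls"
    using assms by (cases "length ls = 3") (auto elim: length_3_cases simp: homogeneous_iff)
qed

text \<open>Every nonempty word ends in a letter. This is the first step of the resolution of
  \<open>k\<close>: the augmentation ideal is generated by the letters as a left ideal.\<close>

lemma free_alg_split_last:
  fixes f :: "'k::field free_alg"
  assumes "cf f [] = 0"
  shows "\<exists>a b. f = a * gx + b * gy"
proof -
  \<comment> \<open>Subtracting the constant term makes the claim additive in \<open>f\<close>, as
    the induction requires.\<close>
  have "\<exists>a b. f - cst (cf f []) = a * gx + b * gy"
  proof (induction f rule: poly_mapping_add_induct)
    case zero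
    show ?case by (intro exI[of _ 0]) simp
  next
    case (single w c)
    obtain ls where w: "w = Word ls" by (metis word.exhaust)
    show ?case
    proof (cases ls rule: rev_cases)
      case Nil
      then show ?thesis
        by (intro exI[of _ 0]) (simp add: w cf_single cst_def)
    next
      case (snoc ms l)
      then show ?thesis
        by (cases l; intro exI[of _ "if l = Lx then Poly_Mapping.single (Word ms) c else 0"]
              exI[of _ "if l = Ly then Poly_Mapping.single (Word ms) c else 0"])
          (auto simp: w cf_single gx_def gy_def mult_single plus_word_def)
    qed
  next
    case (add f g)
    then obtain a b a' b' where "f - cst (cf f []) = a * gx + b * gy" "g - cst (cf g []) = a' * gx + b' * gy"
      by blast
    moreover have "f + g - cst (cf (f + g) []) = (f - cst (cf f [])) + (g - cst (cf g []))"
      by (simp add: lookup_add cst_add)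
    ultimately have "f + g - cst (cf (f + g) []) = (a + a') * gx + (b + b') * gy"
      by (simp only: distrib_right add_ac)
    then show ?case by blast
  qed
  then show ?thesis using assms by simp
qed

text \<open>The augmentation ideal is free on the two letters as a left module; this turns
  identities between elements into identities between entries of the matrix
  \<open>M\<close>.\<close>

lemma gx_gy_unique:
  fixes a b a' b' :: "'k::field free_alg"
  assumes "a * gx + b * gy = a' * gx + b' * gy"
  shows "a = a'" "b = b'"
proof -
  have "cf (a * gx + b * gy) (ls @ [l]) = cf (a' * gx + b' * gy) (ls @ [l])" for ls l
    using assms by simp
  then have *: "(if l = Lx then cf a ls else 0) + (if l = Ly then cf b ls else 0)
      = (if l = Lx then cf a' ls else 0) + (if l = Ly then cf b' ls else 0)" for ls l
    by (simp add: lookup_add)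
  show "a = a'" using *[of Lx] by (auto intro: free_alg_eqI)
  show "b = b'" using *[of Ly] by (auto intro: free_alg_eqI)
qed

subsection \<open>Substitutions\<close>

definition subst :: "(letter \<Rightarrow> 'k free_alg) \<Rightarrow> 'k::field free_alg \<Rightarrow> 'k free_alg" where
  "subst v f = (\<Sum>w\<in>Poly_Mapping.keys f. cst (Poly_Mapping.lookup f w) * prod_list (map v (letters w)))"

text \<open>Cancellation can make the support of a sum smaller than the union of the supports;
  summing over a common finite superset gives additivity of \<open>subst\<close>.\<close>

lemma subst_superset:
  assumes "finite S" "Poly_Mapping.keys f \<subseteq> S"
  shows "subst v f = (\<Sum>w\<in>S. cst (Poly_Mapping.lookup f w) * prod_list (map v (letters w)))"
  unfolding subst_def using assms
  by (intro sum.mono_neutral_left) (auto simp: in_keys_iff)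

lemma subst_add: "subst v (f + g) = subst v f + subst v g"
proof -
  let ?S = "Poly_Mapping.keys f \<union> Poly_Mapping.keys g"
  have "Poly_Mapping.keys (f + g) \<subseteq> ?S" by (rule keys_add)
  then show ?thesis
    by (simp add: subst_superset[of ?S] lookup_add cst_add distrib_right sum.distrib)
qed

lemma subst_0 [simp]: "subst v 0 = 0"
  by (simp add: subst_def)

lemma subst_single: "subst v (Poly_Mapping.single w c) = cst c * prod_list (map v (letters w))"
  by (subst subst_superset[of "{w}"]) auto

text \<open>Words are concatenated under multiplication, and the constant of the second factor moves
  to the front because constants are central.\<close>

lemma subst_mult: "subst v (f * g) = subst v f * subst v g"
proof (induction f rule: poly_mapping_add_induct)
  case (single w c)
  show ?case
  proof (induction g rule: poly_mapping_add_induct)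
    case (single w' d)
    show ?case
      by (simp add: mult_single subst_single plus_word_def cst_mult)
        (metis (no_types, lifting) cst_central mult.assoc)
  qed (auto simp: subst_add distrib_left)
qed (auto simp: subst_add distrib_right)

lemma subst_cst [simp]: "subst v (cst c) = cst c"
  by (simp add: cst_def subst_single)

lemma subst_1 [simp]: "subst v 1 = 1"
  using subst_cst[of v 1] by simp

lemma subst_gx [simp]: "subst v gx = v Lx"
  by (simp add: gx_def subst_single)

lemma subst_gy [simp]: "subst v gy = v Ly"
  by (simp add: gy_def subst_single)

lemma subst_power: "subst v (f ^ n) = subst v f ^ n"
  by (induction n) (auto simp: subst_mult)

lemma subst_minus: "subst v (f - g) = subst v f - subst v g"
  using subst_add[of v "f - g" g] by (simp add: algebra_simps)

lemma prod_list_homogeneous: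
  fixes v :: "letter \<Rightarrow> 'k::field free_alg"
  assumes "\<And>l. homogeneous 1 (v l)"
  shows "homogeneous (length ls) (prod_list (map v ls))"
proof (induction ls)
  case Nil
  then show ?case by (auto simp: homogeneous_iff cf_one)
next
  case (Cons a ls)
  then show ?case using homogeneous_mult[OF assms[of a]] by force
qed

lemma subst_homogeneous:
  assumes "\<And>l. homogeneous 1 (v l)" "homogeneous n f"
  shows "homogeneous n (subst v f)"
  unfolding subst_def
proof (rule homogeneous_sum)
  fix w assume "w \<in> Poly_Mapping.keys f"
  then have "length (letters w) = n" using assms(2) by (auto simp: homogeneous_def)
  then show "homogeneous n (cst (Poly_Mapping.lookup f w) * prod_list (map v (letters w)))"
    using prod_list_homogeneous[of v "letters w", OF assms(1)] by (auto intro: homogeneous_cst)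
qed

lemma subst_compose: "subst u (subst v f) = subst (\<lambda>l. subst u (v l)) f"
proof (induction f rule: poly_mapping_add_induct)
  case (single w c)
  have "subst u (prod_list (map v ls)) = prod_list (map (\<lambda>l. subst u (v l)) ls)" for ls
    by (induction ls) (auto simp: subst_mult)
  then show ?case by (simp add: subst_single subst_mult)
qed (auto simp: subst_add)

lemma subst_id: "v Lx = gx \<Longrightarrow> v Ly = gy \<Longrightarrow> subst v f = f"
proof (induction f rule: poly_mapping_add_induct)
  case (single w c)
  have v: "v l = Poly_Mapping.single (Word [l]) 1" for l
    using single by (cases l) (auto simp: gx_def gy_def)
  have "prod_list (map v ls) = Poly_Mapping.single (Word ls) 1" for ls
  proof (induction ls)
    case Nil
    then show ?case by (simp flip: single_one add: zero_word_def)
  next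
    case (Cons l ls)
    then show ?case by (simp add: v mult_single plus_word_def)
  qed
  then show ?case
    by (cases w) (simp add: subst_single cst_def mult_single plus_word_def)
qed (auto simp: subst_add)

section \<open>Two-sided ideals and presented algebras\<close>

abbreviation FA :: "'k::field free_alg ring" where
  "FA \<equiv> ring_of_type_algebra"

lemma FA_simps [simp]:
  "carrier (FA :: 'k::field free_alg ring) = UNIV"
  "monoid.mult (FA :: 'k free_alg ring) = (*)"
  "one (FA :: 'k free_alg ring) = 1"
  "zero (FA :: 'k free_alg ring) = 0"
  "add (FA :: 'k free_alg ring) = (+)"
  by (simp_all add: ring_of_type_algebra_def)

lemma ring_FA: "ring (FA :: 'k::field free_alg ring)"
proof -
  have "\<exists>y. y + x = 0 \<and> x + y = 0" for x :: "'k free_alg"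
    by (rule exI[of _ "- x"]) simp
  then show ?thesis
    unfolding ring_of_type_algebra_def
    by unfold_locales (auto simp: algebra_simps Units_def)
qed

text \<open>Closure under negation follows from multiplication by \<open>- 1\<close>, whence the
  short list of conditions.\<close>

lemma ideal_FA_iff:
  "ideal J (FA :: 'k::field free_alg ring) \<longleftrightarrow>
    0 \<in> J \<and> (\<forall>a\<in>J. \<forall>b\<in>J. a + b \<in> J) \<and> (\<forall>a\<in>J. \<forall>x. x * a \<in> J \<and> a * x \<in> J)"
  (is "?L \<longleftrightarrow> ?R")
proof
  assume ?L
  then interpret ideal J FA .
  show ?R
    using additive_subgroup.zero_closed[OF additive_subgroup_axioms]
      additive_subgroup.a_closed[OF additive_subgroup_axioms] I_l_closed I_r_closed
    by simp
next
  assume R: ?R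
  have neg: "- a \<in> J" if "a \<in> J" for a
    using R that by (metis mult_1 mult_minus_left)
  interpret ring "FA :: 'k free_alg ring" by (rule ring_FA)
  have inv: "\<ominus>\<^bsub>FA\<^esub> a = - a" for a :: "'k free_alg"
    by (rule minus_equality) auto
  show ?L
  proof (rule idealI[OF ring_FA])
    show "subgroup J (add_monoid FA)"
    proof (rule group.subgroupI[OF a_group])
      fix a assume "a \<in> J"
      then show "inv\<^bsub>add_monoid FA\<^esub> a \<in> J"
        unfolding a_inv_def[symmetric] inv by (rule neg)
    qed (use R in auto)
  qed (use R in auto)
qed

context
  fixes S :: "'k::field free_alg set"
begin

lemma genideal_FA_ideal: "ideal (genideal FA S) FA"
  by (rule ring.genideal_ideal[OF ring_FA]) simp

lemma genideal_FA_0: "0 \<in> genideal FA S"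
  and genideal_FA_add: "a \<in> genideal FA S \<Longrightarrow> b \<in> genideal FA S \<Longrightarrow> a + b \<in> genideal FA S"
  and genideal_FA_l: "a \<in> genideal FA S \<Longrightarrow> x * a \<in> genideal FA S"
  and genideal_FA_r: "a \<in> genideal FA S \<Longrightarrow> a * x \<in> genideal FA S"
  using genideal_FA_ideal by (auto simp: ideal_FA_iff)

lemma genideal_FA_diff: "a \<in> genideal FA S \<Longrightarrow> b \<in> genideal FA S \<Longrightarrow> a - b \<in> genideal FA S"
  using genideal_FA_add[of a "- 1 * b"] genideal_FA_l[of b "- 1"] by simp

lemma genideal_FA_gen: "s \<in> S \<Longrightarrow> s \<in> genideal FA S"
  using ring.genideal_self[OF ring_FA, of S] by auto

lemma genideal_FA_minimal: "ideal J FA \<Longrightarrow> S \<subseteq> J \<Longrightarrow> genideal FA S \<subseteq> J"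
  by (rule ring.genideal_minimal[OF ring_FA])

abbreviation cls :: "'k free_alg \<Rightarrow> 'k free_alg set" where
  "cls f \<equiv> genideal FA S +>\<^bsub>FA\<^esub> f"

lemma mem_cls_iff: "x \<in> cls f \<longleftrightarrow> x - f \<in> genideal FA S"
proof -
  have "x \<in> cls f \<longleftrightarrow> (\<exists>i\<in>genideal FA S. x = i + f)"
    by (auto simp: a_r_coset_def r_coset_def)
  also have "\<dots> \<longleftrightarrow> x - f \<in> genideal FA S"
    by (metis add_diff_cancel_right' diff_add_cancel)
  finally show ?thesis .
qed

lemma cls_eq_iff: "cls f = cls g \<longleftrightarrow> f - g \<in> genideal FA S"
proof
  assume eq: "cls f = cls g"
  have "f \<in> cls f" by (simp add: mem_cls_iff genideal_FA_0)
  then show "f - g \<in> genideal FA S" by (simp add: eq mem_cls_iff)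
next
  assume d: "f - g \<in> genideal FA S"
  have "x - f \<in> genideal FA S \<longleftrightarrow> x - g \<in> genideal FA S" for x
    using genideal_FA_add[OF _ d, of "x - f"] genideal_FA_diff[OF _ d, of "x - g"] by auto
  then show "cls f = cls g" by (auto simp: mem_cls_iff)
qed

lemma presented_carrier: "carrier (presented S) = range cls"
  by (auto simp: presented_def Let_def ring.defs graded_algebra.defs FactRing_def A_RCOSETS_def
      RCOSETS_def a_r_coset_def)

lemma presented_mult: "cls f \<otimes>\<^bsub>presented S\<^esub> cls g = cls (f * g)"
  using ideal.rcoset_mult_add[OF genideal_FA_ideal, of f g]
  by (simp add: presented_def Let_def ring.defs graded_algebra.defs FactRing_simps)

lemma presented_add: "cls f \<oplus>\<^bsub>presented S\<^esub> cls g = cls (f + g)"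
proof -
  interpret ideal "genideal FA S" FA by (rule genideal_FA_ideal)
  show ?thesis
    using a_rcos_sum[of f g]
    by (simp add: presented_def Let_def ring.defs graded_algebra.defs FactRing_simps)
qed

lemma presented_one: "\<one>\<^bsub>presented S\<^esub> = cls 1"
  by (simp add: presented_def Let_def ring.defs graded_algebra.defs FactRing_simps)

lemma presented_zero: "\<zero>\<^bsub>presented S\<^esub> = cls 0"
proof -
  have "cls 0 = genideal FA S"
    by (auto simp: mem_cls_iff)
  then show ?thesis
    by (simp add: presented_def Let_def ring.defs graded_algebra.defs FactRing_simps)
qed

lemma presented_scal: "scal (presented S) c = cls (cst c)"
  by (simp add: presented_def Let_def ring.defs graded_algebra.defs)

lemma presented_grade: "grade (presented S) n = {cls f | f. homogeneous n f}"
  by (simp add: presented_def Let_def ring.defs graded_algebra.defs)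

text \<open>\<open>presented S\<close> extends the record of the quotient ring by scalars and
  grades; the ring laws are carried over field by field.\<close>

lemma ring_presented: "ring (presented S)"
proof -
  interpret Q: ring "FA Quot genideal FA S"
    by (rule ideal.quotient_is_ring[OF genideal_FA_ideal])
  have eqs: "carrier (presented S) = carrier (FA Quot genideal FA S)"
    "monoid.mult (presented S) = monoid.mult (FA Quot genideal FA S)"
    "add (presented S) = add (FA Quot genideal FA S)"
    "\<one>\<^bsub>presented S\<^esub> = \<one>\<^bsub>FA Quot genideal FA S\<^esub>"
    "\<zero>\<^bsub>presented S\<^esub> = \<zero>\<^bsub>FA Quot genideal FA S\<^esub>"
    by (simp_all add: presented_def Let_def ring.defs graded_algebra.defs)
  show ?thesis
  proof (rule ringI)
    show "abelian_group (presented S)"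
    proof (rule abelian_groupI)
      fix x assume "x \<in> carrier (presented S)"
      then show "\<exists>y\<in>carrier (presented S). y \<oplus>\<^bsub>presented S\<^esub> x = \<zero>\<^bsub>presented S\<^esub>"
        using Q.l_neg by (auto simp: eqs)
    qed (auto simp: eqs Q.a_ac)
    show "Group.monoid (presented S)"
      by (rule monoidI) (auto simp: eqs Q.m_assoc)
  qed (auto simp: eqs Q.l_distr Q.r_distr)
qed

end

lemma genideal_FA_le:
  "S \<subseteq> genideal FA T \<Longrightarrow> genideal FA S \<subseteq> genideal FA T" for S :: "'k::field free_alg set"
  by (rule genideal_FA_minimal[OF genideal_FA_ideal])

text \<open>The record depends on \<open>S\<close> only through the ideal, which gives equality of
  the algebras and not merely an isomorphism.\<close>

lemma presented_cong:
  "S \<subseteq> genideal FA T \<Longrightarrow> T \<subseteq> genideal FA S \<Longrightarrow> presented S = presented T"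
  for S :: "'k::field free_alg set"
  using genideal_FA_le[of S T] genideal_FA_le[of T S] by (auto simp: presented_def)

text \<open>The zero of the quotient is the ideal itself.\<close>

lemma presented_eq_genideal:
  fixes S T :: "'k::field free_alg set"
  assumes "presented S = presented T"
  shows "genideal FA S = genideal FA T"
proof -
  have "genideal FA S = \<zero>\<^bsub>presented S\<^esub>" for S :: "'k free_alg set"
    by (simp add: presented_def Let_def ring.defs graded_algebra.defs FactRing_simps)
  then show ?thesis using assms by simp
qed

text \<open>The preimage of an ideal under the endomorphism \<open>subst v\<close> is again an
  ideal, and this one contains \<open>S\<close>.\<close>

lemma subst_genideal:
  fixes S :: "'k::field free_alg set"
  assumes "f \<in> genideal FA S"
  shows "subst v f \<in> genideal FA (subst v ` S)"
proof -
  have "ideal {f. subst v f \<in> genideal FA (subst v ` S)} FA"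
    by (auto simp: ideal_FA_iff genideal_FA_0 subst_add subst_mult
        intro: genideal_FA_add genideal_FA_l genideal_FA_r)
  then have "genideal FA S \<subseteq> {f. subst v f \<in> genideal FA (subst v ` S)}"
    by (rule genideal_FA_minimal) (auto intro: genideal_FA_gen)
  then show ?thesis using assms by auto
qed

text \<open>An automorphism of the free algebra maps cosets of the ideal to cosets of the image
  ideal, and sending letters to linear forms preserves degrees.\<close>

lemma presented_subst_iso:
  fixes S :: "'k::field free_alg set"
  assumes hom: "\<And>l. homogeneous 1 (v l)" "\<And>l. homogeneous 1 (v' l)"
    and inv: "\<And>f. subst v' (subst v f) = f" "\<And>f. subst v (subst v' f) = f"
  shows "presented S \<cong>\<^sub>g\<^sub>r presented (subst v ` S)"
proof -
  let ?T = "subst v ` S"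
  let ?h = "\<lambda>Z. subst v ` Z"
  have inj: "inj (subst v)" by (metis injI inv(1))
  have bwd: "subst v' f \<in> genideal FA S" if "f \<in> genideal FA ?T" for f
    using subst_genideal[OF that, of v'] by (simp add: image_image inv)
  have h: "?h (cls S f) = cls ?T (subst v f)" for f
  proof -
    have "subst v g \<in> ?h (cls S f) \<longleftrightarrow> subst v g \<in> cls ?T (subst v f)" for g
      using bwd[of "subst v (g - f)"] subst_genideal[of "g - f" S v]
      by (auto simp: inj_image_mem_iff[OF inj] mem_cls_iff inv simp flip: subst_minus)
    then show ?thesis by (metis inv(2) subsetI subset_antisym)
  qed
  have surj: "surj (subst v)" by (metis surjI inv(2))
  have "?h \<in> ring_iso (presented S) (presented ?T)"
  proof (rule ring_iso_memI)
    show "bij_betw ?h (carrier (presented S)) (carrier (presented ?T))"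
    proof (rule bij_betw_imageI)
      show "inj_on ?h (carrier (presented S))"
        by (rule inj_onI) (simp add: inj_image_eq_iff[OF inj])
      show "?h ` carrier (presented S) = carrier (presented ?T)"
      proof -
        have "?h ` range (cls S) = cls ?T ` range (subst v)" by (simp add: image_image h)
        then show ?thesis by (simp add: presented_carrier surj)
      qed
    qed
  next
    fix a b assume "a \<in> carrier (presented S)" "b \<in> carrier (presented S)"
    then obtain f g where fg: "a = cls S f" "b = cls S g" by (auto simp: presented_carrier)
    show "?h a \<in> carrier (presented ?T)"
      by (simp only: fg h) (simp add: presented_carrier)
    show "?h (a \<otimes>\<^bsub>presented S\<^esub> b) = ?h a \<otimes>\<^bsub>presented ?T\<^esub> ?h b"
      by (simp only: fg h presented_mult subst_mult)
    show "?h (a \<oplus>\<^bsub>presented S\<^esub> b) = ?h a \<oplus>\<^bsub>presented ?T\<^esub> ?h b"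
      by (simp only: fg h presented_add subst_add)
  qed (simp only: presented_one h subst_1)
  moreover have "?h (scal (presented S) c) = scal (presented ?T) c" for c
    by (simp add: presented_scal h)
  moreover have "?h ` grade (presented S) n = grade (presented ?T) n" for n
  proof -
    have *: "?h ` {cls S f | f. homogeneous n f} = {?h (cls S f) | f. homogeneous n f}"
      by blast
    show ?thesis
      unfolding presented_grade *
    proof (intro subset_antisym subsetI)
      fix t assume "t \<in> {?h (cls S f) | f. homogeneous n f}"
      then obtain f where "homogeneous n f" "t = ?h (cls S f)" by blast
      then show "t \<in> {cls ?T f | f. homogeneous n f}"
        using subst_homogeneous[of v, OF hom(1)] h by blast
    next
      fix t assume "t \<in> {cls ?T f | f. homogeneous n f}"
      then obtain f where f: "homogeneous n f" "t = cls ?T f" by blast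
      then have "t = ?h (cls S (subst v' f))" using h inv(2) by metis
      then show "t \<in> {?h (cls S f) | f. homogeneous n f}"
        using subst_homogeneous[of v', OF hom(2) f(1)] by blast
    qed
  qed
  ultimately show ?thesis unfolding graded_iso_def by blast
qed

section \<open>Projective modules and liftings\<close>

context left_module
begin

lemma smult_zero_left [simp]: "x \<in> carrier M \<Longrightarrow> \<zero>\<^bsub>R\<^esub> \<odot>\<^bsub>M\<^esub> x = \<zero>\<^bsub>M\<^esub>"
proof -
  assume x: "x \<in> carrier M"
  have "\<zero>\<^bsub>R\<^esub> \<odot>\<^bsub>M\<^esub> x = (\<zero>\<^bsub>R\<^esub> \<oplus>\<^bsub>R\<^esub> \<zero>\<^bsub>R\<^esub>) \<odot>\<^bsub>M\<^esub> x" by simp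
  also have "\<dots> = \<zero>\<^bsub>R\<^esub> \<odot>\<^bsub>M\<^esub> x \<oplus>\<^bsub>M\<^esub> \<zero>\<^bsub>R\<^esub> \<odot>\<^bsub>M\<^esub> x"
    using x by (intro smult_l_distr) auto
  finally show ?thesis
    using x by (metis M.add.r_cancel_one R.zero_closed smult_closed)
qed

lemma smult_zero_right [simp]: "a \<in> carrier R \<Longrightarrow> a \<odot>\<^bsub>M\<^esub> \<zero>\<^bsub>M\<^esub> = \<zero>\<^bsub>M\<^esub>"
  using smult_r_distr[of a "\<zero>\<^bsub>M\<^esub>" "\<zero>\<^bsub>M\<^esub>"]
  by (metis M.add.r_cancel_one M.l_zero M.zero_closed smult_closed)

end

lemma lmod_homD:
  assumes "f \<in> lmod_hom R M N"
  shows "x \<in> carrier M \<Longrightarrow> f x \<in> carrier N"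
    "\<lbrakk>x \<in> carrier M; y \<in> carrier M\<rbrakk> \<Longrightarrow> f (x \<oplus>\<^bsub>M\<^esub> y) = f x \<oplus>\<^bsub>N\<^esub> f y"
    "\<lbrakk>a \<in> carrier R; x \<in> carrier M\<rbrakk> \<Longrightarrow> f (a \<odot>\<^bsub>M\<^esub> x) = a \<odot>\<^bsub>N\<^esub> f x"
  using assms by (auto simp: lmod_hom_def)

lemma lmod_hom_zero:
  assumes "f \<in> lmod_hom R M N" "left_module R M" "left_module R N"
  shows "f \<zero>\<^bsub>M\<^esub> = \<zero>\<^bsub>N\<^esub>"
proof -
  interpret M: left_module R M by fact
  interpret N: left_module R N by fact
  have "f (\<zero>\<^bsub>R\<^esub> \<odot>\<^bsub>M\<^esub> \<zero>\<^bsub>M\<^esub>) = \<zero>\<^bsub>R\<^esub> \<odot>\<^bsub>N\<^esub> f \<zero>\<^bsub>M\<^esub>"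
    using assms(1) by (intro lmod_homD(3)) auto
  then show ?thesis using lmod_homD(1)[OF assms(1)] by simp
qed

text \<open>Homomorphisms to the regular left module, without the extensionality that
  \<open>lmod_hom\<close> demands, so that composites and components need no restriction.\<close>

definition lin_form :: "('a, 'r) ring_scheme \<Rightarrow> ('a, 'm) module \<Rightarrow> ('m \<Rightarrow> 'a) \<Rightarrow> bool" where
  "lin_form R P \<psi> \<longleftrightarrow> (\<forall>q\<in>carrier P. \<psi> q \<in> carrier R) \<and>
     (\<forall>q\<in>carrier P. \<forall>q'\<in>carrier P. \<psi> (q \<oplus>\<^bsub>P\<^esub> q') = \<psi> q \<oplus>\<^bsub>R\<^esub> \<psi> q') \<and>
     (\<forall>a\<in>carrier R. \<forall>q\<in>carrier P. \<psi> (a \<odot>\<^bsub>P\<^esub> q) = a \<otimes>\<^bsub>R\<^esub> \<psi> q)"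

lemma lin_formD:
  assumes "lin_form R P \<psi>"
  shows "q \<in> carrier P \<Longrightarrow> \<psi> q \<in> carrier R"
    "\<lbrakk>q \<in> carrier P; q' \<in> carrier P\<rbrakk> \<Longrightarrow> \<psi> (q \<oplus>\<^bsub>P\<^esub> q') = \<psi> q \<oplus>\<^bsub>R\<^esub> \<psi> q'"
    "\<lbrakk>a \<in> carrier R; q \<in> carrier P\<rbrakk> \<Longrightarrow> \<psi> (a \<odot>\<^bsub>P\<^esub> q) = a \<otimes>\<^bsub>R\<^esub> \<psi> q"
  using assms by (auto simp: lin_form_def)

lemma lin_form_zero:
  assumes "lin_form R P \<psi>" "left_module R P"
  shows "\<psi> \<zero>\<^bsub>P\<^esub> = \<zero>\<^bsub>R\<^esub>"
proof -
  interpret P: left_module R P by fact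
  have "\<psi> (\<zero>\<^bsub>R\<^esub> \<odot>\<^bsub>P\<^esub> \<zero>\<^bsub>P\<^esub>) = \<zero>\<^bsub>R\<^esub> \<otimes>\<^bsub>R\<^esub> \<psi> \<zero>\<^bsub>P\<^esub>"
    using assms(1) by (intro lin_formD(3)) auto
  then show ?thesis using lin_formD(1)[OF assms(1)] by simp
qed

lemma lin_form_comp:
  assumes "lin_form R N \<psi>" "f \<in> lmod_hom R P N"
  shows "lin_form R P (\<lambda>q. \<psi> (f q))"
  using lmod_homD[OF assms(2)] lin_formD[OF assms(1)] by (auto simp: lin_form_def)

text \<open>\<open>projective_lmod\<close> tests lifting against modules with carrier in
  \<open>nat \<Rightarrow> 'a\<close>; modules of vectors over the ring are put into this type as
  sequences.\<close>

definition seq_mod :: "('a, 'r) ring_scheme \<Rightarrow> (nat \<Rightarrow> 'a) set \<Rightarrow> ('a, nat \<Rightarrow> 'a) module" where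
  "seq_mod R U = \<lparr>carrier = U, monoid.mult = undefined, one = undefined, zero = (\<lambda>_. \<zero>\<^bsub>R\<^esub>),
     add = (\<lambda>v w n. v n \<oplus>\<^bsub>R\<^esub> w n), module.smult = (\<lambda>a v n. a \<otimes>\<^bsub>R\<^esub> v n)\<rparr>"

lemma seq_mod_simps [simp]:
  "carrier (seq_mod R U) = U" "\<zero>\<^bsub>seq_mod R U\<^esub> = (\<lambda>_. \<zero>\<^bsub>R\<^esub>)"
  "v \<oplus>\<^bsub>seq_mod R U\<^esub> w = (\<lambda>n. v n \<oplus>\<^bsub>R\<^esub> w n)" "a \<odot>\<^bsub>seq_mod R U\<^esub> v = (\<lambda>n. a \<otimes>\<^bsub>R\<^esub> v n)"
  by (simp_all add: seq_mod_def)

text \<open>Additive inverses are supplied by the scalar \<open>\<ominus> \<one>\<close>, so closure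
  under sums and scalars suffices.\<close>

lemma left_module_seq_mod:
  fixes R (structure)
  assumes "ring R" and U: "\<And>v n. v \<in> U \<Longrightarrow> v n \<in> carrier R"
    and "(\<lambda>_. \<zero>\<^bsub>R\<^esub>) \<in> U" and add: "\<And>v w. v \<in> U \<Longrightarrow> w \<in> U \<Longrightarrow> (\<lambda>n. v n \<oplus>\<^bsub>R\<^esub> w n) \<in> U"
    and smult: "\<And>a v. a \<in> carrier R \<Longrightarrow> v \<in> U \<Longrightarrow> (\<lambda>n. a \<otimes>\<^bsub>R\<^esub> v n) \<in> U"
  shows "left_module R (seq_mod R U)"
proof -
  interpret ring R by fact
  have "abelian_group (seq_mod R U)"
  proof (rule abelian_groupI)
    fix v assume "v \<in> carrier (seq_mod R U)"
    then have v: "v \<in> U" by simp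
    have "(\<lambda>n. (\<ominus> \<one>) \<otimes> v n) \<in> U" using v by (intro smult) auto
    moreover have "(\<lambda>n. (\<ominus> \<one>) \<otimes> v n \<oplus> v n) = (\<lambda>_. \<zero>)"
      using U[OF v] by (simp add: l_minus l_neg)
    ultimately show "\<exists>w\<in>carrier (seq_mod R U). w \<oplus>\<^bsub>seq_mod R U\<^esub> v = \<zero>\<^bsub>seq_mod R U\<^esub>"
      by auto
  qed (use assms in \<open>auto simp: a_ac\<close>)
  then show ?thesis
    by (intro left_module.intro left_module_axioms.intro \<open>ring R\<close>)
      (use U smult in \<open>auto simp: l_distr r_distr m_assoc\<close>)
qed

abbreviation pair_seq :: "('a, 'r) ring_scheme \<Rightarrow> 'a \<Rightarrow> 'a \<Rightarrow> nat \<Rightarrow> 'a" where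
  "pair_seq R a b \<equiv> (\<lambda>n. if n = 0 then a else if n = 1 then b else \<zero>\<^bsub>R\<^esub>)"

text \<open>The free left module of rank two.\<close>

definition pair_set :: "('a, 'r) ring_scheme \<Rightarrow> (nat \<Rightarrow> 'a) set" where
  "pair_set R = {pair_seq R a b | a b. a \<in> carrier R \<and> b \<in> carrier R}"

lemma pair_setE:
  assumes "v \<in> pair_set R"
  obtains a b where "a \<in> carrier R" "b \<in> carrier R" "v = pair_seq R a b"
  using assms by (auto simp: pair_set_def)

lemma pair_set_iff: "v \<in> pair_set R \<longleftrightarrow> v 0 \<in> carrier R \<and> v 1 \<in> carrier R \<and> (\<forall>n\<ge>2. v n = \<zero>\<^bsub>R\<^esub>)"
proof
  assume *: "v 0 \<in> carrier R \<and> v 1 \<in> carrier R \<and> (\<forall>n\<ge>2. v n = \<zero>\<^bsub>R\<^esub>)"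
  then have "v = pair_seq R (v 0) (v 1)"
  proof (intro ext)
    fix n :: nat
    consider "n = 0" | "n = 1" | "n \<ge> 2" by linarith
    then show "v n = pair_seq R (v 0) (v 1) n" using * by cases auto
  qed
  then show "v \<in> pair_set R" using * unfolding pair_set_def by blast
qed (auto simp: pair_set_def)

lemma left_module_pair_set: "ring R \<Longrightarrow> left_module R (seq_mod R (pair_set R))"
proof -
  assume "ring R"
  then interpret ring R .
  show ?thesis
  proof (rule left_module_seq_mod[OF \<open>ring R\<close>])
    fix v n assume "v \<in> pair_set R"
    then show "v n \<in> carrier R" by (auto elim!: pair_setE)
  qed (auto simp: pair_set_iff)
qed

text \<open>\<open>d\<close> multiplies row vectors from the right by the matrix with entries
  \<open>n11\<close>, \<open>n12\<close>, \<open>n21\<close>, \<open>n22\<close>, which commutes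
  with left scalars. Hypothesis \<open>ex\<close> says that \<open>(\<psi>1, \<psi>2)\<close> lands
  in the image of \<open>d\<close>, and its lift to the free module has the components
  \<open>\<chi>1\<close>, \<open>\<chi>2\<close>. This is one step in building a chain map out of a
  projective resolution.\<close>

lemma projective_lift_pair:
  fixes R :: "('a, 'r) ring_scheme" (structure) and P :: "('a, nat \<Rightarrow> 'a) module"
  assumes R: "ring R" and P: "projective_lmod R P"
    and lf: "lin_form R P \<psi>1" "lin_form R P \<psi>2"
    and n: "n11 \<in> carrier R" "n12 \<in> carrier R" "n21 \<in> carrier R" "n22 \<in> carrier R"
    and ex: "\<And>q. q \<in> carrier P \<Longrightarrow> \<exists>a\<in>carrier R. \<exists>b\<in>carrier R.
      \<psi>1 q = a \<otimes>\<^bsub>R\<^esub> n11 \<oplus>\<^bsub>R\<^esub> b \<otimes>\<^bsub>R\<^esub> n21 \<and> \<psi>2 q = a \<otimes>\<^bsub>R\<^esub> n12 \<oplus>\<^bsub>R\<^esub> b \<otimes>\<^bsub>R\<^esub> n22"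
  obtains \<chi>1 \<chi>2 where "lin_form R P \<chi>1" "lin_form R P \<chi>2"
    "\<And>q. q \<in> carrier P \<Longrightarrow> \<psi>1 q = \<chi>1 q \<otimes>\<^bsub>R\<^esub> n11 \<oplus>\<^bsub>R\<^esub> \<chi>2 q \<otimes>\<^bsub>R\<^esub> n21"
    "\<And>q. q \<in> carrier P \<Longrightarrow> \<psi>2 q = \<chi>1 q \<otimes>\<^bsub>R\<^esub> n12 \<oplus>\<^bsub>R\<^esub> \<chi>2 q \<otimes>\<^bsub>R\<^esub> n22"
proof -
  interpret ring R by fact
  define V where "V = pair_set R"
  define d where "d = (\<lambda>v::nat \<Rightarrow> 'a. pair_seq R (v 0 \<otimes> n11 \<oplus> v 1 \<otimes> n21) (v 0 \<otimes> n12 \<oplus> v 1 \<otimes> n22))"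
  define f where "f = (\<lambda>q\<in>carrier P. pair_seq R (\<psi>1 q) (\<psi>2 q))"
  have V: "v 0 \<in> carrier R" "v 1 \<in> carrier R" "n \<ge> 2 \<Longrightarrow> v n = \<zero>" if "v \<in> V" for v n
    using that by (auto simp: V_def pair_set_iff)
  have d_add: "(\<lambda>n. d v n \<oplus> d w n) = d (\<lambda>n. v n \<oplus> w n)" if "v \<in> V" "w \<in> V" for v w
    using V[OF that(1)] V[OF that(2)] n
    by (auto simp: d_def l_distr a_ac)
  have d_smult: "(\<lambda>n. a \<otimes> d v n) = d (\<lambda>n. a \<otimes> v n)" if "v \<in> V" "a \<in> carrier R" for v a
    using V[OF that(1)] that(2) n
    by (auto simp: d_def r_distr m_assoc)
  have mV: "left_module R (seq_mod R V)"
    unfolding V_def by (rule left_module_pair_set[OF R])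
  have V_add: "(\<lambda>n. v n \<oplus> w n) \<in> V" if "v \<in> V" "w \<in> V" for v w
    using that unfolding V_def pair_set_iff by auto
  have V_smult: "(\<lambda>n. a \<otimes> v n) \<in> V" if "v \<in> V" "a \<in> carrier R" for v a
    using that unfolding V_def pair_set_iff by auto
  have V_zero: "(\<lambda>_. \<zero>) \<in> V"
    unfolding V_def pair_set_iff by auto
  \<comment> \<open>The target is the image of \<open>d\<close>, so that \<open>d\<close> becomes
    the epimorphism that projectivity asks for.\<close>
  have mN: "left_module R (seq_mod R (d ` V))"
  proof (rule left_module_seq_mod[OF R])
    fix v n assume "v \<in> d ` V"
    then show "v n \<in> carrier R" using V n by (auto simp: d_def)
  next
    have "d (\<lambda>_. \<zero>) = (\<lambda>_. \<zero>)" using n by (auto simp: d_def)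
    then show "(\<lambda>_. \<zero>) \<in> d ` V" using V_zero by (metis image_eqI)
  next
    fix v w assume "v \<in> d ` V" "w \<in> d ` V"
    then obtain v' w' where "v' \<in> V" "w' \<in> V" "v = d v'" "w = d w'" by auto
    then show "(\<lambda>n. v n \<oplus> w n) \<in> d ` V" using d_add V_add by simp
  next
    fix a v assume "a \<in> carrier R" "v \<in> d ` V"
    then obtain v' where "v' \<in> V" "v = d v'" by auto
    then show "(\<lambda>n. a \<otimes> v n) \<in> d ` V" using d_smult V_smult \<open>a \<in> carrier R\<close> by simp
  qed
  have d_hom: "restrict d V \<in> lmod_hom R (seq_mod R V) (seq_mod R (d ` V))"
    using d_add d_smult V_add V_smult by (auto simp: lmod_hom_def)
  have f_V: "pair_seq R (\<psi>1 q) (\<psi>2 q) \<in> d ` V" if q: "q \<in> carrier P" for q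
  proof -
    obtain a b where ab: "a \<in> carrier R" "b \<in> carrier R"
      "\<psi>1 q = a \<otimes> n11 \<oplus> b \<otimes> n21" "\<psi>2 q = a \<otimes> n12 \<oplus> b \<otimes> n22"
      using ex[OF q] by blast
    then have "pair_seq R (\<psi>1 q) (\<psi>2 q) = d (pair_seq R a b)"
      by (auto simp: d_def)
    then show ?thesis using ab by (auto simp: V_def pair_set_iff)
  qed
  interpret P: left_module R P using P by (simp add: projective_lmod_def)
  have f_hom: "f \<in> lmod_hom R P (seq_mod R (d ` V))"
    using f_V lin_formD[OF lf(1)] lin_formD[OF lf(2)]
    by (auto simp: lmod_hom_def f_def P.smult_closed)
  obtain h where h: "h \<in> lmod_hom R P (seq_mod R V)" "\<And>q. q \<in> carrier P \<Longrightarrow> restrict d V (h q) = f q"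
    using P mV mN d_hom f_hom unfolding projective_lmod_def
    by (metis image_restrict_eq seq_mod_simps(1))
  have hV: "h q \<in> V" if "q \<in> carrier P" for q
    using lmod_homD(1)[OF h(1) that] by simp
  have lin_h: "lin_form R P (\<lambda>q. h q i)" if "i < 2" for i
  proof -
    have "i = 0 \<or> i = 1" using that by auto
    then show ?thesis
      using V hV lmod_homD(2,3)[OF h(1)] unfolding lin_form_def by (auto simp del: One_nat_def)
  qed
  have eq: "d (h q) = pair_seq R (\<psi>1 q) (\<psi>2 q)" if "q \<in> carrier P" for q
    using h(2)[OF that] hV[OF that] that by (simp add: f_def)
  show thesis
  proof (rule that[of "\<lambda>q. h q 0" "\<lambda>q. h q 1"])
    fix q assume q: "q \<in> carrier P"
    show "\<psi>1 q = h q 0 \<otimes> n11 \<oplus> h q 1 \<otimes> n21"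
      using fun_cong[OF eq[OF q], of 0] by (simp add: d_def)
    show "\<psi>2 q = h q 0 \<otimes> n12 \<oplus> h q 1 \<otimes> n22"
      using fun_cong[OF eq[OF q], of 1] by (simp add: d_def)
  qed (use lin_h in auto)
qed

section \<open>Algebras with relations of degree at least three\<close>

text \<open>If a word is shorter than \<open>n\<close>, so are both parts of every cut of it; each
  term of \<open>cf_mult\<close> then contains a vanishing coefficient.\<close>

lemma ideal_low_degree: "ideal {f. \<forall>ls. length ls < n \<longrightarrow> cf f ls = 0} (FA :: 'k::field free_alg ring)"
  unfolding ideal_FA_iff
proof (intro conjI ballI allI)
  fix a x :: "'k free_alg" assume a: "a \<in> {f. \<forall>ls. length ls < n \<longrightarrow> cf f ls = 0}"
  show "x * a \<in> {f. \<forall>ls. length ls < n \<longrightarrow> cf f ls = 0}"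
    using a by (auto simp: cf_mult intro!: sum.neutral)
  show "a * x \<in> {f. \<forall>ls. length ls < n \<longrightarrow> cf f ls = 0}"
    using a by (auto simp: cf_mult intro!: sum.neutral)
qed (auto simp: lookup_add)

text \<open>With all relations in degree three the quotient coincides with the free algebra through
  degree two; coefficients of words up to that length take the place of a grading on
  modules.\<close>

locale cubic_presented =
  fixes S :: "'k::field free_alg set"
  assumes cubic: "s \<in> S \<Longrightarrow> homogeneous 3 s"
begin

abbreviation A where "A \<equiv> presented S"
abbreviation cl where "cl \<equiv> cls S"

text \<open>Well defined on cosets only for words of length at most two.\<close>

definition low :: "'k free_alg set \<Rightarrow> letter list \<Rightarrow> 'k" where
  "low a ls = cf (SOME f. a = cl f) ls"

lemma genideal_low: "f \<in> genideal FA S \<Longrightarrow> length ls \<le> 2 \<Longrightarrow> cf f ls = 0"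
  using genideal_FA_minimal[OF ideal_low_degree[of 3], of S] cubic
  by (force simp: homogeneous_iff)

lemma low_cl [simp]: "length ls \<le> 2 \<Longrightarrow> low (cl f) ls = cf f ls"
proof -
  assume ls: "length ls \<le> 2"
  have "cl f = cl (SOME g. cl f = cl g)" by (rule someI[of _ f]) simp
  then have "f - (SOME g. cl f = cl g) \<in> genideal FA S" by (simp only: cls_eq_iff)
  from genideal_low[OF this ls] show ?thesis by (simp add: low_def lookup_minus)
qed

lemma carrierE: assumes "a \<in> carrier A" obtains f where "a = cl f"
  using assms by (auto simp: presented_carrier)

lemma cl_carrier [simp]: "cl f \<in> carrier A"
  by (simp add: presented_carrier)

lemma low_add: "a \<in> carrier A \<Longrightarrow> b \<in> carrier A \<Longrightarrow> length ls \<le> 2 \<Longrightarrow>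
    low (a \<oplus>\<^bsub>A\<^esub> b) ls = low a ls + low b ls"
  by (auto elim!: carrierE simp: presented_add lookup_add)

lemma low_zero: "length ls \<le> 2 \<Longrightarrow> low \<zero>\<^bsub>A\<^esub> ls = 0"
  by (simp add: presented_zero)

lemma low_mult_0: "a \<in> carrier A \<Longrightarrow> b \<in> carrier A \<Longrightarrow> low (a \<otimes>\<^bsub>A\<^esub> b) [] = low a [] * low b []"
  by (auto elim!: carrierE simp: presented_mult)

lemma low_mult_1: "a \<in> carrier A \<Longrightarrow> b \<in> carrier A \<Longrightarrow>
    low (a \<otimes>\<^bsub>A\<^esub> b) [l] = low a [] * low b [l] + low a [l] * low b []"
  by (auto elim!: carrierE simp: presented_mult cf_mult_1)

lemma low_mult_2: "a \<in> carrier A \<Longrightarrow> b \<in> carrier A \<Longrightarrow>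
    low (a \<otimes>\<^bsub>A\<^esub> b) [l, m] = low a [] * low b [l, m] + low a [l] * low b [m] + low a [l, m] * low b []"
  by (auto elim!: carrierE simp: presented_mult cf_mult_2)

text \<open>A scalar stored as the class of a constant at index 0. As an element of
  \<open>pair_set A\<close> it is its own preimage under the augmentation \<open>d\<close> in
  \<open>projective_lift_residue\<close>.\<close>

definition kseq :: "'k \<Rightarrow> nat \<Rightarrow> 'k free_alg set" where
  "kseq c = pair_seq A (cl (cst c)) \<zero>\<^bsub>A\<^esub>"

text \<open>The residue module \<open>k\<close>, with carrier in the type over which \<^const>\<open>gldim\<close> ranges.\<close>

definition kmod :: "('k free_alg set, nat \<Rightarrow> 'k free_alg set) module" where
  "kmod = \<lparr>carrier = range kseq, monoid.mult = undefined, one = undefined, zero = kseq 0,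
     add = (\<lambda>v w. kseq (low (v 0) [] + low (w 0) [])),
     module.smult = (\<lambda>a v. kseq (low a [] * low (v 0) []))\<rparr>"

lemma kseq_0 [simp]: "low (kseq c 0) [] = c"
  by (simp add: kseq_def cf_cst)

lemma kmod_simps [simp]:
  "carrier kmod = range kseq" "\<zero>\<^bsub>kmod\<^esub> = kseq 0"
  "v \<oplus>\<^bsub>kmod\<^esub> w = kseq (low (v 0) [] + low (w 0) [])"
  "a \<odot>\<^bsub>kmod\<^esub> v = kseq (low a [] * low (v 0) [])"
  by (simp_all add: kmod_def)

lemma ring_A: "ring A" by (rule ring_presented)

lemma left_module_kmod: "left_module A kmod"
proof -
  interpret ring A by (rule ring_A)
  have "abelian_group kmod"
  proof (rule abelian_groupI)
    fix x assume "x \<in> carrier kmod"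
    then obtain c where "x = kseq c" by auto
    then show "\<exists>y\<in>carrier kmod. y \<oplus>\<^bsub>kmod\<^esub> x = \<zero>\<^bsub>kmod\<^esub>"
      by (intro bexI[of _ "kseq (- c)"]) auto
  qed (auto simp: add_ac)
  then show ?thesis
    by (intro left_module.intro left_module_axioms.intro ring_A)
      (auto simp: low_add low_mult_0 algebra_simps presented_one cf_one)
qed

text \<open>\<open>\<phi>\<close> is a homomorphism from \<open>P\<close> to the residue module,
  with values written in the field. It is lifted along the augmentation \<open>d\<close> of the free
  module of rank two, and \<open>\<psi>\<close> is the lift at index 0.\<close>

lemma projective_lift_residue:
  fixes P :: "('k free_alg set, nat \<Rightarrow> 'k free_alg set) module"
  assumes P: "projective_lmod A P"
    and add: "\<And>q q'. q \<in> carrier P \<Longrightarrow> q' \<in> carrier P \<Longrightarrow> \<phi> (q \<oplus>\<^bsub>P\<^esub> q') = \<phi> q + \<phi> q'"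
    and smult: "\<And>a q. a \<in> carrier A \<Longrightarrow> q \<in> carrier P \<Longrightarrow> \<phi> (a \<odot>\<^bsub>P\<^esub> q) = low a [] * \<phi> q"
  obtains \<psi> where "lin_form A P \<psi>" "\<And>q. q \<in> carrier P \<Longrightarrow> low (\<psi> q) [] = \<phi> q"
proof -
  interpret ring A by (rule ring_A)
  interpret P: left_module A P using P by (simp add: projective_lmod_def)
  define V where "V = pair_set A"
  define d where "d = (\<lambda>v\<in>V. kseq (low (v 0) []))"
  define f where "f = (\<lambda>q\<in>carrier P. kseq (\<phi> q))"
  have mV: "left_module A (seq_mod A V)"
    unfolding V_def by (rule left_module_pair_set[OF ring_A])
  have V: "v 0 \<in> carrier A" if "v \<in> V" for v
    using that by (auto simp: V_def pair_set_iff)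
  have V_add: "(\<lambda>n. v n \<oplus>\<^bsub>A\<^esub> w n) \<in> V" if "v \<in> V" "w \<in> V" for v w
    using that unfolding V_def pair_set_iff by auto
  have V_smult: "(\<lambda>n. a \<otimes>\<^bsub>A\<^esub> v n) \<in> V" if "v \<in> V" "a \<in> carrier A" for v a
    using that unfolding V_def pair_set_iff by auto
  have d_hom: "d \<in> lmod_hom A (seq_mod A V) kmod"
    by (auto simp: lmod_hom_def d_def V V_add V_smult low_add low_mult_0)
  have surj: "d ` V = range kseq"
  proof
    show "range kseq \<subseteq> d ` V"
    proof safe
      fix c
      have "kseq c \<in> V" by (auto simp: V_def pair_set_iff kseq_def)
      then have "d (kseq c) = kseq c" by (simp add: d_def)
      then show "kseq c \<in> d ` V" using \<open>kseq c \<in> V\<close> by (metis image_eqI)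
    qed
  qed (auto simp: d_def)
  have f_hom: "f \<in> lmod_hom A P kmod"
    using add smult by (auto simp: lmod_hom_def f_def P.smult_closed)
  obtain h where h: "h \<in> lmod_hom A P (seq_mod A V)" "\<And>q. q \<in> carrier P \<Longrightarrow> d (h q) = f q"
    using P mV left_module_kmod d_hom f_hom surj unfolding projective_lmod_def
    by (metis kmod_simps(1) seq_mod_simps(1))
  have hV: "h q \<in> V" if "q \<in> carrier P" for q
    using lmod_homD(1)[OF h(1) that] by simp
  show thesis
  proof (rule that[of "\<lambda>q. h q 0"])
    show "lin_form A P (\<lambda>q. h q 0)"
      using V hV lmod_homD(2,3)[OF h(1)] unfolding lin_form_def by auto
    fix q assume q: "q \<in> carrier P"
    have "kseq (low (h q 0) []) = kseq (\<phi> q)"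
      using h(2)[OF q] hV[OF q] q by (simp add: d_def f_def)
    then show "low (h q 0) [] = \<phi> q" by (metis kseq_0)
  qed
qed

lemma low_0_split:
  assumes "a \<in> carrier A" "low a [] = 0"
  shows "\<exists>b\<in>carrier A. \<exists>c\<in>carrier A. a = b \<otimes>\<^bsub>A\<^esub> cl gx \<oplus>\<^bsub>A\<^esub> c \<otimes>\<^bsub>A\<^esub> cl gy"
proof -
  obtain f where f: "a = cl f" using assms(1) by (rule carrierE)
  then have "cf f [] = 0" using assms(2) by simp
  then obtain u v where "f = u * gx + v * gy" using free_alg_split_last by blast
  then have "a = cl u \<otimes>\<^bsub>A\<^esub> cl gx \<oplus>\<^bsub>A\<^esub> cl v \<otimes>\<^bsub>A\<^esub> cl gy"
    by (simp add: f presented_mult presented_add)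
  then show ?thesis by (intro bexI[of _ "cl u"] bexI[of _ "cl v"]) auto
qed

lemma cl_eq_0: "f \<in> genideal FA S \<Longrightarrow> cl f = \<zero>\<^bsub>A\<^esub>"
  by (simp add: presented_zero cls_eq_iff)

end

text \<open>Let \<open>I\<close> be the ideal. In \<open>a * x\<close> with \<open>a\<close> in
  \<open>I\<close>, the constant part of \<open>x\<close> can be moved to the left, while the rest
  of \<open>x\<close> ends in a letter and contributes to \<open>I * gx + I * gy\<close>. Hence
  modulo \<open>I * gx + I * gy\<close> only left multiples of \<open>g\<close> and \<open>h\<close>
  remain; this is what makes the complex \<open>A^2 -> A^2 -> A\<close> of \<open>k\<close> exact in
  the middle.\<close>

lemma genideal_pair_cases:
  fixes g h :: "'k::field free_alg"
  assumes f: "f \<in> genideal FA {g, h}"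
  shows "\<exists>u v. \<exists>i\<in>genideal FA {g, h}. \<exists>j\<in>genideal FA {g, h}. f = u * g + v * h + i * gx + j * gy"
proof -
  let ?I = "genideal FA {g, h}"
  let ?J = "{f. \<exists>u v. \<exists>i\<in>?I. \<exists>j\<in>?I. f = u * g + v * h + i * gx + j * gy}"
  have JI: "f \<in> ?I" if J: "f \<in> ?J" for f
  proof -
    obtain u v i j where "i \<in> ?I" "j \<in> ?I" "f = u * g + v * h + i * gx + j * gy"
      using J by blast
    then show ?thesis
      by (simp add: genideal_FA_add genideal_FA_l genideal_FA_r genideal_FA_gen)
  qed
  have "ideal ?J FA"
    unfolding ideal_FA_iff
  proof (intro conjI ballI allI)
    show "0 \<in> ?J"
      using genideal_FA_0 by (auto intro!: exI[of _ 0] bexI[of _ 0])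
  next
    fix a b assume "a \<in> ?J" "b \<in> ?J"
    then obtain u v i j u' v' i' j' where ij: "i \<in> ?I" "j \<in> ?I" "i' \<in> ?I" "j' \<in> ?I"
      and "a = u * g + v * h + i * gx + j * gy" "b = u' * g + v' * h + i' * gx + j' * gy"
      by blast
    then have "a + b = (u + u') * g + (v + v') * h + (i + i') * gx + (j + j') * gy"
      by (simp add: algebra_simps)
    moreover have "i + i' \<in> ?I" "j + j' \<in> ?I" using ij by (auto intro: genideal_FA_add)
    ultimately show "a + b \<in> ?J" by blast
  next
    fix a x assume "a \<in> ?J"
    then obtain u v i j where ij: "i \<in> ?I" "j \<in> ?I" and a: "a = u * g + v * h + i * gx + j * gy"
      by blast
    then have "x * a = (x * u) * g + (x * v) * h + (x * i) * gx + (x * j) * gy"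
      by (simp add: algebra_simps)
    moreover have "x * i \<in> ?I" "x * j \<in> ?I" using ij by (auto intro: genideal_FA_l)
    ultimately show "x * a \<in> ?J" by blast
    define c where "c = cf x []"
    have "cf (x - cst c) [] = 0" by (simp add: c_def lookup_minus cf_cst)
    then obtain y z where "x - cst c = y * gx + z * gy" using free_alg_split_last by blast
    then have x: "x = cst c + (y * gx + z * gy)" by (simp add: algebra_simps)
    have "a * x = cst c * a + a * (y * gx + z * gy)"
      by (simp add: x distrib_left cst_central)
    also have "\<dots> = (cst c * u) * g + (cst c * v) * h + (cst c * i + a * y) * gx + (cst c * j + a * z) * gy"
      by (subst (1) a) (simp add: algebra_simps)
    finally have "a * x = (cst c * u) * g + (cst c * v) * h + (cst c * i + a * y) * gx + (cst c * j + a * z) * gy" .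
    moreover have "cst c * i + a * y \<in> ?I" "cst c * j + a * z \<in> ?I"
      using ij JI[OF \<open>a \<in> ?J\<close>] by (auto intro!: genideal_FA_add intro: genideal_FA_l genideal_FA_r)
    ultimately show "a * x \<in> ?J" by blast
  qed
  moreover have "{g, h} \<subseteq> ?J"
  proof -
    have "g = 1 * g + 0 * h + 0 * gx + 0 * gy" "h = 0 * g + 1 * h + 0 * gx + 0 * gy" by simp_all
    then show ?thesis using genideal_FA_0[of "{g, h}"] by blast
  qed
  ultimately show ?thesis using genideal_FA_minimal f by blast
qed

section \<open>A cubic algebra with a relation that is a cube\<close>

lemma homogeneous_cf_3:
  fixes u :: "'k::field free_alg"
  assumes "homogeneous 3 (u * gx + v * gy)"
  shows "cf (u * gx + v * gy) [i, j, l] = (if l = Lx then cf u [i, j] else cf v [i, j])"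
  using cf_mult_gx[of u "[i, j]" l] cf_mult_gy[of v "[i, j]" l] letter.exhaust[of l]
  by (auto simp: lookup_add)

text \<open>If \<open>Y\<^sup>3\<close> is a relation, then \<open>(0, Y)\<close> is a third syzygy of \<open>k\<close> of minimal degree, and it
  is killed by \<open>Y\<^sup>2 \<noteq> 0\<close>; such an element cannot exist in a projective graded module.  The syzygy is
  compared with an arbitrary projective resolution \<open>P\<close> of \<open>k\<close> of length at most three: it is
  pushed to an element \<open>p3\<close> of \<open>P 3\<close> with \<open>Y\<^sup>2 p3 = 0\<close>, and \<open>\<phi>\<close> is a linear map from \<open>P 3\<close> to \<open>k\<close> with
  \<open>\<phi> p3 \<noteq> 0\<close>, whose lift to \<open>A\<close> gives the contradiction.\<close>

lemma gldim_cube_relation: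
  fixes g Y :: "'k::field free_alg"
  assumes g: "homogeneous 3 g" and Y: "homogeneous 1 Y" "Y \<noteq> 0"
    and indep: "\<And>a b. cst a * g + cst b * Y ^ 3 = 0 \<Longrightarrow> a = 0 \<and> b = 0"
  shows "gldim (presented {g, Y ^ 3}) \<noteq> 3"
proof
  define S where "S = {g, Y ^ 3}"
  have Y3: "Y ^ 3 = Y * (Y * Y)" by (simp add: power3_eq_cube mult.assoc)
  have hY3: "homogeneous 3 (Y ^ 3)"
    using homogeneous_mult[OF Y(1) homogeneous_mult[OF Y(1) Y(1)]]
    unfolding Y3 by (simp only: one_add_one numeral_3_eq_3) (simp add: numeral_2_eq_2)
  interpret cubic_presented S by unfold_locales (use g hY3 in \<open>auto simp: S_def\<close>)
  interpret R: ring A by (rule ring_A)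
  assume "gldim (presented {g, Y ^ 3}) = 3"
  then have gl: "gldim A = 3" by (simp add: S_def)
  have "proj_dim A kmod \<le> 3"
    unfolding gl[symmetric] gldim_def by (rule SUP_upper) (simp add: left_module_kmod)
  \<comment> \<open>A strict bound on the infimum yields an actual resolution, vanishing from index
    4 on.\<close>
  then have "proj_dim A kmod < 4" by (rule order_le_less_trans) (simp add: numeral_eq_enat)
  then obtain n P bd \<epsilon> where "enat n < 4" and res: "projective_resolution A P bd \<epsilon> kmod"
    and Pn: "\<And>i. i > n \<Longrightarrow> carrier (P i) = {\<zero>\<^bsub>P i\<^esub>}"
    unfolding proj_dim_def INF_less_iff by blast
  then have P4: "carrier (P 4) = {\<zero>\<^bsub>P 4\<^esub>}" by (simp add: numeral_eq_enat)
  have proj: "projective_lmod A (P i)" for i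
    using res by (simp add: projective_resolution_def)
  have mod: "left_module A (P i)" for i
    using proj[of i] by (simp add: projective_lmod_def)
  interpret M0: left_module A "P 0" by (rule mod)
  interpret M1: left_module A "P 1" by (rule mod)
  interpret M2: left_module A "P 2" by (rule mod)
  interpret M3: left_module A "P 3" by (rule mod)
  have num: "Suc 0 = 1" "Suc 1 = 2" "Suc 2 = 3" "Suc 3 = 4" by simp_all
  have bd_all: "bd i \<in> lmod_hom A (P (Suc i)) (P i)"
    and ex_all: "{x \<in> carrier (P (Suc i)). bd i x = \<zero>\<^bsub>P i\<^esub>} = bd (Suc i) ` carrier (P (Suc (Suc i)))" for i
    using res unfolding projective_resolution_def by blast+
  have \<epsilon>: "\<epsilon> \<in> lmod_hom A (P 0) kmod" "\<epsilon> ` carrier (P 0) = range kseq"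
    and ex0: "{x \<in> carrier (P 0). \<epsilon> x = kseq 0} = bd 0 ` carrier (P 1)"
    using res unfolding projective_resolution_def by simp_all
  note bd = bd_all[of 0, unfolded num] bd_all[of 1, unfolded num] bd_all[of 2, unfolded num]
    bd_all[of 3, unfolded num]
  note ex = ex_all[of 0, unfolded num] ex_all[of 1, unfolded num] ex_all[of 2, unfolded num]
  note bdc = lmod_homD[OF bd(1)] lmod_homD[OF bd(2)] lmod_homD[OF bd(3)]

  obtain m11 m12 where gm: "g = m11 * gx + m12 * gy"
    using free_alg_split_last[of g] g by (auto simp: homogeneous_iff)
  obtain b1' b2' where Yb: "Y = b1' * gx + b2' * gy"
    using free_alg_split_last[of Y] Y by (auto simp: homogeneous_iff)
  \<comment> \<open>With the second row taken as \<open>Y * Y\<close> times the coefficients of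
    \<open>Y\<close>, both \<open>Y * m21\<close> and \<open>Y * m22\<close> are right multiples of
    \<open>Y ^ 3\<close>; this is where the syzygy \<open>(0, Y)\<close> comes from.\<close>
  define m21 m22 where "m21 = Y * (Y * b1')" and "m22 = Y * (Y * b2')"
  have Ym: "Y ^ 3 = m21 * gx + m22 * gy"
    unfolding Y3 m21_def m22_def by (subst (3) Yb) (simp add: distrib_left mult.assoc)
  \<comment> \<open>Independence of the two relations, read off on the rows of their matrix in
    degree two.\<close>
  have m_indep: "c = 0 \<and> d = 0"
    if *: "\<And>i j. c * cf m11 [i, j] + d * cf m21 [i, j] = 0" "\<And>i j. c * cf m12 [i, j] + d * cf m22 [i, j] = 0"
    for c d
  proof (rule indep, rule homogeneous_3_eqI)
    fix i j l
    show "cf (cst c * g + cst d * Y ^ 3) [i, j, l] = cf 0 [i, j, l]"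
      using *[of i j] homogeneous_cf_3[OF g[unfolded gm], folded gm, of i j l]
        homogeneous_cf_3[OF hY3[unfolded Ym], folded Ym, of i j l]
      by (auto simp: lookup_add)
  qed (auto intro: homogeneous_add homogeneous_cst g hY3 homogeneous_0)
  \<comment> \<open>A letter occurring in the linear form \<open>Y\<close>; the word
    \<open>l l\<close> will detect \<open>Y * Y\<close>.\<close>
  obtain l where l: "cf Y [l] \<noteq> 0"
  proof -
    obtain ls where "cf Y ls \<noteq> 0" using Y(2) by (metis free_alg_eqI lookup_zero)
    then have "length ls = 1" using Y(1) by (auto simp: homogeneous_iff)
    then show thesis using that \<open>cf Y ls \<noteq> 0\<close> by (metis One_nat_def length_0_conv length_Suc_conv)
  qed
  have Y0: "cf Y [] = 0" using Y(1) by (simp add: homogeneous_iff)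
  have m1low: "cf m11 [] = 0" "cf m12 [] = 0" "cf m11 [i] = 0" "cf m12 [i] = 0" for i
    using g cf_mult_gx[of m11 "[]" Lx] cf_mult_gy[of m12 "[]" Lx] cf_mult_gx[of m11 "[]" Ly] cf_mult_gy[of m12 "[]" Ly]
      cf_mult_gx[of m11 "[i]" Lx] cf_mult_gy[of m12 "[i]" Lx] cf_mult_gx[of m11 "[i]" Ly] cf_mult_gy[of m12 "[i]" Ly]
    unfolding gm homogeneous_iff
    by (auto simp: lookup_add dest: spec[of _ "[Lx]"] spec[of _ "[Ly]"] spec[of _ "[i, Lx]"] spec[of _ "[i, Ly]"])
  have m2low: "cf m21 [] = 0" "cf m22 [] = 0" "cf m21 [i] = 0" "cf m22 [i] = 0" for i
    by (simp_all add: m21_def m22_def Y0 cf_mult_1)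

  define x y a11 a12 a21 a22 Z where defs: "x = cl gx" "y = cl gy" "a11 = cl m11" "a12 = cl m12"
    "a21 = cl m21" "a22 = cl m22" "Z = cl Y"
  have carr [simp]: "x \<in> carrier A" "y \<in> carrier A" "a11 \<in> carrier A" "a12 \<in> carrier A"
    "a21 \<in> carrier A" "a22 \<in> carrier A" "Z \<in> carrier A"
    by (simp_all add: defs)
  have rel: "a21 \<otimes>\<^bsub>A\<^esub> x \<oplus>\<^bsub>A\<^esub> a22 \<otimes>\<^bsub>A\<^esub> y = \<zero>\<^bsub>A\<^esub>" "Z \<otimes>\<^bsub>A\<^esub> a21 = \<zero>\<^bsub>A\<^esub>" "Z \<otimes>\<^bsub>A\<^esub> a22 = \<zero>\<^bsub>A\<^esub>"
    "Z \<otimes>\<^bsub>A\<^esub> Z \<otimes>\<^bsub>A\<^esub> Z = \<zero>\<^bsub>A\<^esub>"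
  proof -
    have Y3I: "Y ^ 3 \<in> genideal FA S" by (rule genideal_FA_gen) (simp add: S_def)
    show "a21 \<otimes>\<^bsub>A\<^esub> x \<oplus>\<^bsub>A\<^esub> a22 \<otimes>\<^bsub>A\<^esub> y = \<zero>\<^bsub>A\<^esub>"
      using cl_eq_0[OF Y3I] by (simp add: defs presented_mult presented_add Ym)
    show "Z \<otimes>\<^bsub>A\<^esub> a21 = \<zero>\<^bsub>A\<^esub>" "Z \<otimes>\<^bsub>A\<^esub> a22 = \<zero>\<^bsub>A\<^esub>"
      using cl_eq_0[OF genideal_FA_r[OF Y3I]]
      by (simp_all add: defs presented_mult m21_def m22_def Y3 mult.assoc)
    show "Z \<otimes>\<^bsub>A\<^esub> Z \<otimes>\<^bsub>A\<^esub> Z = \<zero>\<^bsub>A\<^esub>"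
      using cl_eq_0[OF Y3I] by (simp add: defs presented_mult Y3 mult.assoc)
  qed
  \<comment> \<open>Exactness of \<open>A^2 -> A^2 -> A\<close>, where the maps are the matrix of
    relations and the column \<open>(x, y)\<close>.\<close>
  have exact: "\<exists>c\<in>carrier A. \<exists>d\<in>carrier A. a = c \<otimes>\<^bsub>A\<^esub> a11 \<oplus>\<^bsub>A\<^esub> d \<otimes>\<^bsub>A\<^esub> a21 \<and> b = c \<otimes>\<^bsub>A\<^esub> a12 \<oplus>\<^bsub>A\<^esub> d \<otimes>\<^bsub>A\<^esub> a22"
    if ab: "a \<in> carrier A" "b \<in> carrier A" and z: "a \<otimes>\<^bsub>A\<^esub> x \<oplus>\<^bsub>A\<^esub> b \<otimes>\<^bsub>A\<^esub> y = \<zero>\<^bsub>A\<^esub>" for a b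
  proof -
    obtain f h where fh: "a = cl f" "b = cl h" using ab by (auto elim!: carrierE)
    have "cl (f * gx + h * gy) = cl 0"
      using z by (simp add: fh defs presented_mult presented_add presented_zero)
    then have "f * gx + h * gy \<in> genideal FA S" by (simp add: cls_eq_iff)
    then obtain u v i j where ij: "i \<in> genideal FA S" "j \<in> genideal FA S"
      and "f * gx + h * gy = u * g + v * Y ^ 3 + i * gx + j * gy"
      using genideal_pair_cases unfolding S_def by blast
    then have "f * gx + h * gy = (u * m11 + v * m21 + i) * gx + (u * m12 + v * m22 + j) * gy"
      by (simp add: gm Ym algebra_simps)
    then have "f = u * m11 + v * m21 + i" "h = u * m12 + v * m22 + j"
      using gx_gy_unique by blast+
    then have "cl f = cl (u * m11 + v * m21)" "cl h = cl (u * m12 + v * m22)"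
      using ij by (simp_all add: cls_eq_iff)
    then show ?thesis
      by (intro bexI[of _ "cl u"] bexI[of _ "cl v"]) (auto simp: fh defs presented_mult presented_add)
  qed
  have low_x [simp]: "low x [] = 0" "low y [] = 0" "low x [Lx] = 1" "low x [Ly] = 0" "low y [Lx] = 0" "low y [Ly] = 1"
    and low_Z [simp]: "low Z [] = 0" "low Z [l] = cf Y [l]"
    and low_a [simp]: "low a11 [] = 0" "low a12 [] = 0" "low a21 [] = 0" "low a22 [] = 0"
      "low a11 [i] = 0" "low a12 [i] = 0" "low a21 [i] = 0" "low a22 [i] = 0"
      "low a11 [i, j] = cf m11 [i, j]" "low a12 [i, j] = cf m12 [i, j]"
      "low a21 [i, j] = cf m21 [i, j]" "low a22 [i, j] = cf m22 [i, j]" for i j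
    by (simp_all add: defs cf_gx cf_gy Y0 m1low m2low)

  note One_nat_def [simp del]
  \<comment> \<open>A chain map from the complex \<open>A -> A^2 -> A^2 -> A\<close> of
    \<open>k\<close> to \<open>P\<close> is followed on generators: \<open>p0\<close> belongs to the
    unit, \<open>p11\<close> and \<open>p12\<close> to \<open>x\<close> and \<open>y\<close>,
    \<open>p22\<close> to the relation \<open>Y ^ 3\<close>, and \<open>p3\<close> to the syzygy
    \<open>(0, Y)\<close>.\<close>
  obtain p0 where p0 [simp]: "p0 \<in> carrier (P 0)" and \<epsilon>p0: "\<epsilon> p0 = kseq 1"
    using \<epsilon>(2) by (metis imageE rangeI)
  have lift0: "\<exists>p\<in>carrier (P 1). bd 0 p = a \<odot>\<^bsub>P 0\<^esub> p0" if "a \<in> carrier A" "low a [] = 0" for a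
  proof -
    have "\<epsilon> (a \<odot>\<^bsub>P 0\<^esub> p0) = kseq 0"
      using lmod_homD(3)[OF \<epsilon>(1) that(1) p0] that(2) by simp
    then have "a \<odot>\<^bsub>P 0\<^esub> p0 \<in> bd 0 ` carrier (P 1)"
      using ex0 M0.smult_closed[OF that(1) p0] by blast
    then show ?thesis by (metis imageE)
  qed
  obtain p11 where p11 [simp]: "p11 \<in> carrier (P 1)" and bdp11: "bd 0 p11 = x \<odot>\<^bsub>P 0\<^esub> p0"
    using lift0[of x] by auto
  obtain p12 where p12 [simp]: "p12 \<in> carrier (P 1)" and bdp12: "bd 0 p12 = y \<odot>\<^bsub>P 0\<^esub> p0"
    using lift0[of y] by auto
  define r where "r = a21 \<odot>\<^bsub>P 1\<^esub> p11 \<oplus>\<^bsub>P 1\<^esub> a22 \<odot>\<^bsub>P 1\<^esub> p12"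
  have r [simp]: "r \<in> carrier (P 1)"
    by (simp add: r_def M1.smult_closed)
  have "bd 0 r = (a21 \<otimes>\<^bsub>A\<^esub> x \<oplus>\<^bsub>A\<^esub> a22 \<otimes>\<^bsub>A\<^esub> y) \<odot>\<^bsub>P 0\<^esub> p0"
    by (simp add: r_def bdc M1.smult_closed bdp11 bdp12 M0.smult_assoc M0.smult_l_distr)
  also have "\<dots> = \<zero>\<^bsub>P 0\<^esub>" by (simp add: rel)
  finally have "r \<in> bd 1 ` carrier (P 2)" using ex(1) by auto
  then obtain p22 where p22 [simp]: "p22 \<in> carrier (P 2)" and bdp22: "bd 1 p22 = r" by auto
  have "bd 1 (Z \<odot>\<^bsub>P 2\<^esub> p22) = Z \<odot>\<^bsub>P 1\<^esub> r"
    by (simp only: bdc(6) bdp22 p22 carr)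
  also have "\<dots> = (Z \<otimes>\<^bsub>A\<^esub> a21) \<odot>\<^bsub>P 1\<^esub> p11 \<oplus>\<^bsub>P 1\<^esub> (Z \<otimes>\<^bsub>A\<^esub> a22) \<odot>\<^bsub>P 1\<^esub> p12"
    by (simp add: r_def M1.smult_r_distr M1.smult_closed M1.smult_assoc)
  also have "\<dots> = \<zero>\<^bsub>P 1\<^esub>" unfolding rel by simp
  finally have "Z \<odot>\<^bsub>P 2\<^esub> p22 \<in> bd 2 ` carrier (P 3)"
    using ex(2) M2.smult_closed[of Z p22] by auto
  then obtain p3 where p3 [simp]: "p3 \<in> carrier (P 3)" and bdp3: "bd 2 p3 = Z \<odot>\<^bsub>P 2\<^esub> p22" by auto
  \<comment> \<open>The boundary vanishes because \<open>Y ^ 3\<close> is a relation, and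
    \<open>bd 2\<close> is injective because \<open>P 4\<close> is zero.\<close>
  have "bd 2 ((Z \<otimes>\<^bsub>A\<^esub> Z) \<odot>\<^bsub>P 3\<^esub> p3) = (Z \<otimes>\<^bsub>A\<^esub> Z \<otimes>\<^bsub>A\<^esub> Z) \<odot>\<^bsub>P 2\<^esub> p22"
    using bdc(9)[of "Z \<otimes>\<^bsub>A\<^esub> Z" p3] by (simp add: bdp3 M2.smult_assoc)
  also have "\<dots> = \<zero>\<^bsub>P 2\<^esub>" unfolding rel by simp
  finally have "(Z \<otimes>\<^bsub>A\<^esub> Z) \<odot>\<^bsub>P 3\<^esub> p3 \<in> bd 3 ` carrier (P 4)"
    using ex(3) M3.smult_closed[of "Z \<otimes>\<^bsub>A\<^esub> Z" p3] by auto
  then have ZZp3: "(Z \<otimes>\<^bsub>A\<^esub> Z) \<odot>\<^bsub>P 3\<^esub> p3 = \<zero>\<^bsub>P 3\<^esub>"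
    using lmod_hom_zero[OF bd(4) mod mod] P4 by auto

  \<comment> \<open>Comparison in the opposite direction: \<open>\<psi>0\<close>, the pair
    \<open>\<chi>1\<close>, \<open>\<chi>2\<close> and the pair \<open>\<omega>1\<close>,
    \<open>\<omega>2\<close> are the components of a chain map from \<open>P\<close> to
    \<open>A\<close>, \<open>A^2\<close>, \<open>A^2\<close>.\<close>
  define \<phi>0 where "\<phi>0 q = low (\<epsilon> q 0) []" for q
  obtain \<psi>0 where lin0: "lin_form A (P 0) \<psi>0" and low0: "\<And>q. q \<in> carrier (P 0) \<Longrightarrow> low (\<psi>0 q) [] = \<phi>0 q"
  proof (rule projective_lift_residue[OF proj[of 0], of \<phi>0])
    fix q q' assume "q \<in> carrier (P 0)" "q' \<in> carrier (P 0)"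
    then show "\<phi>0 (q \<oplus>\<^bsub>P 0\<^esub> q') = \<phi>0 q + \<phi>0 q'"
      by (simp add: \<phi>0_def lmod_homD(2)[OF \<epsilon>(1)])
  next
    fix a q assume "a \<in> carrier A" "q \<in> carrier (P 0)"
    then show "\<phi>0 (a \<odot>\<^bsub>P 0\<^esub> q) = low a [] * \<phi>0 q"
      by (simp add: \<phi>0_def lmod_homD(3)[OF \<epsilon>(1)])
  qed (rule that)
  \<comment> \<open>Factoring through \<open>x\<close> and \<open>y\<close> is a single equation;
    zeros fill the second column of the matrix in \<open>projective_lift_pair\<close>.\<close>
  have zero_lin: "lin_form A (P i) (\<lambda>_. \<zero>\<^bsub>A\<^esub>)" for i
    by (simp add: lin_form_def)
  obtain \<chi>1 \<chi>2 where lin\<chi>: "lin_form A (P 1) \<chi>1" "lin_form A (P 1) \<chi>2"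
    and \<chi>: "\<And>q. q \<in> carrier (P 1) \<Longrightarrow> \<psi>0 (bd 0 q) = \<chi>1 q \<otimes>\<^bsub>A\<^esub> x \<oplus>\<^bsub>A\<^esub> \<chi>2 q \<otimes>\<^bsub>A\<^esub> y"
  proof (rule projective_lift_pair[OF ring_A proj[of 1] lin_form_comp[OF lin0 bd(1)] zero_lin, of x \<open>\<zero>\<^bsub>A\<^esub>\<close> y \<open>\<zero>\<^bsub>A\<^esub>\<close>])
    fix q assume q: "q \<in> carrier (P 1)"
    then have "\<epsilon> (bd 0 q) = kseq 0" using ex0 by auto
    then have "low (\<psi>0 (bd 0 q)) [] = 0"
      using low0[OF bdc(1)[OF q]] by (simp add: \<phi>0_def)
    then obtain b c where "b \<in> carrier A" "c \<in> carrier A" "\<psi>0 (bd 0 q) = b \<otimes>\<^bsub>A\<^esub> x \<oplus>\<^bsub>A\<^esub> c \<otimes>\<^bsub>A\<^esub> y"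
      using low_0_split[OF lin_formD(1)[OF lin0 bdc(1)[OF q]]] unfolding defs by blast
    then show "\<exists>a\<in>carrier A. \<exists>b\<in>carrier A. \<psi>0 (bd 0 q) = a \<otimes>\<^bsub>A\<^esub> x \<oplus>\<^bsub>A\<^esub> b \<otimes>\<^bsub>A\<^esub> y
        \<and> \<zero>\<^bsub>A\<^esub> = a \<otimes>\<^bsub>A\<^esub> \<zero>\<^bsub>A\<^esub> \<oplus>\<^bsub>A\<^esub> b \<otimes>\<^bsub>A\<^esub> \<zero>\<^bsub>A\<^esub>"
      by auto
  qed (rule R.zero_closed carr that; assumption?)+
  note \<chi>c = lin_formD[OF lin\<chi>(1)] lin_formD[OF lin\<chi>(2)]
  obtain \<omega>1 \<omega>2 where lin\<omega>: "lin_form A (P 2) \<omega>1" "lin_form A (P 2) \<omega>2"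
    and \<omega>: "\<And>q. q \<in> carrier (P 2) \<Longrightarrow> \<chi>1 (bd 1 q) = \<omega>1 q \<otimes>\<^bsub>A\<^esub> a11 \<oplus>\<^bsub>A\<^esub> \<omega>2 q \<otimes>\<^bsub>A\<^esub> a21"
      "\<And>q. q \<in> carrier (P 2) \<Longrightarrow> \<chi>2 (bd 1 q) = \<omega>1 q \<otimes>\<^bsub>A\<^esub> a12 \<oplus>\<^bsub>A\<^esub> \<omega>2 q \<otimes>\<^bsub>A\<^esub> a22"
  proof (rule projective_lift_pair[OF ring_A proj[of 2] lin_form_comp[OF lin\<chi>(1) bd(2)]
        lin_form_comp[OF lin\<chi>(2) bd(2)], of a11 a12 a21 a22])
    fix q assume q: "q \<in> carrier (P 2)"
    then have "bd 0 (bd 1 q) = \<zero>\<^bsub>P 0\<^esub>" using ex(1) by auto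
    then show "\<exists>a\<in>carrier A. \<exists>b\<in>carrier A. \<chi>1 (bd 1 q) = a \<otimes>\<^bsub>A\<^esub> a11 \<oplus>\<^bsub>A\<^esub> b \<otimes>\<^bsub>A\<^esub> a21
        \<and> \<chi>2 (bd 1 q) = a \<otimes>\<^bsub>A\<^esub> a12 \<oplus>\<^bsub>A\<^esub> b \<otimes>\<^bsub>A\<^esub> a22"
      using exact[of "\<chi>1 (bd 1 q)" "\<chi>2 (bd 1 q)"] \<chi>[of "bd 1 q"] bdc(4)[OF q] \<chi>c
        lin_form_zero[OF lin0 mod] by simp
  qed (rule carr that; assumption?)+
  note \<omega>c = lin_formD[OF lin\<omega>(1)] lin_formD[OF lin\<omega>(2)]

  \<comment> \<open>On boundaries the pair \<open>\<omega>1\<close>, \<open>\<omega>2\<close> is a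
    syzygy of the rows, and independent rows admit no syzygy with a nonzero constant term.\<close>
  have \<omega>0: "low (\<omega>2 (bd 2 q)) [] = 0" if q: "q \<in> carrier (P 3)" for q
  proof -
    have "bd 1 (bd 2 q) = \<zero>\<^bsub>P 1\<^esub>" using ex(2) q by auto
    then have "\<omega>1 (bd 2 q) \<otimes>\<^bsub>A\<^esub> a11 \<oplus>\<^bsub>A\<^esub> \<omega>2 (bd 2 q) \<otimes>\<^bsub>A\<^esub> a21 = \<zero>\<^bsub>A\<^esub>"
      "\<omega>1 (bd 2 q) \<otimes>\<^bsub>A\<^esub> a12 \<oplus>\<^bsub>A\<^esub> \<omega>2 (bd 2 q) \<otimes>\<^bsub>A\<^esub> a22 = \<zero>\<^bsub>A\<^esub>"
      using \<omega>[OF bdc(7)[OF q]] lin_form_zero[OF lin\<chi>(1) mod] lin_form_zero[OF lin\<chi>(2) mod] by simp_all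
    then have "low (\<omega>1 (bd 2 q) \<otimes>\<^bsub>A\<^esub> a11 \<oplus>\<^bsub>A\<^esub> \<omega>2 (bd 2 q) \<otimes>\<^bsub>A\<^esub> a21) [i, j] = 0"
      "low (\<omega>1 (bd 2 q) \<otimes>\<^bsub>A\<^esub> a12 \<oplus>\<^bsub>A\<^esub> \<omega>2 (bd 2 q) \<otimes>\<^bsub>A\<^esub> a22) [i, j] = 0" for i j
      by (simp_all add: low_zero)
    then show ?thesis
      using m_indep[of "low (\<omega>1 (bd 2 q)) []" "low (\<omega>2 (bd 2 q)) []"] \<omega>c(1,4)[OF bdc(7)[OF q]]
      by (simp add: low_add low_mult_2)
  qed
  \<comment> \<open>The round trip through \<open>P\<close> is the identity modulo positive degree;
    for the generator of the relation \<open>Y ^ 3\<close> this is traced by coefficients of degrees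
    one and two.\<close>
  have \<omega>22: "low (\<omega>2 p22) [] = 1"
  proof -
    have \<psi>p0: "\<psi>0 p0 \<in> carrier A" "low (\<psi>0 p0) [] = 1"
      using lin_formD(1)[OF lin0 p0] low0[OF p0] by (simp_all add: \<phi>0_def \<epsilon>p0)
    have "low (\<chi>1 p11 \<otimes>\<^bsub>A\<^esub> x \<oplus>\<^bsub>A\<^esub> \<chi>2 p11 \<otimes>\<^bsub>A\<^esub> y) [i] = low (x \<otimes>\<^bsub>A\<^esub> \<psi>0 p0) [i]" for i
      using \<chi>[OF p11] lin_formD(3)[OF lin0 carr(1) p0] by (simp add: bdp11)
    from this[of Lx] this[of Ly] have \<chi>11: "low (\<chi>1 p11) [] = 1" "low (\<chi>2 p11) [] = 0"
      using \<psi>p0 \<chi>c by (simp_all add: low_add low_mult_1)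
    have "low (\<chi>1 p12 \<otimes>\<^bsub>A\<^esub> x \<oplus>\<^bsub>A\<^esub> \<chi>2 p12 \<otimes>\<^bsub>A\<^esub> y) [i] = low (y \<otimes>\<^bsub>A\<^esub> \<psi>0 p0) [i]" for i
      using \<chi>[OF p12] lin_formD(3)[OF lin0 carr(2) p0] by (simp add: bdp12)
    from this[of Lx] this[of Ly] have \<chi>12: "low (\<chi>1 p12) [] = 0" "low (\<chi>2 p12) [] = 1"
      using \<psi>p0 \<chi>c by (simp_all add: low_add low_mult_1)
    have "\<chi>1 r = a21 \<otimes>\<^bsub>A\<^esub> \<chi>1 p11 \<oplus>\<^bsub>A\<^esub> a22 \<otimes>\<^bsub>A\<^esub> \<chi>1 p12" "\<chi>2 r = a21 \<otimes>\<^bsub>A\<^esub> \<chi>2 p11 \<oplus>\<^bsub>A\<^esub> a22 \<otimes>\<^bsub>A\<^esub> \<chi>2 p12"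
      by (simp_all add: r_def \<chi>c M1.smult_closed)
    then have "low (\<omega>1 p22 \<otimes>\<^bsub>A\<^esub> a11 \<oplus>\<^bsub>A\<^esub> \<omega>2 p22 \<otimes>\<^bsub>A\<^esub> a21) [i, j]
        = low (a21 \<otimes>\<^bsub>A\<^esub> \<chi>1 p11 \<oplus>\<^bsub>A\<^esub> a22 \<otimes>\<^bsub>A\<^esub> \<chi>1 p12) [i, j]"
      "low (\<omega>1 p22 \<otimes>\<^bsub>A\<^esub> a12 \<oplus>\<^bsub>A\<^esub> \<omega>2 p22 \<otimes>\<^bsub>A\<^esub> a22) [i, j]
        = low (a21 \<otimes>\<^bsub>A\<^esub> \<chi>2 p11 \<oplus>\<^bsub>A\<^esub> a22 \<otimes>\<^bsub>A\<^esub> \<chi>2 p12) [i, j]" for i j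
      using \<omega>[OF p22] by (simp_all add: bdp22)
    then have "low (\<omega>1 p22) [] * cf m11 [i, j] + (low (\<omega>2 p22) [] - 1) * cf m21 [i, j] = 0"
      "low (\<omega>1 p22) [] * cf m12 [i, j] + (low (\<omega>2 p22) [] - 1) * cf m22 [i, j] = 0" for i j
      using \<chi>11 \<chi>12 \<chi>c(1,4)[OF p11] \<chi>c(1,4)[OF p12] \<omega>c(1,4)[OF p22]
      by (simp_all add: low_add low_mult_2 algebra_simps)
    from m_indep[OF this] show ?thesis by simp
  qed

  \<comment> \<open>Since the constant terms vanish, the coefficient at \<open>l\<close> is a
    homomorphism to \<open>k\<close>; it sends \<open>p3\<close> to the coefficient of
    \<open>l\<close> in \<open>Y\<close>.\<close>
  define \<phi> where "\<phi> q = low (\<omega>2 (bd 2 q)) [l]" for q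
  obtain \<psi> where lin\<psi>: "lin_form A (P 3) \<psi>" and low\<psi>: "\<And>q. q \<in> carrier (P 3) \<Longrightarrow> low (\<psi> q) [] = \<phi> q"
  proof (rule projective_lift_residue[OF proj[of 3], of \<phi>])
    fix q q' assume "q \<in> carrier (P 3)" "q' \<in> carrier (P 3)"
    then show "\<phi> (q \<oplus>\<^bsub>P 3\<^esub> q') = \<phi> q + \<phi> q'"
      by (simp add: \<phi>_def bdc \<omega>c low_add)
  next
    fix a q assume "a \<in> carrier A" "q \<in> carrier (P 3)"
    then show "\<phi> (a \<odot>\<^bsub>P 3\<^esub> q) = low a [] * \<phi> q"
      by (simp add: \<phi>_def bdc \<omega>c low_mult_1 \<omega>0)
  qed (rule that)
  have "\<phi> p3 = cf Y [l]"
    using \<omega>c by (simp add: \<phi>_def bdp3 low_mult_1 \<omega>22)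
  then have "low (\<psi> p3) [] \<noteq> 0" using low\<psi>[OF p3] l by simp
  \<comment> \<open>The element is zero, but its coefficient at \<open>l l\<close> is the square of
    the coefficient of \<open>l\<close> in \<open>Y\<close> times the constant term of
    \<open>\<psi> p3\<close>.\<close>
  moreover have "low ((Z \<otimes>\<^bsub>A\<^esub> Z) \<otimes>\<^bsub>A\<^esub> \<psi> p3) [l, l] = 0"
    using lin_formD(3)[OF lin\<psi>, of "Z \<otimes>\<^bsub>A\<^esub> Z" p3] lin_form_zero[OF lin\<psi> mod] low_zero[of "[l, l]"]
    by (simp add: ZZp3)
  then have "low Z [l] * low Z [l] * low (\<psi> p3) [] = 0"
    using lin_formD(1)[OF lin\<psi> p3] by (simp add: low_mult_2 low_mult_1 low_mult_0)
  ultimately show False using l by simp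
qed

section \<open>The projective line\<close>

definition pv :: "'k::field \<times> 'k \<Rightarrow> 'k P1" where
  "pv u = pt (fst u) (snd u)"

text \<open>The determinant with columns \<open>u\<close> and \<open>v\<close>; its vanishing
  expresses equality of projective points without division.\<close>

definition cross :: "'k::field \<times> 'k \<Rightarrow> 'k \<times> 'k \<Rightarrow> 'k" where
  "cross u v = fst u * snd v - snd u * fst v"

text \<open>\<open>((a, b), (c, d))\<close> stands for the matrix with these rows.\<close>

type_synonym 'k mat2 = "('k \<times> 'k) \<times> ('k \<times> 'k)"

definition mv :: "'k::field mat2 \<Rightarrow> 'k \<times> 'k \<Rightarrow> 'k \<times> 'k" where
  "mv M u = (fst (fst M) * fst u + snd (fst M) * snd u, fst (snd M) * fst u + snd (snd M) * snd u)"

definition mdet :: "'k::field mat2 \<Rightarrow> 'k" where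
  "mdet M = fst (fst M) * snd (snd M) - snd (fst M) * fst (snd M)"

definition mm :: "'k::field mat2 \<Rightarrow> 'k mat2 \<Rightarrow> 'k mat2" where
  "mm M N = ((fst (fst M) * fst (fst N) + snd (fst M) * fst (snd N), fst (fst M) * snd (fst N) + snd (fst M) * snd (snd N)),
             (fst (snd M) * fst (fst N) + snd (snd M) * fst (snd N), fst (snd M) * snd (fst N) + snd (snd M) * snd (snd N)))"

lemma mv_mm: "mv (mm M N) u = mv M (mv N u)"
  by (simp add: mv_def mm_def algebra_simps)

lemma mdet_mm: "mdet (mm M N) = mdet M * mdet N"
  by (simp add: mdet_def mm_def algebra_simps)

definition minv :: "'k::field mat2 \<Rightarrow> 'k mat2" where
  "minv M = ((snd (snd M) / mdet M, - snd (fst M) / mdet M), (- fst (snd M) / mdet M, fst (fst M) / mdet M))"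

lemma mm_minv:
  assumes "mdet M \<noteq> 0"
  shows "mm M (minv M) = ((1, 0), (0, 1))" "mm (minv M) M = ((1, 0), (0, 1))"
proof -
  obtain a b c d where M: "M = ((a, b), (c, d))" by (metis surj_pair)
  define D where "D = mdet M"
  have D: "D \<noteq> 0" "a * d = D + b * c" using assms by (simp_all add: D_def M mdet_def)
  then show "mm M (minv M) = ((1, 0), (0, 1))" "mm (minv M) M = ((1, 0), (0, 1))"
    unfolding minv_def D_def[symmetric]
    by (simp_all add: M mm_def divide_simps) (simp_all add: algebra_simps)
qed

lemma mv_minv:
  assumes "mdet M \<noteq> 0"
  shows "mv M (mv (minv M) u) = u" "mv (minv M) (mv M u) = u"
  unfolding mv_mm[symmetric] mm_minv[OF assms] by (simp_all add: mv_def)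

lemma mdet_minv: "mdet M \<noteq> 0 \<Longrightarrow> mdet (minv M) \<noteq> 0"
  using mm_minv(1)[of M] mdet_mm[of M "minv M"] by (auto simp: mdet_def)

lemma cross_mv: "cross (mv M u) (mv M v) = mdet M * cross u v"
  by (simp add: cross_def mv_def mdet_def algebra_simps)

lemma mv_scale: "mv M (c * fst u, c * snd u) = (c * fst (mv M u), c * snd (mv M u))"
  by (simp add: mv_def algebra_simps)

lemma mv_nonzero: "mdet M \<noteq> 0 \<Longrightarrow> u \<noteq> (0, 0) \<Longrightarrow> mv M u \<noteq> (0, 0)"
proof
  assume *: "mdet M \<noteq> 0" "u \<noteq> (0, 0)" "mv M u = (0, 0)"
  have "u = mv (minv M) (0, 0)" using mv_minv(2)[OF *(1), of u] *(3) by simp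
  then show False using *(2) by (simp add: mv_def)
qed

lemma cross_eq_0_iff:
  assumes "u \<noteq> (0, 0)" "v \<noteq> (0, 0)"
  shows "cross u v = 0 \<longleftrightarrow> (\<exists>c. c \<noteq> 0 \<and> v = (c * fst u, c * snd u))"
proof
  assume c: "cross u v = 0"
  show "\<exists>c. c \<noteq> 0 \<and> v = (c * fst u, c * snd u)"
  proof (cases "fst u = 0")
    case True
    then have "snd u \<noteq> 0" using assms(1) by (cases u) auto
    then show ?thesis using True c assms(2)
      by (intro exI[of _ "snd v / snd u"]) (cases v, auto simp: cross_def)
  next
    case False
    then have "snd v = fst v / fst u * snd u" using c by (simp add: cross_def field_simps)
    then show ?thesis using False assms(2)
      by (intro exI[of _ "fst v / fst u"]) (cases v, auto)
  qed
qed (auto simp: cross_def)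

lemma coords_ex: "\<exists>u. u \<noteq> (0, 0) \<and> coords p = proj_class u"
  using coords[of p] by auto

lemma coords_pv: "u \<noteq> (0, 0) \<Longrightarrow> coords (pv u) = proj_class u"
  unfolding pv_def pt_def prod.collapse by (rule Abs_P1_inverse) blast

lemma proj_class_eq_iff:
  assumes "u \<noteq> (0, 0)" "v \<noteq> (0, 0)"
  shows "proj_class u = proj_class v \<longleftrightarrow> cross u v = 0"
proof
  assume *: "proj_class u = proj_class v"
  have "v \<in> proj_class v" unfolding proj_class_def by (rule CollectI, rule exI[of _ 1]) simp
  then show "cross u v = 0" unfolding *[symmetric] by (auto simp: proj_class_def cross_def)
next
  assume "cross u v = 0"
  then obtain c where c: "c \<noteq> 0" "v = (c * fst u, c * snd u)" using cross_eq_0_iff assms by blast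
  show "proj_class u = proj_class v"
    unfolding proj_class_def
  proof safe
    fix d :: 'a assume "d \<noteq> 0"
    then show "\<exists>e. (d * fst u, d * snd u) = (e * fst v, e * snd v) \<and> e \<noteq> 0"
      using c by (intro exI[of _ "d / c"]) auto
    show "\<exists>e. (d * fst v, d * snd v) = (e * fst u, e * snd u) \<and> e \<noteq> 0"
      using c \<open>d \<noteq> 0\<close> by (intro exI[of _ "d * c"]) auto
  qed
qed

lemma pv_eq_iff: "u \<noteq> (0, 0) \<Longrightarrow> v \<noteq> (0, 0) \<Longrightarrow> pv u = pv v \<longleftrightarrow> cross u v = 0"
  by (metis coords_inject coords_pv proj_class_eq_iff)

lemma ex_pv: "\<exists>u. u \<noteq> (0, 0) \<and> p = pv u"
  by (metis coords_ex coords_inject coords_pv)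

lemma pvE: obtains u where "u \<noteq> (0, 0)" "p = pv u"
  using ex_pv by blast

lemma mem_coords_iff: "u \<in> coords p \<longleftrightarrow> u \<noteq> (0, 0) \<and> p = pv u"
proof -
  obtain v where v: "v \<noteq> (0, 0)" "p = pv v" by (rule pvE)
  have "u \<in> proj_class v \<longleftrightarrow> u \<noteq> (0, 0) \<and> cross v u = 0"
  proof
    assume "u \<in> proj_class v"
    then obtain c where "c \<noteq> 0" "u = (c * fst v, c * snd v)" by (auto simp: proj_class_def)
    then show "u \<noteq> (0, 0) \<and> cross v u = 0" using v by (cases v) (auto simp: cross_def)
  next
    assume "u \<noteq> (0, 0) \<and> cross v u = 0"
    then show "u \<in> proj_class v" using cross_eq_0_iff[OF v(1), of u] by (auto simp: proj_class_def)
  qed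
  then show ?thesis using v pv_eq_iff[OF v(1), of u] by (auto simp: coords_pv)
qed

lemma pv_scale: "c \<noteq> 0 \<Longrightarrow> pv (c * fst u, c * snd u) = pv u"
proof (cases "u = (0, 0)")
  case False
  then show "c \<noteq> 0 \<Longrightarrow> pv (c * fst u, c * snd u) = pv u"
    by (subst pv_eq_iff) (cases u, auto simp: cross_def)
qed simp

lemma pv_mv_eq_iff:
  "mdet M \<noteq> 0 \<Longrightarrow> u \<noteq> (0, 0) \<Longrightarrow> v \<noteq> (0, 0) \<Longrightarrow> pv (mv M u) = pv (mv M v) \<longleftrightarrow> cross u v = 0"
  by (simp add: pv_eq_iff mv_nonzero cross_mv)

lemma pv_mvE:
  assumes "mdet M \<noteq> 0" obtains u where "u \<noteq> (0, 0)" "p = pv (mv M u)"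
proof -
  obtain v where v: "v \<noteq> (0, 0)" "p = pv v" by (rule pvE)
  show thesis
    using that[of "mv (minv M) v"] v mv_nonzero[OF mdet_minv[OF assms] v(1)] by (simp add: mv_minv assms)
qed

lemma proj_map_pv:
  assumes "a * d - b * c \<noteq> 0" "u \<noteq> (0, 0)"
  shows "proj_map a b c d (pv u) = pv (mv ((a, b), (c, d)) u)"
proof -
  let ?M = "((a, b), (c, d))"
  have M: "mdet ?M \<noteq> 0" using assms(1) by (simp add: mdet_def)
  have "(\<forall>(s, t)\<in>coords (pv u). (a * s + b * t, c * s + d * t) \<in> coords q) \<longleftrightarrow> q = pv (mv ?M u)" for q
  proof
    assume "\<forall>(s, t)\<in>coords (pv u). (a * s + b * t, c * s + d * t) \<in> coords q"
    moreover have "u \<in> coords (pv u)" using assms(2) by (simp add: mem_coords_iff)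
    ultimately show "q = pv (mv ?M u)" by (cases u) (auto simp: mem_coords_iff mv_def)
  next
    assume q: "q = pv (mv ?M u)"
    show "\<forall>(s, t)\<in>coords (pv u). (a * s + b * t, c * s + d * t) \<in> coords q"
    proof safe
      fix s t assume "(s, t) \<in> coords (pv u)"
      then have st: "(s, t) \<noteq> (0, 0)" "cross u (s, t) = 0"
        using pv_eq_iff[OF assms(2)] by (auto simp: mem_coords_iff)
      have "(a * s + b * t, c * s + d * t) = mv ?M (s, t)" by (simp add: mv_def)
      then show "(a * s + b * t, c * s + d * t) \<in> coords q"
        using mv_nonzero[OF M st(1)] pv_mv_eq_iff[OF M assms(2) st(1)] st(2) q
        by (simp add: mem_coords_iff)
    qed
  qed
  then show ?thesis unfolding proj_map_def by simp
qed

lemma inj_pv_1: "inj (\<lambda>z. pv (1, z))"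
  by (rule injI) (simp add: pv_eq_iff cross_def)

lemma infinite_P1: "infinite (UNIV :: 'k::field_char_0 P1 set)"
  using inj_pv_1 infinite_UNIV_char_0 by (metis finite_imageD finite_subset subset_UNIV)

section \<open>Regular maps on lines\<close>

lemma biform_poly:
  fixes F :: "'k::field \<times> 'k \<Rightarrow> 'k \<times> 'k \<Rightarrow> 'k"
  assumes "biform m n F"
  shows "\<exists>f. \<forall>z. F (poly u1 z, poly u2 z) (poly v1 z, poly v2 z) = poly f z"
proof -
  obtain c where c: "F (s, t) (s', t') =
        (\<Sum>i\<le>m. \<Sum>j\<le>n. c i j * s ^ i * t ^ (m - i) * s' ^ j * t' ^ (n - j))" for s t s' t'
    using assms unfolding biform_def by blast
  show ?thesis
    unfolding c
    by (rule exI[of _ "\<Sum>i\<le>m. \<Sum>j\<le>n. [:c i j:] * u1 ^ i * u2 ^ (m - i) * v1 ^ j * v2 ^ (n - j)"])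
      (simp add: poly_sum poly_power mult.assoc)
qed

lemma biform_scale:
  fixes F :: "'k::field \<times> 'k \<Rightarrow> 'k \<times> 'k \<Rightarrow> 'k"
  assumes "biform m n F"
  shows "F (x * fst u, x * snd u) (y * fst v, y * snd v) = x ^ m * y ^ n * F u v"
proof -
  obtain c where c: "F (s, t) (s', t') =
        (\<Sum>i\<le>m. \<Sum>j\<le>n. c i j * s ^ i * t ^ (m - i) * s' ^ j * t' ^ (n - j))" for s t s' t'
    using assms unfolding biform_def by blast
  have "c i j * (x * s) ^ i * (x * t) ^ (m - i) * (y * s') ^ j * (y * t') ^ (n - j) =
      x ^ m * y ^ n * (c i j * s ^ i * t ^ (m - i) * s' ^ j * t' ^ (n - j))"
    if "i \<le> m" "j \<le> n" for i j s t s' t'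
  proof -
    have "x ^ m = x ^ i * x ^ (m - i)" "y ^ n = y ^ j * y ^ (n - j)"
      using that by (simp_all flip: power_add)
    then show ?thesis by (simp add: power_mult_distrib algebra_simps)
  qed
  note scale = this
  show ?thesis
  proof (cases u, cases v)
    fix s t s' t' assume uv: "u = (s, t)" "v = (s', t')"
    show ?thesis
      unfolding uv fst_conv snd_conv c sum_distrib_left
      by (intro sum.cong refl) (simp only: scale atMost_iff)
  qed
qed

lemma zero_locus_pv:
  assumes "biform m n F" "u \<noteq> (0, 0)" "v \<noteq> (0, 0)"
  shows "(pv u, pv v) \<in> zero_locus F \<longleftrightarrow> F u v = 0"
proof
  assume "(pv u, pv v) \<in> zero_locus F"
  then show "F u v = 0" using assms by (auto simp: zero_locus_def mem_coords_iff)
next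
  assume F: "F u v = 0"
  show "(pv u, pv v) \<in> zero_locus F"
    unfolding zero_locus_def
  proof (intro CollectI case_prodI ballI)
    fix u' v' assume "u' \<in> coords (pv u)" "v' \<in> coords (pv v)"
    then obtain c d where "u' = (c * fst u, c * snd u)" "v' = (d * fst v, d * snd v)"
      using assms by (auto simp: coords_pv proj_class_def)
    then show "F u' v' = 0" using F biform_scale[OF assms(1)] by simp
  qed
qed

text \<open>A representation of \<open>\<phi>\<close> near the point at \<open>z0\<close> becomes a
  pair of polynomials \<open>f\<close>, \<open>g\<close> in the parameter, not both zero at
  \<open>z0\<close>. Agreement with \<open>w1 : w2\<close> at infinitely many parameters forces
  \<open>f * w2 - g * w1 = 0\<close>, and evaluation at \<open>z0\<close> gives the claim.\<close>

lemma regular_map_identity: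
  fixes E :: "('k::field P1 \<times> 'k P1) set"
  assumes reg: "regular_map_to_P1 E \<phi>"
    and nz: "\<And>z. (poly u1 z, poly u2 z) \<noteq> (0, 0)" "\<And>z. (poly v1 z, poly v2 z) \<noteq> (0, 0)"
      "\<And>z. (poly w1 z, poly w2 z) \<noteq> (0, 0)"
    and E: "\<And>z. (pv (poly u1 z, poly u2 z), pv (poly v1 z, poly v2 z)) \<in> E"
    and inf: "infinite {z. \<phi> (pv (poly u1 z, poly u2 z), pv (poly v1 z, poly v2 z)) = pv (poly w1 z, poly w2 z)}"
  shows "\<phi> (pv (poly u1 z0, poly u2 z0), pv (poly v1 z0, poly v2 z0)) = pv (poly w1 z0, poly w2 z0)"
proof -
  let ?u = "\<lambda>z. (poly u1 z, poly u2 z)" and ?v = "\<lambda>z. (poly v1 z, poly v2 z)"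
    and ?w = "\<lambda>z. (poly w1 z, poly w2 z)"
  let ?e = "\<lambda>z. (pv (?u z), pv (?v z))"
  obtain m n F G where FG: "biform m n F" "biform m n G" "?e z0 \<notin> zero_locus F \<inter> zero_locus G"
    and eq: "\<And>p q u v. (p, q) \<in> E - zero_locus F \<inter> zero_locus G \<Longrightarrow> u \<in> coords p \<Longrightarrow> v \<in> coords q \<Longrightarrow>
      (F u v, G u v) \<in> coords (\<phi> (p, q))"
    using reg E[of z0] unfolding regular_map_to_P1_def by (smt (verit) case_prodD)
  obtain f where f: "\<And>z. F (?u z) (?v z) = poly f z" using biform_poly[OF FG(1)] by blast
  obtain g where g: "\<And>z. G (?u z) (?v z) = poly g z" using biform_poly[OF FG(2)] by blast
  have loc: "?e z \<in> zero_locus F \<inter> zero_locus G \<longleftrightarrow> poly f z = 0 \<and> poly g z = 0" for z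
    using zero_locus_pv[OF FG(1) nz(1,2)] zero_locus_pv[OF FG(2) nz(1,2)] f g by simp
  have val: "(poly f z, poly g z) \<noteq> (0, 0) \<and> \<phi> (?e z) = pv (poly f z, poly g z)"
    if "\<not> (poly f z = 0 \<and> poly g z = 0)" for z
    using eq[of "pv (?u z)" "pv (?v z)" "?u z" "?v z"] E[of z] loc[of z] that nz f g
    by (auto simp: mem_coords_iff)
  define h where "h = f * w2 - g * w1"
  have z0: "\<not> (poly f z0 = 0 \<and> poly g z0 = 0)" using FG(3) loc by blast
  \<comment> \<open>Only finitely many parameters are common zeros of \<open>f\<close> and
    \<open>g\<close>, so this representation sees infinitely many of the agreements.\<close>
  then have "f \<noteq> 0 \<or> g \<noteq> 0" by auto
  then have "finite {z. poly f z = 0 \<and> poly g z = 0}"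
    using poly_roots_finite[of f] poly_roots_finite[of g]
    by (metis (mono_tags, lifting) Collect_mono finite_subset)
  then have "infinite ({z. \<phi> (?e z) = pv (?w z)} - {z. poly f z = 0 \<and> poly g z = 0})"
    using inf by (simp add: Diff_infinite_finite)
  moreover have "({z. \<phi> (?e z) = pv (?w z)} - {z. poly f z = 0 \<and> poly g z = 0}) \<subseteq> {z. poly h z = 0}"
  proof
    fix z assume "z \<in> {z. \<phi> (?e z) = pv (?w z)} - {z. poly f z = 0 \<and> poly g z = 0}"
    then have *: "\<phi> (?e z) = pv (?w z)" "\<not> (poly f z = 0 \<and> poly g z = 0)" by auto
    then have "cross (poly f z, poly g z) (?w z) = 0"
      using val[OF *(2)] pv_eq_iff[OF _ nz(3)] by metis
    then show "z \<in> {z. poly h z = 0}" by (simp add: h_def cross_def mult.commute)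
  qed
  ultimately have "infinite {z. poly h z = 0}" using finite_subset by blast
  then have "h = 0" using poly_roots_finite by blast
  then have "cross (poly f z0, poly g z0) (?w z0) = 0"
    by (simp add: h_def cross_def flip: poly_mult poly_diff)
  then show ?thesis using val[OF z0] pv_eq_iff[OF _ nz(3)] by metis
qed

text \<open>The parametrisations that occur: linear isomorphisms for the conic and for the moving
  coordinate of a line, constants for the fixed coordinate of a line. In both cases
  \<open>pv (U u)\<close> depends on \<open>pv u\<close> only.\<close>

definition param :: "('k::field \<times> 'k \<Rightarrow> 'k \<times> 'k) \<Rightarrow> bool" where
  "param U \<longleftrightarrow> (\<exists>M. mdet M \<noteq> 0 \<and> U = mv M) \<or> (\<exists>v. v \<noteq> (0, 0) \<and> U = (\<lambda>_. v))"

lemma param_mv: "mdet M \<noteq> 0 \<Longrightarrow> param (mv M)"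
  and param_const: "v \<noteq> (0, 0) \<Longrightarrow> param (\<lambda>_. v)"
  unfolding param_def by blast+

lemma param_comp: "mdet M \<noteq> 0 \<Longrightarrow> param U \<Longrightarrow> param (\<lambda>u. mv M (U u))"
proof -
  assume M: "mdet M \<noteq> 0" and "param U"
  then consider N where "mdet N \<noteq> 0" "U = mv N" | v where "v \<noteq> (0, 0)" "U = (\<lambda>_. v)"
    unfolding param_def by blast
  then show ?thesis
  proof cases
    case 1
    then have "(\<lambda>u. mv M (U u)) = mv (mm M N)" by (auto simp: mv_mm)
    then show ?thesis using M 1 by (simp add: param_mv mdet_mm)
  next
    case 2
    then show ?thesis using param_const[OF mv_nonzero[OF M 2(1)]] by simp
  qed
qed

lemma param_id: "param (\<lambda>u. u)"
proof -
  have "mv ((1, 0), (0, 1)) = (\<lambda>u :: 'a \<times> 'a. u)" by (auto simp: mv_def)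
  then show ?thesis using param_mv[of "((1, 0), (0, 1)) :: 'a mat2"] by (simp add: mdet_def)
qed

lemma param_nonzero: "param U \<Longrightarrow> u \<noteq> (0, 0) \<Longrightarrow> U u \<noteq> (0, 0)"
  by (auto simp: param_def mv_nonzero)

lemma param_scale: "param U \<Longrightarrow> c \<noteq> 0 \<Longrightarrow> pv (U (c * fst u, c * snd u)) = pv (U u)"
  by (auto simp: param_def mv_scale pv_scale)

lemma param_poly:
  assumes "param U"
  shows "\<exists>p1 p2. \<forall>z. U (1, z) = (poly p1 z, poly p2 z)" "\<exists>p1 p2. \<forall>z. U (z, 1) = (poly p1 z, poly p2 z)"
proof -
  have "(\<exists>p1 p2. \<forall>z. U (1, z) = (poly p1 z, poly p2 z)) \<and> (\<exists>p1 p2. \<forall>z. U (z, 1) = (poly p1 z, poly p2 z))"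
    using assms unfolding param_def
  proof (elim disjE exE conjE)
    fix M assume "U = mv M"
    moreover obtain a b c d where "M = ((a, b), (c, d))" by (metis surj_pair)
    ultimately have "\<forall>z. U (1, z) = (poly [:a, b:] z, poly [:c, d:] z)" "\<forall>z. U (z, 1) = (poly [:b, a:] z, poly [:d, c:] z)"
      by (simp_all add: mv_def)
    then show ?thesis by blast
  next
    fix v assume "U = (\<lambda>_. v)"
    then have "\<forall>z. U (1, z) = (poly [:fst v:] z, poly [:snd v:] z)" "\<forall>z. U (z, 1) = (poly [:fst v:] z, poly [:snd v:] z)"
      by simp_all
    then show ?thesis by blast
  qed
  then show "\<exists>p1 p2. \<forall>z. U (1, z) = (poly p1 z, poly p2 z)" "\<exists>p1 p2. \<forall>z. U (z, 1) = (poly p1 z, poly p2 z)"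
    by blast+
qed

text \<open>The chart \<open>(1, z)\<close> is settled directly. The chart \<open>(z, 1)\<close>,
  needed for the point \<open>(0, 1)\<close>, inherits infinitely many agreements through
  \<open>z \<mapsto> 1 / z\<close>, and the identity principle applies again.\<close>

lemma regular_map_param_identity:
  fixes E :: "('k::field P1 \<times> 'k P1) set"
  assumes reg: "regular_map_to_P1 E \<phi>" and U: "param U" and V: "param V" and W: "param W"
    and E: "\<And>u. u \<noteq> (0, 0) \<Longrightarrow> (pv (U u), pv (V u)) \<in> E"
    and inf: "infinite {z. \<phi> (pv (U (1, z)), pv (V (1, z))) = pv (W (1, z))}"
    and u: "u \<noteq> (0, 0)"
  shows "\<phi> (pv (U u), pv (V u)) = pv (W u)"
proof -
  note nz = param_nonzero[OF U] param_nonzero[OF V] param_nonzero[OF W]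
  have scale: "\<phi> (pv (U (c * fst u, c * snd u)), pv (V (c * fst u, c * snd u))) = pv (W (c * fst u, c * snd u)) \<longleftrightarrow>
      \<phi> (pv (U u), pv (V u)) = pv (W u)" if "c \<noteq> 0" for c u
    using that by (simp add: param_scale U V W)
  have one: "\<phi> (pv (U (1, z)), pv (V (1, z))) = pv (W (1, z))" for z
  proof -
    obtain u1 u2 where U': "\<And>z. U (1, z) = (poly u1 z, poly u2 z)" using param_poly(1)[OF U] by blast
    obtain v1 v2 where V': "\<And>z. V (1, z) = (poly v1 z, poly v2 z)" using param_poly(1)[OF V] by blast
    obtain w1 w2 where W': "\<And>z. W (1, z) = (poly w1 z, poly w2 z)" using param_poly(1)[OF W] by blast
    show ?thesis
      unfolding U' V' W'
      by (rule regular_map_identity[OF reg])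
        (use nz[of "(1, _)"] E[of "(1, _)"] inf in \<open>simp_all add: U' V' W'\<close>)
  qed
  have two: "\<phi> (pv (U (z, 1)), pv (V (z, 1))) = pv (W (z, 1))" for z
  proof -
    obtain u1 u2 where U': "\<And>z. U (z, 1) = (poly u1 z, poly u2 z)" using param_poly(2)[OF U] by blast
    obtain v1 v2 where V': "\<And>z. V (z, 1) = (poly v1 z, poly v2 z)" using param_poly(2)[OF V] by blast
    obtain w1 w2 where W': "\<And>z. W (z, 1) = (poly w1 z, poly w2 z)" using param_poly(2)[OF W] by blast
    have "UNIV - {0} \<subseteq> {z. \<phi> (pv (U (z, 1)), pv (V (z, 1))) = pv (W (z, 1))}"
    proof safe
      fix z :: 'k assume "z \<noteq> 0"
      then show "\<phi> (pv (U (z, 1)), pv (V (z, 1))) = pv (W (z, 1))"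
        using scale[of z "(1, inverse z)"] one[of "inverse z"] by simp
    qed
    moreover have "infinite (UNIV :: 'k set)"
      using inf finite_subset subset_UNIV by blast
    then have "infinite (UNIV - {0 :: 'k})" by simp
    ultimately have "infinite {z. \<phi> (pv (U (z, 1)), pv (V (z, 1))) = pv (W (z, 1))}"
      using finite_subset by blast
    then show ?thesis
      unfolding U' V' W'
      by (intro regular_map_identity[OF reg])
        (use nz[of "(_, 1)"] E[of "(_, 1)"] in \<open>simp_all add: U' V' W'\<close>)
  qed
  show ?thesis
  proof (cases "fst u = 0")
    case False
    then show ?thesis using scale[of "fst u" "(1, snd u / fst u)"] one by simp
  next
    case True
    then have "snd u \<noteq> 0" using u by (cases u) auto
    then show ?thesis using scale[of "snd u" "(fst u / snd u, 1)"] two by simp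
  qed
qed

text \<open>A form of bidegree \<open>(1, 1)\<close> is a bilinear form; if its matrix is singular,
  it has rank at most one and splits into factors of bidegrees \<open>(1, 0)\<close> and
  \<open>(0, 1)\<close>.\<close>

lemma irreducible_curve_1_1:
  fixes C :: "('k::field P1 \<times> 'k P1) set"
  assumes "irreducible_curve 1 1 C"
  obtains T where "mdet T \<noteq> 0"
    "\<And>u v. u \<noteq> (0, 0) \<Longrightarrow> v \<noteq> (0, 0) \<Longrightarrow> (pv u, pv v) \<in> C \<longleftrightarrow> cross v (mv T u) = 0"
proof -
  obtain F where irr: "irreducible_biform 1 1 F" and C: "C = zero_locus F"
    using assms by (auto simp: irreducible_curve_def)
  then have F: "biform 1 1 F" by (simp add: irreducible_biform_def)
  then obtain c where c0: "F (s, t) (s', t') =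
        (\<Sum>i\<le>1. \<Sum>j\<le>1. c i j * s ^ i * t ^ (1 - i) * s' ^ j * t' ^ (1 - j))" for s t s' t'
    unfolding biform_def by blast
  have c: "F (s, t) (s', t') = c 0 0 * t * t' + c 0 1 * t * s' + c 1 0 * s * t' + c 1 1 * s * s'" for s t s' t'
    by (simp add: c0 add_ac)
  \<comment> \<open>Chosen so that \<open>F u v = - cross v (mv T u)\<close>: the curve is the graph
    of \<open>T\<close>.\<close>
  define T where "T = ((c 1 0, c 0 0), (- c 1 1, - c 0 1))"
  have "mdet T \<noteq> 0"
  proof
    assume "mdet T = 0"
    then have d: "c 1 1 * c 0 0 = c 1 0 * c 0 1" by (simp add: T_def mdet_def algebra_simps)
    \<comment> \<open>A matrix of rank at most one is a column times a row.\<close>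
    have "\<exists>x y z w. c 1 1 = x * z \<and> c 1 0 = x * w \<and> c 0 1 = y * z \<and> c 0 0 = y * w"
    proof (cases "c 1 1 = 0")
      case False
      then show ?thesis using d
        by (intro exI[of _ 1] exI[of _ "c 0 1 / c 1 1"] exI[of _ "c 1 1"] exI[of _ "c 1 0"]) (auto simp: field_simps)
    next
      case c11: True
      show ?thesis
      proof (cases "c 1 0 = 0")
        case True
        then show ?thesis using c11
          by (intro exI[of _ 0] exI[of _ 1] exI[of _ "c 0 1"] exI[of _ "c 0 0"]) auto
      next
        case False
        then have "c 0 1 = 0" using d c11 by simp
        then show ?thesis using False c11
          by (intro exI[of _ 1] exI[of _ "c 0 0 / c 1 0"] exI[of _ 0] exI[of _ "c 1 0"]) auto
      qed
    qed
    then obtain x y z w where xyzw: "c 1 1 = x * z" "c 1 0 = x * w" "c 0 1 = y * z" "c 0 0 = y * w" by blast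
    define G H where "G = (\<lambda>(u :: 'k \<times> 'k) (v :: 'k \<times> 'k). x * fst u + y * snd u)"
      and "H = (\<lambda>(u :: 'k \<times> 'k) (v :: 'k \<times> 'k). z * fst v + w * snd v)"
    have "biform 1 0 G"
      unfolding biform_def by (rule exI[of _ "\<lambda>i j. if i = 1 then x else y"]) (simp add: G_def)
    moreover have "biform 0 1 H"
      unfolding biform_def by (rule exI[of _ "\<lambda>i j. if j = 1 then z else w"]) (simp add: H_def)
    moreover have "F = (\<lambda>u v. G u v * H u v)"
      by (intro ext) (auto simp: c xyzw G_def H_def algebra_simps simp del: One_nat_def)
    ultimately show False
      using irr unfolding irreducible_biform_def by fastforce
  qed
  moreover have "(pv u, pv v) \<in> C \<longleftrightarrow> cross v (mv T u) = 0" if "u \<noteq> (0, 0)" "v \<noteq> (0, 0)" for u v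
  proof -
    have "F u v = - cross v (mv T u)"
      by (cases u, cases v) (simp add: c T_def cross_def mv_def algebra_simps)
    then show ?thesis using zero_locus_pv[OF F that] C by simp
  qed
  ultimately show thesis by (rule that)
qed

section \<open>Multilinear forms and coordinate changes\<close>

text \<open>The form of the cubic part, summed over all eight words instead of the support: it is
  additive and applies to arbitrary members of an ideal, and on cubic elements it equals
  \<open>mlin\<close>.\<close>

definition tri :: "'k::field free_alg \<Rightarrow> 'k \<times> 'k \<Rightarrow> 'k \<times> 'k \<Rightarrow> 'k \<times> 'k \<Rightarrow> 'k" where
  "tri f u v w = (\<Sum>i\<in>{Lx, Ly}. \<Sum>j\<in>{Lx, Ly}. \<Sum>l\<in>{Lx, Ly}.
     cf f [i, j, l] * (coordinate i u * coordinate j v * coordinate l w))"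

lemma tri_expand: "tri f u v w =
    cf f [Lx, Lx, Lx] * (fst u * fst v * fst w) + cf f [Lx, Lx, Ly] * (fst u * fst v * snd w)
  + cf f [Lx, Ly, Lx] * (fst u * snd v * fst w) + cf f [Lx, Ly, Ly] * (fst u * snd v * snd w)
  + cf f [Ly, Lx, Lx] * (snd u * fst v * fst w) + cf f [Ly, Lx, Ly] * (snd u * fst v * snd w)
  + cf f [Ly, Ly, Lx] * (snd u * snd v * fst w) + cf f [Ly, Ly, Ly] * (snd u * snd v * snd w)"
  by (simp add: tri_def)

lemma tri_add: "tri (f + g) u v w = tri f u v w + tri g u v w"
  by (simp add: tri_expand lookup_add algebra_simps)

lemma tri_0 [simp]: "tri 0 u v w = 0"
  by (simp add: tri_def)

lemma mlin_3:
  assumes "homogeneous 3 f"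
  shows "mlin f [u, v, w] = tri f u v w"
proof -
  let ?W = "\<lambda>(i, j, l). Word [i, j, l]"
  let ?L = "{Lx, Ly}"
  let ?K = "?W ` (?L \<times> ?L \<times> ?L)"
  have "Poly_Mapping.keys f \<subseteq> ?K"
  proof
    fix x assume "x \<in> Poly_Mapping.keys f"
    then have "length (letters x) = 3" using assms by (simp add: homogeneous_def)
    then obtain i j l where "letters x = [i, j, l]" by (rule length_3_cases)
    then have "x = ?W (i, j, l)" by (cases x) simp
    then show "x \<in> ?K" using letter.exhaust by blast
  qed
  then have "mlin f [u, v, w] = (\<Sum>x\<in>?K. Poly_Mapping.lookup f x * prod_list (map2 coordinate (letters x) [u, v, w]))"
    unfolding mlin_def by (intro sum.mono_neutral_left) (auto simp: in_keys_iff)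
  also have "\<dots> = (\<Sum>(i, j, l)\<in>?L \<times> ?L \<times> ?L. cf f [i, j, l] * (coordinate i u * coordinate j v * coordinate l w))"
    by (subst sum.reindex) (auto simp: inj_on_def mult.assoc intro!: sum.cong)
  also have "\<dots> = tri f u v w"
    unfolding tri_def by (simp only: sum.cartesian_product)
  finally show ?thesis .
qed

lemma mlin_2:
  assumes "homogeneous 2 f"
  shows "mlin f [u, v] = (\<Sum>i\<in>{Lx, Ly}. \<Sum>j\<in>{Lx, Ly}. cf f [i, j] * (coordinate i u * coordinate j v))"
proof -
  let ?W = "\<lambda>(i, j). Word [i, j]"
  let ?L = "{Lx, Ly}"
  let ?K = "?W ` (?L \<times> ?L)"
  have "Poly_Mapping.keys f \<subseteq> ?K"
  proof
    fix x assume "x \<in> Poly_Mapping.keys f"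
    then have "length (letters x) = 2" using assms by (simp add: homogeneous_def)
    then obtain i j where "letters x = [i, j]" by (metis length_0_conv length_Suc_conv numeral_2_eq_2)
    then have "x = ?W (i, j)" by (cases x) simp
    then show "x \<in> ?K" using letter.exhaust by blast
  qed
  then have "mlin f [u, v] = (\<Sum>x\<in>?K. Poly_Mapping.lookup f x * prod_list (map2 coordinate (letters x) [u, v]))"
    unfolding mlin_def by (intro sum.mono_neutral_left) (auto simp: in_keys_iff)
  also have "\<dots> = (\<Sum>(i, j)\<in>?L \<times> ?L. cf f [i, j] * (coordinate i u * coordinate j v))"
    by (subst sum.reindex) (auto simp: inj_on_def mult.assoc intro!: sum.cong)
  finally show ?thesis by (simp only: sum.cartesian_product)
qed

text \<open>On elements without terms below degree three, multiplication by \<open>x\<close> on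
  either side multiplies the cubic part by the constant term of \<open>x\<close>. Among these
  elements the vanishing of \<open>tri\<close> at a point cuts out an ideal, so it passes from the
  relation space to everything it generates.\<close>

lemma genideal_relation_space:
  fixes g :: "'k::field free_alg"
  assumes g: "g \<in> genideal FA (relation_space E \<sigma>)" and e: "(p, q) \<in> E"
    and uvw: "u \<in> coords p" "v \<in> coords q" "w \<in> coords (snd (\<sigma> (p, q)))"
  shows "tri g u v w = 0"
proof -
  let ?J = "{f :: 'k free_alg. (\<forall>ls. length ls < 3 \<longrightarrow> cf f ls = 0) \<and> tri f u v w = 0}"
  have "ideal ?J FA"
    unfolding ideal_FA_iff
  proof (intro conjI ballI allI)
    show "0 \<in> ?J" by (simp add: tri_def)
    show "a + b \<in> ?J" if "a \<in> ?J" "b \<in> ?J" for a b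
      using that by (auto simp: tri_add lookup_add)
    fix a x :: "'k free_alg" assume a: "a \<in> ?J"
    have "x * a \<in> {f. \<forall>ls. length ls < 3 \<longrightarrow> cf f ls = 0}" "a * x \<in> {f. \<forall>ls. length ls < 3 \<longrightarrow> cf f ls = 0}"
      using ideal_low_degree[of 3, where 'k = 'k] a unfolding ideal_FA_iff by auto
    moreover have "cf a [] = 0" "cf a [l] = 0" "cf a [l, m] = 0" for l m
      using a by auto
    then have "tri (x * a) u v w = cf x [] * tri a u v w" "tri (a * x) u v w = cf x [] * tri a u v w"
      by (simp_all add: tri_expand cf_mult_3 algebra_simps)
    ultimately show "x * a \<in> ?J" "a * x \<in> ?J" using a by auto
  qed
  moreover have "relation_space E \<sigma> \<subseteq> ?J"
  proof
    fix f assume f: "f \<in> relation_space E \<sigma>"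
    then have h: "homogeneous 3 f" by (simp add: relation_space_def)
    moreover have "mlin f [u, v, w] = 0"
      using f e uvw by (auto simp: relation_space_def)
    ultimately show "f \<in> ?J" by (auto simp: mlin_3 homogeneous_iff)
  qed
  ultimately show ?thesis using genideal_FA_minimal[of ?J] g by blast
qed

section \<open>Independence of the two relations\<close>

definition indep2 :: "'k::field free_alg \<Rightarrow> 'k free_alg \<Rightarrow> bool" where
  "indep2 g h \<longleftrightarrow> (\<forall>a b. cst a * g + cst b * h = 0 \<longrightarrow> a = 0 \<and> b = 0)"

text \<open>A linear dependence of the relations is one of the rows of \<open>M\<close>, so
  \<open>det M\<close> vanishes identically.\<close>

lemma point_scheme_indep:
  fixes E :: "('k::field P1 \<times> 'k P1) set"
  assumes "point_scheme g1 g2 E" "E \<noteq> UNIV"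
  shows "indep2 g1 g2"
  unfolding indep2_def
proof (intro allI impI, rule ccontr)
  fix a b assume z: "cst a * g1 + cst b * g2 = 0" and ab: "\<not> (a = 0 \<and> b = 0)"
  obtain m11 m12 m21 m22 where h: "homogeneous 2 m11" "homogeneous 2 m12" "homogeneous 2 m21" "homogeneous 2 m22"
    and g: "g1 = m11 * gx + m12 * gy" "g2 = m21 * gx + m22 * gy"
    and E: "E = zero_locus (\<lambda>u v. mlin m11 [u, v] * mlin m22 [u, v] - mlin m12 [u, v] * mlin m21 [u, v])"
    using assms(1) unfolding point_scheme_def by blast
  have "(cst a * m11 + cst b * m21) * gx + (cst a * m12 + cst b * m22) * gy = 0 * gx + 0 * gy"
    using z by (simp add: g algebra_simps)
  then have m: "cst a * m11 + cst b * m21 = 0" "cst a * m12 + cst b * m22 = 0"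
    using gx_gy_unique by blast+
  have lin: "a * mlin m [u, v] + b * mlin m' [u, v] = 0"
    if "cst a * m + cst b * m' = 0" "homogeneous 2 m" "homogeneous 2 m'" for m m' u v
  proof -
    have cfs: "a * cf m ls + b * cf m' ls = 0" for ls
      using arg_cong[OF that(1), of "\<lambda>f. cf f ls"] by (simp add: lookup_add)
    have "a * mlin m [u, v] + b * mlin m' [u, v]
        = (\<Sum>i\<in>{Lx, Ly}. \<Sum>j\<in>{Lx, Ly}. (a * cf m [i, j] + b * cf m' [i, j]) * (coordinate i u * coordinate j v))"
      by (simp add: mlin_2 that algebra_simps)
    then show ?thesis by (simp add: cfs)
  qed
  have "mlin m11 [u, v] * mlin m22 [u, v] - mlin m12 [u, v] * mlin m21 [u, v] = 0" for u v
  proof -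
    have e: "a * mlin m11 [u, v] + b * mlin m21 [u, v] = 0" "a * mlin m12 [u, v] + b * mlin m22 [u, v] = 0"
      using lin m h by blast+
    have "x * w - z * y = 0" if "a * x + b * y = 0" "a * z + b * w = 0" for x y z w
    proof -
      have "a * (x * w - z * y) = w * (a * x + b * y) - y * (a * z + b * w)"
        "b * (x * w - z * y) = x * (a * z + b * w) - z * (a * x + b * y)"
        by (simp_all add: algebra_simps)
      then show ?thesis using that ab by auto
    qed
    from this[OF e] show ?thesis .
  qed
  then have "E = UNIV" unfolding E zero_locus_def by auto
  then show False using assms(2) by simp
qed

text \<open>Two independent elements in the span of \<open>h1\<close>, \<open>h2\<close> have an
  invertible coefficient matrix, of determinant \<open>D\<close>, so they span the same space. An
  upper bound for the solutions of the linear system is therefore enough to identify the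
  algebra.\<close>

lemma presented_span:
  fixes h1 h2 :: "'k::field free_alg"
  assumes ind: "indep2 g1 g2" and g: "g1 = cst a1 * h1 + cst b1 * h2" "g2 = cst a2 * h1 + cst b2 * h2"
  shows "presented {g1, g2} = presented {h1, h2}" "indep2 h1 h2"
proof -
  define D where "D = a1 * b2 - a2 * b1"
  have ind': "a = 0 \<and> b = 0" if "cst a * g1 + cst b * g2 = 0" for a b
    using ind that unfolding indep2_def by blast
  have eqs: "cst b2 * g1 + cst (- b1) * g2 = cst D * h1" "cst (- a2) * g1 + cst a1 * g2 = cst D * h2"
    by (rule free_alg_eqI, simp add: g lookup_add D_def algebra_simps)+
  have "D \<noteq> 0"
  proof
    assume "D = 0"
    then have "b2 = 0 \<and> - b1 = 0" "- a2 = 0 \<and> a1 = 0"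
      using ind'[of b2 "- b1"] ind'[of "- a2" a1] unfolding eqs by simp_all
    then have "cst 1 * g1 + cst 0 * g2 = 0" by (simp add: g)
    then have "(1 :: 'k) = 0 \<and> (0 :: 'k) = 0" by (rule ind')
    then show False by simp
  qed
  have h: "h1 = cst (b2 / D) * g1 + cst (- b1 / D) * g2" "h2 = cst (- a2 / D) * g1 + cst (a1 / D) * g2"
  proof -
    have "cf h1 ls = b2 / D * cf g1 ls + - b1 / D * cf g2 ls \<and> cf h2 ls = - a2 / D * cf g1 ls + a1 / D * cf g2 ls" for ls
    proof -
      have "b2 * cf g1 ls - b1 * cf g2 ls = cf (cst b2 * g1 + cst (- b1) * g2) ls"
        "- a2 * cf g1 ls + a1 * cf g2 ls = cf (cst (- a2) * g1 + cst a1 * g2) ls"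
        by (simp_all add: lookup_add)
      then have "b2 * cf g1 ls - b1 * cf g2 ls = D * cf h1 ls" "- a2 * cf g1 ls + a1 * cf g2 ls = D * cf h2 ls"
        unfolding eqs by simp_all
      then have "cf h1 ls = (b2 * cf g1 ls - b1 * cf g2 ls) / D" "cf h2 ls = (- a2 * cf g1 ls + a1 * cf g2 ls) / D"
        using \<open>D \<noteq> 0\<close> by simp_all
      then show ?thesis by (simp add: diff_divide_distrib add_divide_distrib)
    qed
    then show "h1 = cst (b2 / D) * g1 + cst (- b1 / D) * g2" "h2 = cst (- a2 / D) * g1 + cst (a1 / D) * g2"
      by (auto intro!: free_alg_eqI simp: lookup_add)
  qed
  have comb: "cst a * f + cst b * f' \<in> genideal FA {f, f'}" for a b and f f' :: "'k free_alg"
    by (intro genideal_FA_add genideal_FA_l genideal_FA_gen) auto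
  have "g1 \<in> genideal FA {h1, h2}" "g2 \<in> genideal FA {h1, h2}"
    unfolding g by (rule comb)+
  moreover have "h1 \<in> genideal FA {g1, g2}" "h2 \<in> genideal FA {g1, g2}"
    by (subst h, rule comb)+
  ultimately show "presented {g1, g2} = presented {h1, h2}"
    by (intro presented_cong) auto
  show "indep2 h1 h2"
    unfolding indep2_def
  proof (intro allI impI)
    fix \<alpha> \<beta> assume z: "cst \<alpha> * h1 + cst \<beta> * h2 = 0"
    have "cst (\<alpha> * b2 - \<beta> * a2) * g1 + cst (\<beta> * a1 - \<alpha> * b1) * g2 = cst D * (cst \<alpha> * h1 + cst \<beta> * h2)"
      by (rule free_alg_eqI) (simp add: g lookup_add D_def algebra_simps)
    then have "\<alpha> * b2 - \<beta> * a2 = 0 \<and> \<beta> * a1 - \<alpha> * b1 = 0" unfolding z by (intro ind') simp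
    moreover have "\<alpha> * D = a1 * (\<alpha> * b2 - \<beta> * a2) + a2 * (\<beta> * a1 - \<alpha> * b1)"
      "\<beta> * D = b2 * (\<beta> * a1 - \<alpha> * b1) + b1 * (\<alpha> * b2 - \<beta> * a2)"
      by (simp_all add: D_def algebra_simps)
    ultimately have "\<alpha> * D = 0" "\<beta> * D = 0" by simp_all
    then show "\<alpha> = 0 \<and> \<beta> = 0" using \<open>D \<noteq> 0\<close> by simp
  qed
qed

text \<open>Substituting \<open>lin_subst B\<close> pulls a form back along \<open>mv B\<close>.\<close>

fun lin_subst :: "'k::field mat2 \<Rightarrow> letter \<Rightarrow> 'k free_alg" where
  "lin_subst B Lx = cst (fst (fst B)) * gx + cst (snd (fst B)) * gy"
| "lin_subst B Ly = cst (fst (snd B)) * gx + cst (snd (snd B)) * gy"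

lemma lin_subst_homogeneous: "homogeneous 1 (lin_subst B l)"
  using homogeneous_gx homogeneous_gy by (cases l) (auto intro!: homogeneous_add homogeneous_cst)

lemma cf_lin_subst: "cf (lin_subst B l) [Lx] * fst u + cf (lin_subst B l) [Ly] * snd u = coordinate l (mv B u)"
  by (cases l) (auto simp: lookup_add cf_gx cf_gy mv_def)

lemma tri_linear_forms:
  assumes L: "\<And>l. homogeneous 1 (v l)"
  shows "tri (cst c * (v i * (v j * v l))) u1 u2 u3
    = c * ((cf (v i) [Lx] * fst u1 + cf (v i) [Ly] * snd u1) * (cf (v j) [Lx] * fst u2 + cf (v j) [Ly] * snd u2)
      * (cf (v l) [Lx] * fst u3 + cf (v l) [Ly] * snd u3))"
proof -
  have z: "cf (v m) [] = 0" "cf (v m) [a, b] = 0" "cf (v m) [a, b, d] = 0" for m a b d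
    using L[of m] by (auto simp: homogeneous_iff)
  show ?thesis by (simp add: tri_expand cf_mult_1 cf_mult_2 cf_mult_3 cf_cst z algebra_simps)
qed

lemma tri_sum: "tri (\<Sum>i\<in>S. f i) u v w = (\<Sum>i\<in>S. tri (f i) u v w)"
  by (induction S rule: infinite_finite_induct) (auto simp: tri_add)

text \<open>On a word both sides are a product of three linear forms, and
  \<open>lin_subst B l\<close> is the coordinate of the letter \<open>l\<close> composed with
  \<open>mv B\<close>.\<close>

lemma tri_subst:
  assumes "homogeneous 3 g"
  shows "tri (subst (lin_subst B) g) u v w = tri g (mv B u) (mv B v) (mv B w)"
proof -
  have "tri (subst (lin_subst B) g) u v w
      = (\<Sum>x\<in>Poly_Mapping.keys g. Poly_Mapping.lookup g x * prod_list (map2 coordinate (letters x) [mv B u, mv B v, mv B w]))"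
    unfolding subst_def tri_sum
  proof (rule sum.cong)
    fix x assume "x \<in> Poly_Mapping.keys g"
    then have "length (letters x) = 3" using assms by (simp add: homogeneous_def)
    then obtain i j l where x: "letters x = [i, j, l]" by (rule length_3_cases)
    show "tri (cst (Poly_Mapping.lookup g x) * prod_list (map (lin_subst B) (letters x))) u v w
        = Poly_Mapping.lookup g x * prod_list (map2 coordinate (letters x) [mv B u, mv B v, mv B w])"
      using tri_linear_forms[of "lin_subst B" "Poly_Mapping.lookup g x" i j l u v w, OF lin_subst_homogeneous]
      by (simp add: x cf_lin_subst mult.assoc)
  qed simp
  also have "\<dots> = tri g (mv B u) (mv B v) (mv B w)"
    using mlin_3[OF assms] by (simp add: mlin_def)
  finally show ?thesis .
qed

text \<open>Pulling back is contravariant, which reverses the order of the matrices.\<close>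

lemma subst_lin_subst: "subst (lin_subst M) (subst (lin_subst B) f) = subst (lin_subst (mm B M)) f"
proof -
  have "subst (lin_subst M) (lin_subst B l) = lin_subst (mm B M) l" for l
    by (cases l; rule free_alg_eqI)
      (simp_all add: subst_add subst_mult lookup_add mm_def algebra_simps)
  then have "(\<lambda>l. subst (lin_subst M) (lin_subst B l)) = lin_subst (mm B M)" by (rule ext)
  then show ?thesis by (simp add: subst_compose)
qed

lemma subst_minv:
  assumes "mdet M \<noteq> 0"
  shows "subst (lin_subst M) (subst (lin_subst (minv M)) f) = f"
    "subst (lin_subst (minv M)) (subst (lin_subst M) f) = f"
  unfolding subst_lin_subst mm_minv[OF assms] by (rule subst_id; simp)+

lemma indep2_subst:
  assumes "mdet B \<noteq> 0" "indep2 g1 g2"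
  shows "indep2 (subst (lin_subst B) g1) (subst (lin_subst B) g2)"
  unfolding indep2_def
proof (intro allI impI)
  fix a b assume z: "cst a * subst (lin_subst B) g1 + cst b * subst (lin_subst B) g2 = 0"
  have "subst (lin_subst (minv B)) (cst a * subst (lin_subst B) g1 + cst b * subst (lin_subst B) g2)
      = cst a * g1 + cst b * g2"
    by (simp add: subst_add subst_mult subst_minv assms(1))
  then show "a = 0 \<and> b = 0" using assms(2) by (simp add: z indep2_def)
qed

lemma presented_lin_subst_iso:
  fixes g1 g2 :: "'k::field free_alg"
  assumes B: "mdet B \<noteq> 0" and ind: "indep2 g1 g2"
    and span: "\<And>g. g \<in> {g1, g2} \<Longrightarrow> \<exists>a b. subst (lin_subst B) g = cst a * h1 + cst b * h2"
  shows "presented {g1, g2} \<cong>\<^sub>g\<^sub>r presented {h1, h2}"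
proof -
  have "presented {g1, g2} \<cong>\<^sub>g\<^sub>r presented (subst (lin_subst B) ` {g1, g2})"
    using lin_subst_homogeneous subst_minv[OF B] by (intro presented_subst_iso[of _ "lin_subst (minv B)"])
  also have "subst (lin_subst B) ` {g1, g2} = {subst (lin_subst B) g1, subst (lin_subst B) g2}" by simp
  also have "presented \<dots> = presented {h1, h2}"
    using span[of g1] span[of g2] presented_span(1)[OF indep2_subst[OF B ind]] by auto
  finally show ?thesis .
qed

text \<open>The coordinate change is undone on the relations instead of transporting
  \<open>gldim\<close> along an isomorphism. In the original coordinates \<open>gy ^ 3\<close> is
  the cube of a linear form \<open>Y\<close>, which is why \<open>gldim_cube_relation\<close> allows
  any nonzero linear form.\<close>

lemma lin_subst_cube_not_gldim_3:
  fixes g1 g2 :: "'k::field free_alg"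
  assumes B: "mdet B \<noteq> 0" and ind: "indep2 g1 g2" and h: "homogeneous 3 h"
    and span: "\<And>g. g \<in> {g1, g2} \<Longrightarrow> \<exists>a b. subst (lin_subst B) g = cst a * h + cst b * gy ^ 3"
  shows "gldim (presented {g1, g2}) \<noteq> 3"
proof -
  define H where "H = subst (lin_subst (minv B)) h"
  define Y where "Y = subst (lin_subst (minv B)) gy"
  have span': "\<exists>a b. g = cst a * H + cst b * Y ^ 3" if g: "g \<in> {g1, g2}" for g
  proof -
    obtain a b where "subst (lin_subst B) g = cst a * h + cst b * gy ^ 3" using span[OF g] by blast
    then have "g = subst (lin_subst (minv B)) (cst a * h + cst b * gy ^ 3)"
      using subst_minv(2)[OF B] by metis
    then have "g = cst a * H + cst b * Y ^ 3"
      by (simp only: subst_add subst_mult subst_power subst_cst H_def Y_def)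
    then show ?thesis by blast
  qed
  have eq: "presented {g1, g2} = presented {H, Y ^ 3}" and ind': "indep2 H (Y ^ 3)"
    using span'[of g1] span'[of g2] presented_span[OF ind] by blast+
  have "homogeneous 3 H" unfolding H_def by (rule subst_homogeneous[OF lin_subst_homogeneous h])
  moreover have "homogeneous 1 Y" unfolding Y_def by (rule subst_homogeneous[OF lin_subst_homogeneous homogeneous_gy])
  moreover have "Y \<noteq> 0"
  proof
    assume "Y = 0"
    then have "gy = (0 :: 'k free_alg)" using subst_minv(1)[OF B, of gy] by (simp add: Y_def)
    then show False using cf_gy[of "[Ly]", where 'a = 'k] by simp
  qed
  ultimately show ?thesis
    unfolding eq using ind' by (intro gldim_cube_relation) (auto simp: indep2_def)
qed

section \<open>Point schemes and their automorphisms\<close>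

lemma AutG_D:
  assumes "\<sigma> \<in> AutG E"
  shows "e \<in> E \<Longrightarrow> \<sigma> e \<in> E" "\<lbrakk>e \<in> E; e' \<in> E; \<sigma> e = \<sigma> e'\<rbrakk> \<Longrightarrow> e = e'"
    "e \<in> E \<Longrightarrow> fst (\<sigma> e) = snd e" "regular_map_to_P1 E (snd \<circ> \<sigma>)"
proof -
  obtain \<sigma>' where \<sigma>': "\<And>e. e \<in> E \<Longrightarrow> \<sigma>' (\<sigma> e) = e"
    using assms unfolding AutG_def by blast
  then show "\<lbrakk>e \<in> E; e' \<in> E; \<sigma> e = \<sigma> e'\<rbrakk> \<Longrightarrow> e = e'" by metis
qed (use assms in \<open>auto simp: AutG_def morphism_def\<close>)

lemma AutG_eqI: "\<sigma> \<in> AutG E \<Longrightarrow> (p, q) \<in> E \<Longrightarrow> snd (\<sigma> (p, q)) = r \<Longrightarrow> \<sigma> (p, q) = (q, r)"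
  using AutG_D(3)[of \<sigma> E "(p, q)"] by (metis prod.collapse snd_conv)

text \<open>The condition \<open>fst (\<sigma> e) = snd e\<close> places the image of the horizontal
  line in the fibre over \<open>q\<close>, and injectivity makes that image infinite.\<close>

lemma AutG_infinite_fibre:
  fixes E :: "('k::field_char_0 P1 \<times> 'k P1) set"
  assumes \<sigma>: "\<sigma> \<in> AutG E" and q: "hline q \<subseteq> E"
  shows "infinite {y. (q, y) \<in> E}"
proof
  assume "finite {y. (q, y) \<in> E}"
  moreover have "range (\<lambda>x. snd (\<sigma> (x, q))) \<subseteq> {y. (q, y) \<in> E}"
  proof safe
    fix x
    have "(x, q) \<in> E" using q by (auto simp: hline_def)
    then show "(q, snd (\<sigma> (x, q))) \<in> E"
      using AutG_D(1)[OF \<sigma>, of "(x, q)"] AutG_eqI[OF \<sigma>, of x q] by simp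
  qed
  ultimately have "finite (range (\<lambda>x. snd (\<sigma> (x, q))))" using finite_subset by blast
  moreover have "inj (\<lambda>x. snd (\<sigma> (x, q)))"
  proof (rule injI)
    fix x y assume "snd (\<sigma> (x, q)) = snd (\<sigma> (y, q))"
    moreover have "(x, q) \<in> E" "(y, q) \<in> E" using q by (auto simp: hline_def)
    ultimately have "\<sigma> (x, q) = \<sigma> (y, q)" using AutG_eqI[OF \<sigma>] by metis
    then show "x = y" using AutG_D(2)[OF \<sigma> \<open>(x, q) \<in> E\<close> \<open>(y, q) \<in> E\<close>] by simp
  qed
  ultimately show False using infinite_P1 finite_imageD by blast
qed

text \<open>In the coordinates given by \<open>B\<close>, \<open>E\<close> is the union of the graph of \<open>T\<close> and of the vertical and
  the horizontal line through \<open>(1, 0)\<close>.\<close>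

definition framed :: "'k::field mat2 \<Rightarrow> 'k mat2 \<Rightarrow> ('k P1 \<times> 'k P1) set \<Rightarrow> bool" where
  "framed B T E \<longleftrightarrow> mdet B \<noteq> 0 \<and> mdet T \<noteq> 0 \<and>
     (\<forall>u v. u \<noteq> (0, 0) \<and> v \<noteq> (0, 0) \<longrightarrow>
        ((pv (mv B u), pv (mv B v)) \<in> E \<longleftrightarrow> snd u = 0 \<or> snd v = 0 \<or> cross v (mv T u) = 0))"

lemma framedD:
  assumes "framed B T E"
  shows "mdet B \<noteq> 0" "mdet T \<noteq> 0"
    "\<And>u v. u \<noteq> (0, 0) \<Longrightarrow> v \<noteq> (0, 0) \<Longrightarrow>
      (pv (mv B u), pv (mv B v)) \<in> E \<longleftrightarrow> snd u = 0 \<or> snd v = 0 \<or> cross v (mv T u) = 0"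
  using assms by (auto simp: framed_def)

lemma cross_self [simp]: "cross u u = 0"
  by (simp add: cross_def)

lemma framed_not_UNIV:
  assumes "framed B T E" shows "E \<noteq> UNIV"
proof
  assume E: "E = UNIV"
  have "cross (0, 1) (mv T (0, 1)) = 0" "cross (1, 1) (mv T (0, 1)) = 0"
    using framedD(3)[OF assms, of "(0, 1)" "(0, 1)"] framedD(3)[OF assms, of "(0, 1)" "(1, 1)"]
    unfolding E by simp_all
  then have "mv T (0, 1) = (0, 0)" by (simp add: cross_def prod_eq_iff)
  then show False using mv_nonzero[OF framedD(2)[OF assms], of "(0, 1)"] by simp
qed

section \<open>Coordinates adapted to a conic and two lines\<close>

lemma ex_frame:
  fixes p :: "'k::field P1"
  shows "\<exists>B. mdet B \<noteq> 0 \<and> p = pv (mv B (1, 0))"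
proof -
  obtain u where u: "u \<noteq> (0, 0)" "p = pv u" by (rule pvE)
  define B :: "'k mat2" where "B = ((fst u, if fst u = 0 then 1 else 0), (snd u, if fst u = 0 then 0 else 1))"
  have "mdet B \<noteq> 0" using u(1) by (cases u) (auto simp: B_def mdet_def)
  moreover have "mv B (1, 0) = u" by (simp add: B_def mv_def)
  ultimately show ?thesis using u(2) by metis
qed

lemma pv_mv_eq_1_0_iff:
  "mdet B \<noteq> 0 \<Longrightarrow> u \<noteq> (0, 0) \<Longrightarrow> pv (mv B u) = pv (mv B (1, 0)) \<longleftrightarrow> snd u = 0"
  by (subst pv_mv_eq_iff) (auto simp: cross_def)

lemma pv_mv_eq_0_1_iff:
  "mdet B \<noteq> 0 \<Longrightarrow> u \<noteq> (0, 0) \<Longrightarrow> pv (mv B u) = pv (mv B (0, 1)) \<longleftrightarrow> fst u = 0"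
  by (subst pv_mv_eq_iff) (auto simp: cross_def)

text \<open>If \<open>p\<close> and \<open>q\<close> were different, the fibre of \<open>E\<close>
  over \<open>q\<close> would contain at most \<open>q\<close> and the point of \<open>C\<close>
  over \<open>q\<close>, against \<open>AutG_infinite_fibre\<close>.\<close>

lemma framedI:
  fixes C :: "('k::field_char_0 P1 \<times> 'k P1) set"
  assumes C: "irreducible_curve 1 1 C" and E: "E = C \<union> vline p \<union> hline q" and \<sigma>: "\<sigma> \<in> AutG E"
  obtains B T where "framed B T E" "p = q" "p = pv (mv B (1, 0))"
    "\<And>u v. u \<noteq> (0, 0) \<Longrightarrow> v \<noteq> (0, 0) \<Longrightarrow> (pv (mv B u), pv (mv B v)) \<in> C \<longleftrightarrow> cross v (mv T u) = 0"
proof -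
  obtain T where T: "mdet T \<noteq> 0"
    and CT: "\<And>u v. u \<noteq> (0, 0) \<Longrightarrow> v \<noteq> (0, 0) \<Longrightarrow> (pv u, pv v) \<in> C \<longleftrightarrow> cross v (mv T u) = 0"
    using irreducible_curve_1_1[OF C] by blast
  have pq: "p = q"
  proof (rule ccontr)
    assume "p \<noteq> q"
    obtain u where u: "u \<noteq> (0, 0)" "q = pv u" by (rule pvE)
    have "{y. (q, y) \<in> E} \<subseteq> {q, pv (mv T u)}"
    proof
      fix y assume "y \<in> {y. (q, y) \<in> E}"
      then have "y = q \<or> (q, y) \<in> C" using \<open>p \<noteq> q\<close> by (auto simp: E vline_def hline_def)
      moreover obtain v where "v \<noteq> (0, 0)" "y = pv v" by (rule pvE)
      ultimately show "y \<in> {q, pv (mv T u)}"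
        using CT[OF u(1), of v] pv_eq_iff[of v "mv T u"] mv_nonzero[OF T u(1)] u(2) by auto
    qed
    moreover have "finite {q, pv (mv T u)}" by simp
    ultimately have "finite {y. (q, y) \<in> E}" by (rule finite_subset)
    moreover have "hline q \<subseteq> E" by (auto simp: E)
    ultimately show False using AutG_infinite_fibre[OF \<sigma>] by blast
  qed
  obtain B where B: "mdet B \<noteq> 0" "p = pv (mv B (1, 0))" using ex_frame by blast
  \<comment> \<open>Conjugation by \<open>B\<close> expresses the automorphism with graph
    \<open>C\<close> in the new coordinates.\<close>
  define T' where "T' = mm (minv B) (mm T B)"
  have T': "mdet T' \<noteq> 0" using T B(1) mdet_minv[OF B(1)] by (simp add: T'_def mdet_mm)
  have C': "(pv (mv B u), pv (mv B v)) \<in> C \<longleftrightarrow> cross v (mv T' u) = 0" if "u \<noteq> (0, 0)" "v \<noteq> (0, 0)" for u v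
  proof -
    have "mv T (mv B u) = mv B (mv T' u)" by (simp add: T'_def mv_mm mv_minv B(1))
    then show ?thesis
      using CT[OF mv_nonzero[OF B(1) that(1)] mv_nonzero[OF B(1) that(2)]] B(1) by (simp add: cross_mv)
  qed
  have "framed B T' E"
    unfolding framed_def
    using B(1) T' C' pv_mv_eq_1_0_iff[OF B(1)] by (auto simp: E vline_def hline_def B(2) simp flip: pq)
  then show thesis using that pq B(2) C' by blast
qed

text \<open>\<open>M\<close> is triangular, so it fixes the point \<open>(1, 0)\<close> that
  determines both lines, and \<open>T'\<close> is the conjugate of \<open>T\<close> by
  \<open>M\<close> up to the scalar \<open>c\<close>, which is invisible projectively.\<close>

lemma reframe:
  fixes B :: "'k::field mat2"
  assumes fr: "framed B T E" and M: "mdet M \<noteq> 0" and k: "k \<noteq> 0" "\<And>u. snd (mv M u) = k * snd u"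
    and T': "mdet T' \<noteq> 0" and c: "c \<noteq> 0" "\<And>u. mv T (mv M u) = (c * fst (mv M (mv T' u)), c * snd (mv M (mv T' u)))"
  shows "framed (mm B M) T' E"
  unfolding framed_def
proof (intro conjI allI impI)
  show "mdet (mm B M) \<noteq> 0" using framedD(1)[OF fr] M by (simp add: mdet_mm)
  fix u v :: "'k \<times> 'k" assume uv: "u \<noteq> (0, 0) \<and> v \<noteq> (0, 0)"
  have "cross (mv M v) (mv T (mv M u)) = c * cross (mv M v) (mv M (mv T' u))"
    by (simp add: c(2) cross_def algebra_simps)
  also have "\<dots> = c * mdet M * cross v (mv T' u)" by (simp add: cross_mv)
  finally show "((pv (mv (mm B M) u), pv (mv (mm B M) v)) \<in> E) =
      (snd u = 0 \<or> snd v = 0 \<or> cross v (mv T' u) = 0)"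
    using framedD(3)[OF fr mv_nonzero[OF M] mv_nonzero[OF M], of u v] uv M k c(1) by (simp add: mv_mm)
qed (rule T')

text \<open>Write \<open>p\<close> for the point \<open>(1, 0)\<close>. For general \<open>u\<close>
  the fibre of \<open>E\<close> over \<open>T u\<close> has at most the points \<open>p\<close> and
  \<open>T (T u)\<close>, and \<open>\<sigma>\<close> maps \<open>(p, T u)\<close> and
  \<open>(u, T u)\<close> injectively into it, hence in one of two ways. One of these occurs for
  infinitely many \<open>u\<close>, and the identity principle extends it to all
  \<open>u\<close>.\<close>

lemma framed_AutG_cases:
  fixes E :: "('k::field_char_0 P1 \<times> 'k P1) set"
  assumes fr: "framed B T E" and \<sigma>: "\<sigma> \<in> AutG E"
  obtains
    (fixed) "\<And>w. w \<noteq> (0, 0) \<Longrightarrow> \<sigma> (pv (mv B (1, 0)), pv (mv B w)) = (pv (mv B w), pv (mv B (1, 0)))"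
      "\<And>u. u \<noteq> (0, 0) \<Longrightarrow> \<sigma> (pv (mv B u), pv (mv B (mv T u))) = (pv (mv B (mv T u)), pv (mv B (mv T (mv T u))))"
  | (cyclic) "\<And>w. w \<noteq> (0, 0) \<Longrightarrow> \<sigma> (pv (mv B (1, 0)), pv (mv B w)) = (pv (mv B w), pv (mv B (mv T w)))"
      "\<And>u. u \<noteq> (0, 0) \<Longrightarrow> \<sigma> (pv (mv B u), pv (mv B (mv T u))) = (pv (mv B (mv T u)), pv (mv B (1, 0)))"
proof -
  note B = framedD(1)[OF fr] and T = framedD(2)[OF fr] and E = framedD(3)[OF fr]
  let ?p = "pv (mv B (1, 0))"
  let ?\<phi> = "snd \<circ> \<sigma>"
  \<comment> \<open>General means that neither \<open>u = (1, z)\<close> nor \<open>T u\<close> is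
    the point \<open>(1, 0)\<close>.\<close>
  define G where "G = {z. z \<noteq> 0 \<and> snd (mv T (1, z)) \<noteq> 0}"
  define G1 where "G1 = {z. ?\<phi> (?p, pv (mv B (mv T (1, z)))) = ?p \<and>
    ?\<phi> (pv (mv B (1, z)), pv (mv B (mv T (1, z)))) = pv (mv B (mv T (mv T (1, z))))}"
  define G2 where "G2 = {z. ?\<phi> (?p, pv (mv B (mv T (1, z)))) = pv (mv B (mv T (mv T (1, z)))) \<and>
    ?\<phi> (pv (mv B (1, z)), pv (mv B (mv T (1, z)))) = ?p}"
  have inE: "(?p, pv (mv B (mv T u))) \<in> E" "(pv (mv B u), pv (mv B (mv T u))) \<in> E" if "u \<noteq> (0, 0)" for u
    using E[of "(1, 0)" "mv T u"] E[of u "mv T u"] mv_nonzero[OF T that] that by simp_all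
  have "infinite G"
  proof -
    obtain a b c d where abcd: "T = ((a, b), (c, d))" by (metis surj_pair)
    have "[:0, c, d:] \<noteq> 0" using T by (auto simp: abcd mdet_def)
    then have "finite {z. poly [:0, c, d:] z = 0}" by (rule poly_roots_finite)
    moreover have "UNIV - {z. poly [:0, c, d:] z = 0} \<subseteq> G"
      by (auto simp: G_def abcd mv_def mult.commute)
    moreover have "infinite (UNIV :: 'k set)" by (rule infinite_UNIV_char_0)
    ultimately show ?thesis by (meson Diff_infinite_finite infinite_super)
  qed
  moreover have "G \<subseteq> G1 \<union> G2"
  proof
    fix z assume z: "z \<in> G"
    let ?u = "(1, z)" and ?w = "mv T (1, z)"
    have w: "?w \<noteq> (0, 0)" "mv T ?w \<noteq> (0, 0)" using mv_nonzero[OF T] by auto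
    have x: "x = ?p \<or> x = pv (mv B (mv T ?w))" if "(pv (mv B ?w), x) \<in> E" for x
    proof -
      obtain v where v: "v \<noteq> (0, 0)" "x = pv (mv B v)" by (rule pv_mvE[OF B])
      then have "snd v = 0 \<or> cross v (mv T ?w) = 0" using E[OF w(1) v(1)] that z by (auto simp: G_def)
      then show ?thesis using pv_mv_eq_1_0_iff[OF B v(1)] pv_mv_eq_iff[OF B v(1) w(2)] v(2) by auto
    qed
    have eq: "\<sigma> (?p, pv (mv B ?w)) = (pv (mv B ?w), ?\<phi> (?p, pv (mv B ?w)))"
      "\<sigma> (pv (mv B ?u), pv (mv B ?w)) = (pv (mv B ?w), ?\<phi> (pv (mv B ?u), pv (mv B ?w)))"
      using AutG_eqI[OF \<sigma> inE(1)[of ?u]] AutG_eqI[OF \<sigma> inE(2)[of ?u]] by auto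
    have in1: "?\<phi> (?p, pv (mv B ?w)) = ?p \<or> ?\<phi> (?p, pv (mv B ?w)) = pv (mv B (mv T ?w))"
      using AutG_D(1)[OF \<sigma> inE(1)[of ?u]] x unfolding eq by auto
    have in2: "?\<phi> (pv (mv B ?u), pv (mv B ?w)) = ?p \<or> ?\<phi> (pv (mv B ?u), pv (mv B ?w)) = pv (mv B (mv T ?w))"
      using AutG_D(1)[OF \<sigma> inE(2)[of ?u]] x unfolding eq by auto
    have "pv (mv B ?u) \<noteq> ?p" using pv_mv_eq_1_0_iff[OF B, of ?u] z by (auto simp: G_def)
    then have "\<sigma> (?p, pv (mv B ?w)) \<noteq> \<sigma> (pv (mv B ?u), pv (mv B ?w))"
      using AutG_D(2)[OF \<sigma> inE(1)[of ?u] inE(2)[of ?u]] by auto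
    then have "?\<phi> (?p, pv (mv B ?w)) \<noteq> ?\<phi> (pv (mv B ?u), pv (mv B ?w))" using eq by metis
    then show "z \<in> G1 \<union> G2" unfolding G1_def G2_def using in1 in2 by auto
  qed
  ultimately have "infinite G1 \<or> infinite G2" using finite_subset by blast
  have par: "param (\<lambda>_. mv B (1, 0))" "param (mv B)" "param (\<lambda>u. mv B (mv T u))" "param (\<lambda>u. mv B (mv T (mv T u)))"
    using B T mv_nonzero[OF B, of "(1, 0)"] by (auto intro!: param_comp param_mv param_const)
  note ident = regular_map_param_identity[OF AutG_D(4)[OF \<sigma>]]
  \<comment> \<open>The vertical line was parametrised by \<open>T u\<close> to compare it with the
    conic at the same \<open>u\<close>; as \<open>T\<close> is invertible, every point
    \<open>w\<close> of it is reached.\<close>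
  have onto: "\<exists>u. u \<noteq> (0, 0) \<and> pv (mv B w) = pv (mv B (mv T u)) \<and> pv (mv B (mv T w)) = pv (mv B (mv T (mv T u)))"
    if w: "w \<noteq> (0, 0)" for w
    by (rule exI[of _ "mv (minv T) w"]) (simp only: mv_nonzero[OF mdet_minv[OF T] w] mv_minv[OF T], simp)
  show thesis
    using \<open>infinite G1 \<or> infinite G2\<close>
  proof
    assume inf: "infinite G1"
    have a: "?\<phi> (?p, pv (mv B (mv T u))) = ?p" if u: "u \<noteq> (0, 0)" for u
      by (rule ident[OF par(1,3,1) inE(1) infinite_super[OF _ inf] u]) (auto simp: G1_def)
    have b: "?\<phi> (pv (mv B u), pv (mv B (mv T u))) = pv (mv B (mv T (mv T u)))" if u: "u \<noteq> (0, 0)" for u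
      by (rule ident[OF par(2,3,4) inE(2) infinite_super[OF _ inf] u]) (auto simp: G1_def)
    show thesis
    proof (rule fixed)
      fix w :: "'k \<times> 'k" assume "w \<noteq> (0, 0)"
      then obtain u where u: "u \<noteq> (0, 0)" "pv (mv B w) = pv (mv B (mv T u))" using onto by blast
      then show "\<sigma> (?p, pv (mv B w)) = (pv (mv B w), ?p)"
        using AutG_eqI[OF \<sigma> inE(1)[OF u(1)]] a[OF u(1)] by simp
      show "\<sigma> (pv (mv B w), pv (mv B (mv T w))) = (pv (mv B (mv T w)), pv (mv B (mv T (mv T w))))"
        using AutG_eqI[OF \<sigma> inE(2)] b \<open>w \<noteq> (0, 0)\<close> by simp
    qed
  next
    assume inf: "infinite G2"
    have a: "?\<phi> (?p, pv (mv B (mv T u))) = pv (mv B (mv T (mv T u)))" if u: "u \<noteq> (0, 0)" for u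
      by (rule ident[OF par(1,3,4) inE(1) infinite_super[OF _ inf] u]) (auto simp: G2_def)
    have b: "?\<phi> (pv (mv B u), pv (mv B (mv T u))) = ?p" if u: "u \<noteq> (0, 0)" for u
      by (rule ident[OF par(2,3,1) inE(2) infinite_super[OF _ inf] u]) (auto simp: G2_def)
    show thesis
    proof (rule cyclic)
      fix w :: "'k \<times> 'k" assume "w \<noteq> (0, 0)"
      then obtain u where u: "u \<noteq> (0, 0)" "pv (mv B w) = pv (mv B (mv T u))"
        "pv (mv B (mv T w)) = pv (mv B (mv T (mv T u)))" using onto by blast
      then show "\<sigma> (?p, pv (mv B w)) = (pv (mv B w), pv (mv B (mv T w)))"
        using AutG_eqI[OF \<sigma> inE(1)[OF u(1)]] a[OF u(1)] by simp
      show "\<sigma> (pv (mv B w), pv (mv B (mv T w))) = (pv (mv B (mv T w)), ?p)"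
        using AutG_eqI[OF \<sigma> inE(2)] b \<open>w \<noteq> (0, 0)\<close> by simp
    qed
  qed
qed

section \<open>Normal forms of the conic for Types S' and T'\<close>

lemma type_S_framed:
  fixes E :: "('k::{alg_closed_field, field_char_0} P1 \<times> 'k P1) set"
  assumes "type_S E" and \<sigma>: "\<sigma> \<in> AutG E"
  shows "\<exists>B. framed B ((0, 1), (1, 0)) E"
proof -
  obtain C p q a0 b0 c0 where C: "irreducible_curve 1 1 C" and E: "E = C \<union> vline p \<union> hline q"
    and abc: "C \<inter> vline p = {a0}" "C \<inter> hline q = {b0}" "vline p \<inter> hline q = {c0}" "distinct [a0, b0, c0]"
    using assms(1) unfolding type_S_def by blast
  obtain B T where fr: "framed B T E" and pq: "p = q" and p: "p = pv (mv B (1, 0))"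
    and CT: "\<And>u v. u \<noteq> (0, 0) \<Longrightarrow> v \<noteq> (0, 0) \<Longrightarrow> (pv (mv B u), pv (mv B v)) \<in> C \<longleftrightarrow> cross v (mv T u) = 0"
    using framedI[OF C E \<sigma>] by blast
  note B = framedD(1)[OF fr] and T = framedD(2)[OF fr]
  obtain a b c d where abcd: "T = ((a, b), (c, d))" by (metis surj_pair)
  have "(p, p) \<notin> C"
  proof
    assume "(p, p) \<in> C"
    then have "(p, p) \<in> C \<inter> vline p" "(p, p) \<in> vline p \<inter> hline q" by (auto simp: vline_def hline_def pq)
    then show False using abc by auto
  qed
  then have c: "c \<noteq> 0"
    using CT[of "(1, 0)" "(1, 0)"] by (simp add: p abcd mv_def cross_def)
  \<comment> \<open>The point with coordinates \<open>(1, 0)\<close> and \<open>T (1, 0)\<close>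
    lies on the vertical line and on the conic; in either case the formulas for
    \<open>\<sigma>\<close> on these two components must agree there.\<close>
  have TT: "pv (mv B (mv T (mv T (1, 0)))) = pv (mv B (1, 0))"
  proof -
    have nz: "mv T (1, 0) \<noteq> (0, 0)" using mv_nonzero[OF T] by simp
    show ?thesis
    proof (rule framed_AutG_cases[OF fr \<sigma>], goal_cases)
      case 1
      from 1(1)[of "mv T (1, 0)"] 1(2)[of "(1, 0)"] nz show ?case by simp
    next
      case 2
      from 2(1)[of "mv T (1, 0)"] 2(2)[of "(1, 0)"] nz show ?case by simp
    qed
  qed
  have "mv T (mv T (1, 0)) \<noteq> (0, 0)" using mv_nonzero[OF T] by simp
  then have "snd (mv T (mv T (1, 0))) = 0" using TT pv_mv_eq_1_0_iff[OF B] by blast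
  \<comment> \<open>The left side is the lower left entry of the square of \<open>T\<close>. As
    \<open>c\<close> is nonzero, \<open>T\<close> is traceless and its square is the scalar
    \<open>D\<close>.\<close>
  then have "c * (a + d) = 0" by (simp add: abcd mv_def algebra_simps)
  then have d: "d = - a" using c by (simp add: eq_neg_iff_add_eq_0 add.commute)
  define D where "D = a * a + b * c"
  have D: "D \<noteq> 0" using T by (simp add: D_def abcd mdet_def d neg_eq_iff_add_eq_0)
  obtain l where l: "l ^ 2 = inverse D" using nth_root_exists[of 2 "inverse D"] by auto
  then have l0: "l \<noteq> 0" using D by auto
  have l2: "l * l * D = 1" using l D by (simp add: power2_eq_square)
  \<comment> \<open>The columns of \<open>M\<close> are \<open>(1, 0)\<close> and \<open>l\<close>
    times its image under \<open>T\<close>; since \<open>l ^ 2 * D = 1\<close>, \<open>T\<close>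
    interchanges them up to the common factor \<open>1 / l\<close>.\<close>
  define M :: "'k mat2" where "M = ((1, l * a), (0, l * c))"
  have "framed (mm B M) ((0, 1), (1, 0)) E"
  proof (rule reframe[OF fr, where k = "l * c" and c = "inverse l"])
    show "mdet M \<noteq> 0" "l * c \<noteq> 0" "inverse l \<noteq> 0" using l0 c by (simp_all add: M_def mdet_def)
    show "snd (mv M u) = l * c * snd u" for u by (simp add: M_def mv_def)
    show "mdet ((0, 1), (1, 0)) \<noteq> (0 :: 'k)" by (simp add: mdet_def)
    fix u :: "'k \<times> 'k"
    have "inverse l = l * D" using l2 l0 by (simp add: field_simps)
    show "mv T (mv M u) = (inverse l * fst (mv M (mv ((0, 1), (1, 0)) u)), inverse l * snd (mv M (mv ((0, 1), (1, 0)) u)))"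
    proof -
      have "mv T (mv M u) = (a * fst u + l * D * snd u, c * fst u)"
        by (simp add: mv_def M_def abcd d D_def algebra_simps)
      moreover have "inverse l * fst (mv M (mv ((0, 1), (1, 0)) u)) = a * fst u + inverse l * snd u"
        "inverse l * snd (mv M (mv ((0, 1), (1, 0)) u)) = c * fst u"
        using l0 by (simp_all add: mv_def M_def distrib_left)
      ultimately show ?thesis by (simp only: \<open>inverse l = l * D\<close>)
    qed
  qed
  then show ?thesis by blast
qed

text \<open>The common point of the three components is \<open>(p, p)\<close>, so \<open>T\<close>
  fixes \<open>(1, 0)\<close> and is triangular. The three cases are its Jordan forms up to a
  scalar; a scalar \<open>T\<close> is the diagonal case with \<open>\<delta> = 1\<close>.\<close>

lemma type_T_framed:
  fixes E :: "('k::field_char_0 P1 \<times> 'k P1) set"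
  assumes "type_T E" and \<sigma>: "\<sigma> \<in> AutG E"
  shows "(\<exists>B \<delta>. \<delta> \<noteq> 0 \<and> framed B ((1, 0), (0, \<delta>)) E) \<or> (\<exists>B. framed B ((1, 1), (0, 1)) E)"
proof -
  obtain C p q a0 where C: "irreducible_curve 1 1 C" and E: "E = C \<union> vline p \<union> hline q"
    and a0: "C \<inter> vline p = {a0}" "C \<inter> hline q = {a0}" "vline p \<inter> hline q = {a0}"
    using assms(1) unfolding type_T_def by blast
  obtain B T where fr: "framed B T E" and pq: "p = q" and p: "p = pv (mv B (1, 0))"
    and CT: "\<And>u v. u \<noteq> (0, 0) \<Longrightarrow> v \<noteq> (0, 0) \<Longrightarrow> (pv (mv B u), pv (mv B v)) \<in> C \<longleftrightarrow> cross v (mv T u) = 0"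
    using framedI[OF C E \<sigma>] by blast
  obtain a b c d where abcd: "T = ((a, b), (c, d))" by (metis surj_pair)
  have "(p, p) \<in> vline p \<inter> hline q" by (auto simp: vline_def hline_def pq)
  then have "(p, p) \<in> C" using a0 by auto
  then have c: "c = 0"
    using CT[of "(1, 0)" "(1, 0)"] by (simp add: p abcd mv_def cross_def)
  then have ad: "a \<noteq> 0" "d \<noteq> 0" using framedD(2)[OF fr] by (auto simp: abcd mdet_def)
  consider "a \<noteq> d" | "a = d" "b = 0" | "a = d" "b \<noteq> 0" by blast
  then show ?thesis
  proof cases
    case 1
    define M :: "'k mat2" where "M = ((1, b / (d - a)), (0, 1))"
    have "framed (mm B M) ((1, 0), (0, d / a)) E"
      by (rule reframe[OF fr, where k = 1 and c = a])
        (use ad 1 in \<open>auto simp: M_def mdet_def mv_def abcd c divide_simps, simp_all add: algebra_simps\<close>)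
    then show ?thesis using ad by (metis divide_eq_0_iff)
  next
    case 2
    have "framed (mm B ((1, 0), (0, 1))) ((1, 0), (0, 1)) E"
      by (rule reframe[OF fr, where k = 1 and c = a]) (use ad 2 in \<open>auto simp: mdet_def mv_def abcd c\<close>)
    then show ?thesis using zero_neq_one by metis
  next
    case 3
    have "framed (mm B ((1, 0), (0, a / b))) ((1, 1), (0, 1)) E"
      by (rule reframe[OF fr, where k = "a / b" and c = a])
        (use ad 3 in \<open>auto simp: mdet_def mv_def abcd c algebra_simps\<close>)
    then show ?thesis by blast
  qed
qed

text \<open>The frame is the inverse of the automorphism \<open>\<rho>\<close> that carries
  \<open>E\<close> to the standard curve \<open>E'\<close>.\<close>

lemma two_equivalent_framed:
  fixes E :: "('k::field P1 \<times> 'k P1) set"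
  assumes det: "a * d - b * c \<noteq> 0"
  defines "E' \<equiv> hline (pt 1 0) \<union> vline (pt 1 0) \<union> graph_curve (proj_map a b c d)"
  shows "two_equivalent E E' \<longleftrightarrow> (\<exists>B. framed B ((a, b), (c, d)) E)"
proof -
  let ?T = "((a, b), (c, d))"
  have T: "mdet ?T \<noteq> 0" using det by (simp add: mdet_def)
  have pt: "pt 1 0 = pv (1, 0)" by (simp add: pv_def)
  have E': "(pv u, pv v) \<in> E' \<longleftrightarrow> snd u = 0 \<or> snd v = 0 \<or> cross v (mv ?T u) = 0"
    if uv: "u \<noteq> (0, 0)" "v \<noteq> (0, 0)" for u v
  proof -
    have "(pv u, pv v) \<in> graph_curve (proj_map a b c d) \<longleftrightarrow> cross v (mv ?T u) = 0"
      using proj_map_pv[OF det uv(1)] pv_eq_iff[OF uv(2) mv_nonzero[OF T uv(1)]]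
      by (auto simp: graph_curve_def)
    then show ?thesis
      using pv_eq_iff[of u "(1, 0)"] pv_eq_iff[of v "(1, 0)"] uv
      by (auto simp: E'_def hline_def vline_def pt cross_def)
  qed
  have inv: "pv (mv (minv M) u) = pv u'"
    if M: "mdet M \<noteq> 0" and u: "u \<noteq> (0, 0)" "u' \<noteq> (0, 0)" and eq: "pv u = pv (mv M u')"
    for M :: "'k mat2" and u u'
  proof -
    have "cross u (mv M u') = 0" using eq pv_eq_iff[OF u(1) mv_nonzero[OF M u(2)]] by blast
    then have "cross (mv (minv M) u) u' = 0"
      using cross_mv[of "minv M" u "mv M u'"] by (simp only: mv_minv[OF M] mult_zero_right)
    then show ?thesis using pv_eq_iff[OF mv_nonzero[OF mdet_minv[OF M] u(1)] u(2)] by blast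
  qed
  have tr: "(pv u, pv v) \<in> map_prod \<rho> \<rho> ` E \<longleftrightarrow> (pv (mv (minv M) u), pv (mv (minv M) v)) \<in> E"
    if M: "mdet M \<noteq> 0" and \<rho>: "\<And>u. u \<noteq> (0, 0) \<Longrightarrow> \<rho> (pv u) = pv (mv M u)"
      and uv: "u \<noteq> (0, 0)" "v \<noteq> (0, 0)" for M \<rho> u v
  proof
    assume "(pv u, pv v) \<in> map_prod \<rho> \<rho> ` E"
    then obtain x y where xy: "(x, y) \<in> E" "pv u = \<rho> x" "pv v = \<rho> y" by auto
    obtain u' v' where u'v': "u' \<noteq> (0, 0)" "v' \<noteq> (0, 0)" "x = pv u'" "y = pv v'" by (metis ex_pv)
    have "pv (mv (minv M) u) = pv u'"
      using xy(2) \<rho>[OF u'v'(1)] u'v' uv by (intro inv[OF M]) simp_all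
    moreover have "pv (mv (minv M) v) = pv v'"
      using xy(3) \<rho>[OF u'v'(2)] u'v' uv by (intro inv[OF M]) simp_all
    ultimately show "(pv (mv (minv M) u), pv (mv (minv M) v)) \<in> E" using xy u'v' by simp
  next
    assume *: "(pv (mv (minv M) u), pv (mv (minv M) v)) \<in> E"
    have "\<rho> (pv (mv (minv M) u)) = pv u" "\<rho> (pv (mv (minv M) v)) = pv v"
      using \<rho> mv_nonzero[OF mdet_minv[OF M]] uv by (simp_all add: mv_minv M)
    then show "(pv u, pv v) \<in> map_prod \<rho> \<rho> ` E" using * by (metis image_eqI map_prod_simp)
  qed
  show ?thesis
  proof
    assume "two_equivalent E E'"
    then obtain x y z w where xyzw: "x * w - y * z \<noteq> 0" and eq: "E' = map_prod (proj_map x y z w) (proj_map x y z w) ` E"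
      unfolding two_equivalent_def Aut_P1_def by blast
    let ?M = "((x, y), (z, w))"
    have M: "mdet ?M \<noteq> 0" using xyzw by (simp add: mdet_def)
    have "framed (minv ?M) ?T E"
      unfolding framed_def
      using tr[OF M proj_map_pv[OF xyzw], folded eq] E' T mdet_minv[OF M] by blast
    then show "\<exists>B. framed B ?T E" by blast
  next
    assume "\<exists>B. framed B ?T E"
    then obtain B where fr: "framed B ?T E" by blast
    have B: "mdet B \<noteq> 0" by (rule framedD(1)[OF fr])
    obtain x y z w where M: "minv B = ((x, y), (z, w))" by (metis surj_pair)
    have dM: "mdet (minv B) \<noteq> 0" by (rule mdet_minv[OF B])
    then have xyzw: "x * w - y * z \<noteq> 0" by (simp add: M mdet_def)
    have BB: "mv (minv (minv B)) u = mv B u" for u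
      by (metis B dM mv_minv)
    have "(p, q) \<in> E' \<longleftrightarrow> (p, q) \<in> map_prod (proj_map x y z w) (proj_map x y z w) ` E" for p q
    proof -
      obtain u v where uv: "u \<noteq> (0, 0)" "v \<noteq> (0, 0)" "p = pv u" "q = pv v" by (metis ex_pv)
      then show ?thesis
        using tr[OF dM proj_map_pv[OF xyzw, folded M] uv(1,2)] E'[OF uv(1,2)] framedD(3)[OF fr uv(1,2)]
        by (simp add: BB)
    qed
    then have "E' = map_prod (proj_map x y z w) (proj_map x y z w) ` E" by auto
    then show "two_equivalent E E'" using xyzw unfolding two_equivalent_def Aut_P1_def by blast
  qed
qed

section \<open>Curves of Type FL and their automorphisms\<close>

definition FL_curve :: "'k P1 \<Rightarrow> 'k P1 \<Rightarrow> ('k::field P1 \<times> 'k P1) set" where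
  "FL_curve P Q = vline P \<union> vline Q \<union> hline P \<union> hline Q"

lemma mem_FL_curve: "(x, y) \<in> FL_curve P Q \<longleftrightarrow> x = P \<or> x = Q \<or> y = P \<or> y = Q"
  by (auto simp: FL_curve_def vline_def hline_def)

lemma type_FL_curve:
  fixes E :: "('k::field_char_0 P1 \<times> 'k P1) set"
  assumes "type_FL E" and \<sigma>: "\<sigma> \<in> AutG E"
  obtains P Q where "P \<noteq> Q" "E = FL_curve P Q"
proof -
  obtain p p' q q' where pq: "p \<noteq> p'" "q \<noteq> q'" and E: "E = vline p \<union> vline p' \<union> hline q \<union> hline q'"
    using assms(1) unfolding type_FL_def by blast
  have sub: "r = p \<or> r = p'" if "r = q \<or> r = q'" for r
  proof (rule ccontr)
    assume "\<not> (r = p \<or> r = p')"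
    then have "{y. (r, y) \<in> E} \<subseteq> {q, q'}" by (auto simp: E vline_def hline_def)
    then have "finite {y. (r, y) \<in> E}" by (rule finite_subset) simp
    moreover have "hline r \<subseteq> E" using that by (auto simp: E)
    ultimately show False using AutG_infinite_fibre[OF \<sigma>] by blast
  qed
  have "E = FL_curve p p'"
    using sub[of q] sub[of q'] pq by (auto simp: E FL_curve_def)
  then show thesis using pq that by blast
qed

text \<open>Over a point \<open>w\<close> other than \<open>P\<close> and \<open>Q\<close> the fibre
  of \<open>E\<close> is \<open>{P, Q}\<close>, and \<open>\<sigma>\<close> maps
  \<open>(P, w)\<close> and \<open>(Q, w)\<close> injectively into it. The choice made at infinitely
  many \<open>w\<close> propagates along both vertical lines by the identity principle.\<close>

lemma FL_curve_AutG_cases: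
  fixes E :: "('k::field_char_0 P1 \<times> 'k P1) set"
  assumes E: "E = FL_curve P Q" and PQ: "P \<noteq> Q" and \<sigma>: "\<sigma> \<in> AutG E"
  shows "(\<forall>p. \<sigma> (P, p) = (p, P) \<and> \<sigma> (Q, p) = (p, Q)) \<or> (\<forall>p. \<sigma> (P, p) = (p, Q) \<and> \<sigma> (Q, p) = (p, P))"
proof -
  obtain e f where e: "e \<noteq> (0, 0)" "P = pv e" and f: "f \<noteq> (0, 0)" "Q = pv f" by (metis ex_pv)
  let ?\<phi> = "snd \<circ> \<sigma>"
  define G where "G = {z. pv (1, z) \<noteq> P \<and> pv (1, z) \<noteq> Q}"
  define G1 where "G1 = {z. ?\<phi> (P, pv (1, z)) = P \<and> ?\<phi> (Q, pv (1, z)) = Q}"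
  define G2 where "G2 = {z. ?\<phi> (P, pv (1, z)) = Q \<and> ?\<phi> (Q, pv (1, z)) = P}"
  have inE: "(P, p) \<in> E" "(Q, p) \<in> E" for p by (auto simp: E mem_FL_curve)
  have "finite (UNIV - G)"
  proof -
    have "UNIV - G = (\<lambda>z. pv (1, z)) -` {P, Q}" by (auto simp: G_def)
    then show ?thesis using finite_vimageI[OF _ inj_pv_1, of "{P, Q}"] by simp
  qed
  then have "infinite G"
    using infinite_UNIV_char_0[where 'a = 'k] finite_Diff2[of G UNIV] by blast
  moreover have "G \<subseteq> G1 \<union> G2"
  proof
    fix z assume z: "z \<in> G"
    let ?w = "pv (1, z)"
    have eq: "\<sigma> (P, ?w) = (?w, ?\<phi> (P, ?w))" "\<sigma> (Q, ?w) = (?w, ?\<phi> (Q, ?w))"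
      using AutG_eqI[OF \<sigma> inE(1)] AutG_eqI[OF \<sigma> inE(2)] by auto
    have x: "x = P \<or> x = Q" if "(?w, x) \<in> E" for x
      using that z by (auto simp: E mem_FL_curve G_def)
    have "?\<phi> (P, ?w) = P \<or> ?\<phi> (P, ?w) = Q" "?\<phi> (Q, ?w) = P \<or> ?\<phi> (Q, ?w) = Q"
      using AutG_D(1)[OF \<sigma> inE(1)[of ?w]] AutG_D(1)[OF \<sigma> inE(2)[of ?w]] x unfolding eq by auto
    moreover have "\<sigma> (P, ?w) \<noteq> \<sigma> (Q, ?w)"
      using AutG_D(2)[OF \<sigma> inE(1)[of ?w] inE(2)[of ?w]] PQ by auto
    then have "?\<phi> (P, ?w) \<noteq> ?\<phi> (Q, ?w)" using eq by metis
    ultimately show "z \<in> G1 \<union> G2" unfolding G1_def G2_def by auto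
  qed
  ultimately have "infinite G1 \<or> infinite G2" using finite_subset by blast
  note ident = regular_map_param_identity[OF AutG_D(4)[OF \<sigma>]]
  note par = param_const[OF e(1)] param_const[OF f(1)] param_id
  show ?thesis
    using \<open>infinite G1 \<or> infinite G2\<close>
  proof
    assume inf: "infinite G1"
    have on_P: "?\<phi> (P, pv u) = P" if u: "u \<noteq> (0, 0)" for u
      unfolding e(2) f(2)
      by (rule ident[OF par(1,3,1) _ infinite_super[OF _ inf] u]) (use inE in \<open>auto simp: G1_def e f\<close>)
    have on_Q: "?\<phi> (Q, pv u) = Q" if u: "u \<noteq> (0, 0)" for u
      unfolding e(2) f(2)
      by (rule ident[OF par(2,3,2) _ infinite_super[OF _ inf] u]) (use inE in \<open>auto simp: G1_def e f\<close>)
    have "\<sigma> (P, p) = (p, P) \<and> \<sigma> (Q, p) = (p, Q)" for p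
    proof -
      obtain u where u: "u \<noteq> (0, 0)" "p = pv u" by (rule pvE)
      show ?thesis
        unfolding u(2) using AutG_eqI[OF \<sigma> inE(1)] AutG_eqI[OF \<sigma> inE(2)] on_P[OF u(1)] on_Q[OF u(1)]
        unfolding comp_apply by blast
    qed
    then have "\<forall>p. \<sigma> (P, p) = (p, P) \<and> \<sigma> (Q, p) = (p, Q)" by simp
    then show ?thesis by (rule disjI1)
  next
    assume inf: "infinite G2"
    have on_P: "?\<phi> (P, pv u) = Q" if u: "u \<noteq> (0, 0)" for u
      unfolding e(2) f(2)
      by (rule ident[OF par(1,3,2) _ infinite_super[OF _ inf] u]) (use inE in \<open>auto simp: G2_def e f\<close>)
    have on_Q: "?\<phi> (Q, pv u) = P" if u: "u \<noteq> (0, 0)" for u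
      unfolding e(2) f(2)
      by (rule ident[OF par(2,3,1) _ infinite_super[OF _ inf] u]) (use inE in \<open>auto simp: G2_def e f\<close>)
    have "\<sigma> (P, p) = (p, Q) \<and> \<sigma> (Q, p) = (p, P)" for p
    proof -
      obtain u where u: "u \<noteq> (0, 0)" "p = pv u" by (rule pvE)
      show ?thesis
        unfolding u(2) using AutG_eqI[OF \<sigma> inE(1)] AutG_eqI[OF \<sigma> inE(2)] on_P[OF u(1)] on_Q[OF u(1)]
        unfolding comp_apply by blast
    qed
    then have "\<forall>p. \<sigma> (P, p) = (p, Q) \<and> \<sigma> (Q, p) = (p, P)" by simp
    then show ?thesis by (rule disjI2)
  qed
qed

section \<open>The relations\<close>

lemmas word_simps = gx_def gy_def cst_def power2_eq_square power3_eq_cube mult_single plus_word_def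
  cf_single lookup_add lookup_minus

lemma cf_comb: "cf (cst a * f + cst b * g) ls = a * cf f ls + b * cf g ls"
  for f :: "'k::field free_alg"
  by (simp add: lookup_add)

text \<open>Evaluating a binary form at two points that differ by a sign in one coordinate separates
  its even from its odd part; characteristic 0 enters through division by 2.\<close>

lemma add_diff_eq_0:
  fixes x y :: "'k::field_char_0"
  assumes "x + y = 0" "x - y = 0"
  shows "x = 0" "y = 0"
proof -
  have "2 * x = (x + y) + (x - y)" by simp
  then have "2 * x = 0" using assms by simp
  then show "x = 0" by simp
  then show "y = 0" using assms by simp
qed

lemma linear_solve:
  fixes x y :: "'k::field"
  assumes "x * v + y * w = 0" "v \<noteq> 0"
  shows "x = - (w / v) * y"
proof -
  have "x * v = - (y * w)" using assms(1) by (simp add: eq_neg_iff_add_eq_0)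
  then have "x = - (y * w) / v" using assms(2) by (metis nonzero_mult_div_cancel_right)
  then show ?thesis by simp
qed

text \<open>The remaining constraint on the relations comes from the horizontal line, where \<open>\<sigma>\<close> is only
  needed at the one point with first coordinate \<open>(1, 1)\<close>; its image there is \<open>w\<close>.\<close>

lemma relation_S:
  fixes h :: "'k::field_char_0 free_alg"
  assumes h: "homogeneous 3 h" and w: "fst w \<noteq> 0"
    and v: "\<And>u. u \<noteq> (0, 0) \<Longrightarrow> tri h (1, 0) u (1, 0) = 0"
    and c: "\<And>u. u \<noteq> (0, 0) \<Longrightarrow> tri h u (mv ((0, 1), (1, 0)) u) u = 0"
    and l: "tri h (1, 1) (1, 0) w = 0"
  defines "\<alpha> \<equiv> snd w / fst w"
  shows "\<exists>a b. h = cst a * (gx ^ 2 * gy - cst \<alpha> * gy * gx ^ 2 + cst (\<alpha> - 1) * gy ^ 3)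
    + cst b * (gx * gy ^ 2 - gy ^ 2 * gx)"
proof -
  let ?c = "\<lambda>i j l. cf h [i, j, l]"
  have "?c Lx Lx Lx = 0" "?c Lx Ly Lx = 0" "?c Ly Lx Ly = 0"
    using v[of "(1, 0)"] v[of "(0, 1)"] c[of "(0, 1)"] by (simp_all add: tri_expand mv_def)
  note z = this
  \<comment> \<open>At \<open>u = (s, t)\<close> the condition on the conic reads
    \<open>m * s * t ^ 2 + n * s ^ 2 * t = 0\<close>.\<close>
  define m n where "m = ?c Lx Lx Ly + ?c Ly Lx Lx + ?c Ly Ly Ly" and "n = ?c Lx Ly Ly + ?c Ly Ly Lx"
  have "tri h (1, 1) (mv ((0, 1), (1, 0)) (1, 1)) (1, 1) = m + n"
    "tri h (1, - 1) (mv ((0, 1), (1, 0)) (1, - 1)) (1, - 1) = m - n"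
    by (simp_all add: tri_expand mv_def z m_def n_def)
  then have "m + n = 0" "m - n = 0" using c[of "(1, 1)"] c[of "(1, - 1)"] by simp_all
  note mn = add_diff_eq_0[OF this]
  have "?c Ly Ly Ly = m - ?c Lx Lx Ly - ?c Ly Lx Lx" "?c Ly Ly Lx = n - ?c Lx Ly Ly"
    by (simp_all add: m_def n_def)
  moreover have s: "?c Ly Lx Lx = - \<alpha> * ?c Lx Lx Ly"
    unfolding \<alpha>_def using l w by (intro linear_solve) (simp_all add: tri_expand z add.commute)
  ultimately have s': "?c Ly Ly Ly = (\<alpha> - 1) * ?c Lx Lx Ly" "?c Ly Ly Lx = - ?c Lx Ly Ly"
    by (simp_all add: mn algebra_simps)
  have "h = cst (?c Lx Lx Ly) * (gx ^ 2 * gy - cst \<alpha> * gy * gx ^ 2 + cst (\<alpha> - 1) * gy ^ 3)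
    + cst (?c Lx Ly Ly) * (gx * gy ^ 2 - gy ^ 2 * gx)"
  proof (rule homogeneous_3_eqI[OF h])
    fix i j l show "?c i j l = cf (cst (?c Lx Lx Ly) * (gx ^ 2 * gy - cst \<alpha> * gy * gx ^ 2 + cst (\<alpha> - 1) * gy ^ 3)
      + cst (?c Lx Ly Ly) * (gx * gy ^ 2 - gy ^ 2 * gx)) [i, j, l]"
      unfolding cf_comb by (cases i; cases j; cases l) (simp_all add: word_simps z s s' algebra_simps)
  qed (intro homogeneous_add homogeneous_cst; auto simp: homogeneous_iff word_simps)
  then show ?thesis by blast
qed

text \<open>For cyclic \<open>\<sigma>\<close> every triple in the conditions has an entry
  \<open>(1, 0)\<close>, where \<open>y\<close> vanishes, so \<open>gy ^ 3\<close> satisfies them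
  all. The linear system leaves room for just one more cubic.\<close>

lemma relation_S_cyclic:
  fixes h :: "'k::field_char_0 free_alg"
  assumes h: "homogeneous 3 h" and w: "snd w \<noteq> 0"
    and v: "\<And>u. u \<noteq> (0, 0) \<Longrightarrow> tri h (1, 0) u (mv ((0, 1), (1, 0)) u) = 0"
    and c: "\<And>u. u \<noteq> (0, 0) \<Longrightarrow> tri h u (mv ((0, 1), (1, 0)) u) (1, 0) = 0"
    and l: "tri h (1, 1) (1, 0) w = 0"
  defines "\<beta> \<equiv> fst w / snd w"
  shows "\<exists>a b. h = cst a * (gx ^ 3 - gx * gy ^ 2 - gy ^ 2 * gx - cst \<beta> * gy * gx * gy) + cst b * gy ^ 3"
proof -
  let ?c = "\<lambda>i j l. cf h [i, j, l]"
  have z: "?c Lx Lx Ly = 0" "?c Lx Ly Lx = 0" "?c Ly Lx Lx = 0"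
    using v[of "(1, 0)"] v[of "(0, 1)"] c[of "(1, 0)"] c[of "(0, 1)"] by (simp_all add: tri_expand mv_def)
  have s: "?c Lx Ly Ly = - ?c Lx Lx Lx" "?c Ly Ly Lx = - ?c Lx Lx Lx"
    using v[of "(1, 1)"] c[of "(1, 1)"] by (simp_all add: tri_expand mv_def z eq_neg_iff_add_eq_0 add.commute)
  have s': "?c Ly Lx Ly = - \<beta> * ?c Lx Lx Lx"
    unfolding \<beta>_def using l w by (intro linear_solve) (simp_all add: tri_expand z add.commute)
  have "h = cst (?c Lx Lx Lx) * (gx ^ 3 - gx * gy ^ 2 - gy ^ 2 * gx - cst \<beta> * gy * gx * gy) + cst (?c Ly Ly Ly) * gy ^ 3"
  proof (rule homogeneous_3_eqI[OF h])
    fix i j l show "?c i j l = cf (cst (?c Lx Lx Lx) * (gx ^ 3 - gx * gy ^ 2 - gy ^ 2 * gx - cst \<beta> * gy * gx * gy)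
      + cst (?c Ly Ly Ly) * gy ^ 3) [i, j, l]"
      unfolding cf_comb by (cases i; cases j; cases l) (simp_all add: word_simps z s s' algebra_simps)
  qed (intro homogeneous_add homogeneous_cst; auto simp: homogeneous_iff word_simps)
  then show ?thesis by blast
qed

text \<open>Of the eight coefficients the vertical line removes two, the conic three and the
  horizontal line one; those of \<open>x^2 y\<close> and \<open>x y^2\<close> stay free.
  \<open>\<alpha>\<close> is the resulting ratio of the coefficient of \<open>y x y\<close> to that
  of \<open>x^2 y\<close>.\<close>

lemma relation_T1:
  fixes h :: "'k::field_char_0 free_alg"
  assumes h: "homogeneous 3 h" and w: "snd w \<noteq> 0" and \<delta>: "\<delta> \<noteq> 0"
    and v: "\<And>u. u \<noteq> (0, 0) \<Longrightarrow> tri h (1, 0) u (1, 0) = 0"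
    and c: "\<And>u. u \<noteq> (0, 0) \<Longrightarrow> tri h u (mv ((1, 0), (0, \<delta>)) u) (mv ((1, 0), (0, \<delta>)) (mv ((1, 0), (0, \<delta>)) u)) = 0"
    and l: "tri h (1, 1) (1, 0) w = 0"
  defines "\<alpha> \<equiv> \<delta> ^ 2 * (fst w / snd w) - 1"
  shows "\<exists>a b. h = cst a * (gx ^ 2 * gy - cst (\<delta> ^ 2) * gy * gx ^ 2 + cst \<alpha> * gy * gx * gy - cst (\<alpha> * \<delta>) * gy ^ 2 * gx)
    + cst b * (gx * gy ^ 2 - cst (\<delta> ^ 2) * gy ^ 2 * gx)"
proof -
  let ?c = "\<lambda>i j l. cf h [i, j, l]"
  have z: "?c Lx Lx Lx = 0" "?c Lx Ly Lx = 0"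
    using v[of "(1, 0)"] v[of "(0, 1)"] by (simp_all add: tri_expand)
  have z': "?c Ly Ly Ly = 0"
    using c[of "(0, 1)"] \<delta> by (simp add: tri_expand mv_def)
  \<comment> \<open>At \<open>u = (s, t)\<close> the condition on the conic reads
    \<open>m * s ^ 2 * t + \<delta> * n * s * t ^ 2 = 0\<close>.\<close>
  define m n where "m = \<delta> ^ 2 * ?c Lx Lx Ly + ?c Ly Lx Lx"
    and "n = \<delta> ^ 2 * ?c Lx Ly Ly + \<delta> * ?c Ly Lx Ly + ?c Ly Ly Lx"
  let ?T = "mv ((1, 0), (0, \<delta>))"
  have "tri h (1, 1) (?T (1, 1)) (?T (?T (1, 1))) = m + \<delta> * n"
    "tri h (- 1, 1) (?T (- 1, 1)) (?T (?T (- 1, 1))) = m - \<delta> * n"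
    by (simp_all add: tri_expand mv_def z z' m_def n_def power2_eq_square algebra_simps)
  then have "m + \<delta> * n = 0" "m - \<delta> * n = 0" using c[of "(1, 1)"] c[of "(- 1, 1)"] by simp_all
  then have mn: "m = 0" "n = 0" using add_diff_eq_0[of m "\<delta> * n"] \<delta> by auto
  have "?c Ly Lx Lx = m - \<delta> ^ 2 * ?c Lx Lx Ly" "?c Ly Ly Lx = n - \<delta> ^ 2 * ?c Lx Ly Ly - \<delta> * ?c Ly Lx Ly"
    by (simp_all add: m_def n_def)
  then have s: "?c Ly Lx Lx = - (\<delta> ^ 2) * ?c Lx Lx Ly" "?c Ly Ly Lx = - (\<delta> ^ 2) * ?c Lx Ly Ly - \<delta> * ?c Ly Lx Ly"
    by (simp_all add: mn)
  have "?c Lx Lx Ly + ?c Ly Lx Ly = - (fst w / snd w) * ?c Ly Lx Lx"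
    using l w by (intro linear_solve) (simp_all add: tri_expand z algebra_simps)
  note e = this
  have "?c Ly Lx Ly = (?c Lx Lx Ly + ?c Ly Lx Ly) - ?c Lx Lx Ly" by simp
  also have "\<dots> = - (fst w / snd w) * ?c Ly Lx Lx - ?c Lx Lx Ly" by (simp only: e)
  also have "\<dots> = \<alpha> * ?c Lx Lx Ly"
    unfolding s(1) \<alpha>_def by (simp add: algebra_simps)
  finally have s': "?c Ly Lx Ly = \<alpha> * ?c Lx Lx Ly" .
  let ?h = "cst (?c Lx Lx Ly) * (gx ^ 2 * gy - cst (\<delta> ^ 2) * gy * gx ^ 2 + cst \<alpha> * gy * gx * gy - cst (\<alpha> * \<delta>) * gy ^ 2 * gx)
    + cst (?c Lx Ly Ly) * (gx * gy ^ 2 - cst (\<delta> ^ 2) * gy ^ 2 * gx)"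
  have "h = ?h"
  proof (rule homogeneous_3_eqI[OF h])
    fix i j l show "?c i j l = cf ?h [i, j, l]"
      unfolding cf_comb by (cases i; cases j; cases l) (simp_all add: word_simps z z' s s' algebra_simps)
  qed (intro homogeneous_add homogeneous_cst; auto simp: homogeneous_iff word_simps)
  then show ?thesis by blast
qed

lemma relation_T1_cyclic:
  fixes h :: "'k::field_char_0 free_alg"
  assumes h: "homogeneous 3 h" and w: "snd w \<noteq> 0" and \<delta>: "\<delta> \<noteq> 0"
    and v: "\<And>u. u \<noteq> (0, 0) \<Longrightarrow> tri h (1, 0) u (mv ((1, 0), (0, \<delta>)) u) = 0"
    and c: "\<And>u. u \<noteq> (0, 0) \<Longrightarrow> tri h u (mv ((1, 0), (0, \<delta>)) u) (1, 0) = 0"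
    and l: "tri h (1, 1) (1, 0) w = 0"
  defines "\<beta> \<equiv> - 1 - \<delta> ^ 2 * (fst w / snd w)"
  shows "\<exists>a b. h = cst a * (gx ^ 2 * gy - cst \<delta> * gx * gy * gx + cst (\<delta> ^ 2) * gy * gx ^ 2 + cst \<beta> * gy * gx * gy)
    + cst b * gy ^ 3"
proof -
  let ?c = "\<lambda>i j l. cf h [i, j, l]"
  have z: "?c Lx Lx Lx = 0" "?c Lx Ly Ly = 0" "?c Ly Ly Lx = 0"
    using v[of "(1, 0)"] v[of "(0, 1)"] c[of "(0, 1)"] \<delta> by (simp_all add: tri_expand mv_def)
  have s: "?c Lx Ly Lx = - \<delta> * ?c Lx Lx Ly"
    using v[of "(1, 1)"] by (simp add: tri_expand mv_def z eq_neg_iff_add_eq_0 algebra_simps)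
  have s2: "?c Ly Lx Lx = \<delta> ^ 2 * ?c Lx Lx Ly"
    using c[of "(1, 1)"] by (simp add: tri_expand mv_def z s power2_eq_square algebra_simps)
  have "?c Lx Lx Ly + ?c Ly Lx Ly = - (fst w / snd w) * ?c Ly Lx Lx"
    using l w by (intro linear_solve) (simp_all add: tri_expand z algebra_simps)
  note e = this
  have "?c Ly Lx Ly = (?c Lx Lx Ly + ?c Ly Lx Ly) - ?c Lx Lx Ly" by simp
  also have "\<dots> = - (fst w / snd w) * ?c Ly Lx Lx - ?c Lx Lx Ly" by (simp only: e)
  also have "\<dots> = \<beta> * ?c Lx Lx Ly"
    unfolding s2 \<beta>_def by (simp add: algebra_simps)
  finally have s': "?c Ly Lx Ly = \<beta> * ?c Lx Lx Ly" .
  let ?h = "cst (?c Lx Lx Ly) * (gx ^ 2 * gy - cst \<delta> * gx * gy * gx + cst (\<delta> ^ 2) * gy * gx ^ 2 + cst \<beta> * gy * gx * gy)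
    + cst (?c Ly Ly Ly) * gy ^ 3"
  have "h = ?h"
  proof (rule homogeneous_3_eqI[OF h])
    fix i j l show "?c i j l = cf ?h [i, j, l]"
      unfolding cf_comb by (cases i; cases j; cases l) (simp_all add: word_simps z s s2 s' algebra_simps)
  qed (intro homogeneous_add homogeneous_cst; auto simp: homogeneous_iff word_simps)
  then show ?thesis by blast
qed

lemma relation_T2:
  fixes h :: "'k::field_char_0 free_alg"
  assumes h: "homogeneous 3 h" and w: "snd w \<noteq> 0"
    and v: "\<And>u. u \<noteq> (0, 0) \<Longrightarrow> tri h (1, 0) u (1, 0) = 0"
    and c: "\<And>u. u \<noteq> (0, 0) \<Longrightarrow> tri h u (mv ((1, 1), (0, 1)) u) (mv ((1, 1), (0, 1)) (mv ((1, 1), (0, 1)) u)) = 0"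
    and l: "tri h (1, 1) (1, 0) w = 0"
  defines "\<alpha> \<equiv> fst w / snd w - 1"
  shows "\<exists>a b. h = cst a * (gx ^ 2 * gy - gy * gx ^ 2 + cst \<alpha> * gy * gx * gy + cst (2 - \<alpha>) * gy ^ 2 * gx + cst (\<alpha> - 2) * gy ^ 3)
    + cst b * (gx * gy ^ 2 - gy ^ 2 * gx + cst 2 * gy ^ 3)"
proof -
  let ?c = "\<lambda>i j l. cf h [i, j, l]"
  have z: "?c Lx Lx Lx = 0" "?c Lx Ly Lx = 0"
    using v[of "(1, 0)"] v[of "(0, 1)"] by (simp_all add: tri_expand)
  \<comment> \<open>At \<open>u = (s, 1)\<close> the form on the conic is
    \<open>m * s ^ 2 + n * s + r\<close>, and its values at \<open>s = 0, 1, -1\<close> determine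
    it.\<close>
  define m n r where "m = ?c Lx Lx Ly + ?c Ly Lx Lx"
    and "n = ?c Lx Lx Ly + ?c Lx Ly Ly + 3 * ?c Ly Lx Lx + ?c Ly Lx Ly + ?c Ly Ly Lx"
    and "r = 2 * ?c Ly Lx Lx + ?c Ly Lx Ly + 2 * ?c Ly Ly Lx + ?c Ly Ly Ly"
  let ?T = "mv ((1, 1), (0, 1))"
  have "tri h (0, 1) (?T (0, 1)) (?T (?T (0, 1))) = r"
    by (simp add: tri_expand mv_def z r_def algebra_simps)
  then have r: "r = 0" using c[of "(0, 1)"] by simp
  have "tri h (1, 1) (?T (1, 1)) (?T (?T (1, 1))) = m + n + r"
    "tri h (- 1, 1) (?T (- 1, 1)) (?T (?T (- 1, 1))) = m - n + r"
    by (simp_all add: tri_expand mv_def z m_def n_def r_def algebra_simps)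
  then have "m + n = 0" "m - n = 0" using c[of "(1, 1)"] c[of "(- 1, 1)"] r by simp_all
  note mn = add_diff_eq_0[OF this]
  have "?c Ly Lx Lx = m - ?c Lx Lx Ly" by (simp add: m_def)
  then have s: "?c Ly Lx Lx = - ?c Lx Lx Ly" by (simp add: mn)
  have "?c Lx Lx Ly + ?c Ly Lx Ly = - (fst w / snd w) * ?c Ly Lx Lx"
    using l w by (intro linear_solve) (simp_all add: tri_expand z algebra_simps)
  note e = this
  have "?c Ly Lx Ly = (?c Lx Lx Ly + ?c Ly Lx Ly) - ?c Lx Lx Ly" by simp
  also have "\<dots> = - (fst w / snd w) * ?c Ly Lx Lx - ?c Lx Lx Ly" by (simp only: e)
  also have "\<dots> = \<alpha> * ?c Lx Lx Ly"
    unfolding s \<alpha>_def by (simp add: algebra_simps)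
  finally have s': "?c Ly Lx Ly = \<alpha> * ?c Lx Lx Ly" .
  have "?c Ly Ly Lx = n - ?c Lx Lx Ly - ?c Lx Ly Ly - 3 * ?c Ly Lx Lx - ?c Ly Lx Ly" by (simp add: n_def)
  then have s2: "?c Ly Ly Lx = (2 - \<alpha>) * ?c Lx Lx Ly - ?c Lx Ly Ly" by (simp add: mn s s' algebra_simps)
  have "?c Ly Ly Ly = r - 2 * ?c Ly Lx Lx - ?c Ly Lx Ly - 2 * ?c Ly Ly Lx" by (simp add: r_def)
  then have s3: "?c Ly Ly Ly = (\<alpha> - 2) * ?c Lx Lx Ly + 2 * ?c Lx Ly Ly" by (simp add: r s s' s2 algebra_simps)
  let ?h = "cst (?c Lx Lx Ly) * (gx ^ 2 * gy - gy * gx ^ 2 + cst \<alpha> * gy * gx * gy + cst (2 - \<alpha>) * gy ^ 2 * gx + cst (\<alpha> - 2) * gy ^ 3)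
    + cst (?c Lx Ly Ly) * (gx * gy ^ 2 - gy ^ 2 * gx + cst 2 * gy ^ 3)"
  have "h = ?h"
  proof (rule homogeneous_3_eqI[OF h])
    fix i j l show "?c i j l = cf ?h [i, j, l]"
      unfolding cf_comb by (cases i; cases j; cases l) (simp_all add: word_simps z s s' s2 s3 algebra_simps)
  qed (intro homogeneous_add homogeneous_cst; auto simp: homogeneous_iff word_simps)
  then show ?thesis by blast
qed

lemma relation_T2_cyclic:
  fixes h :: "'k::field_char_0 free_alg"
  assumes h: "homogeneous 3 h" and w: "snd w \<noteq> 0"
    and v: "\<And>u. u \<noteq> (0, 0) \<Longrightarrow> tri h (1, 0) u (mv ((1, 1), (0, 1)) u) = 0"
    and c: "\<And>u. u \<noteq> (0, 0) \<Longrightarrow> tri h u (mv ((1, 1), (0, 1)) u) (1, 0) = 0"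
    and l: "tri h (1, 1) (1, 0) w = 0"
  defines "\<beta> \<equiv> - 1 - fst w / snd w"
  shows "\<exists>a b. h = cst a * (gx ^ 2 * gy - gx * gy * gx + gx * gy ^ 2 + gy * gx ^ 2 - gy ^ 2 * gx + cst \<beta> * gy * gx * gy)
    + cst b * gy ^ 3"
proof -
  let ?c = "\<lambda>i j l. cf h [i, j, l]"
  have z: "?c Lx Lx Lx = 0"
    using v[of "(1, 0)"] by (simp add: tri_expand mv_def)
  have a1: "?c Lx Ly Lx + ?c Lx Ly Ly = 0" "?c Ly Lx Lx + ?c Ly Ly Lx = 0"
    using v[of "(0, 1)"] c[of "(0, 1)"] by (simp_all add: tri_expand mv_def)
  have "tri h (1, 0) (1, 1) (mv ((1, 1), (0, 1)) (1, 1)) = ?c Lx Lx Ly + ?c Lx Ly Lx + (?c Lx Ly Lx + ?c Lx Ly Ly)"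
    "tri h (1, 1) (mv ((1, 1), (0, 1)) (1, 1)) (1, 0) = ?c Lx Ly Lx + ?c Ly Lx Lx + (?c Ly Lx Lx + ?c Ly Ly Lx)"
    by (simp_all add: tri_expand mv_def z algebra_simps)
  then have a2: "?c Lx Lx Ly + ?c Lx Ly Lx = 0" "?c Lx Ly Lx + ?c Ly Lx Lx = 0"
    using v[of "(1, 1)"] c[of "(1, 1)"] by (simp_all add: a1)
  have s: "?c Lx Ly Lx = - ?c Lx Lx Ly" by (metis a2(1) minus_unique)
  have s2: "?c Lx Ly Ly = ?c Lx Lx Ly" by (metis a1(1) s minus_minus minus_unique)
  have s3: "?c Ly Lx Lx = ?c Lx Lx Ly" by (metis a2(2) s minus_minus minus_unique)
  have s4: "?c Ly Ly Lx = - ?c Lx Lx Ly" by (metis a1(2) s3 minus_unique)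
  have "?c Lx Lx Ly + ?c Ly Lx Ly = - (fst w / snd w) * ?c Ly Lx Lx"
    using l w by (intro linear_solve) (simp_all add: tri_expand z algebra_simps)
  note e = this
  have "?c Ly Lx Ly = (?c Lx Lx Ly + ?c Ly Lx Ly) - ?c Lx Lx Ly" by simp
  also have "\<dots> = - (fst w / snd w) * ?c Ly Lx Lx - ?c Lx Lx Ly" by (simp only: e)
  also have "\<dots> = \<beta> * ?c Lx Lx Ly"
    unfolding s3 \<beta>_def by (simp add: algebra_simps)
  finally have s': "?c Ly Lx Ly = \<beta> * ?c Lx Lx Ly" .
  let ?h = "cst (?c Lx Lx Ly) * (gx ^ 2 * gy - gx * gy * gx + gx * gy ^ 2 + gy * gx ^ 2 - gy ^ 2 * gx + cst \<beta> * gy * gx * gy)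
    + cst (?c Ly Ly Ly) * gy ^ 3"
  have "h = ?h"
  proof (rule homogeneous_3_eqI[OF h])
    fix i j l show "?c i j l = cf ?h [i, j, l]"
      unfolding cf_comb by (cases i; cases j; cases l) (simp_all add: word_simps z s s2 s3 s4 s' algebra_simps)
  qed (intro homogeneous_add homogeneous_cst; auto simp: homogeneous_iff word_simps)
  then show ?thesis by blast
qed

text \<open>The two vertical lines remove four coefficients, and each horizontal line ties two of
  the others together, with a ratio read off from \<open>w\<close> or \<open>w'\<close>.\<close>

lemma relation_FL1:
  fixes h :: "'k::field_char_0 free_alg"
  assumes h: "homogeneous 3 h" and w: "fst w \<noteq> 0" "fst w' \<noteq> 0"
    and v: "\<And>u. u \<noteq> (0, 0) \<Longrightarrow> tri h (1, 0) u (1, 0) = 0" "\<And>u. u \<noteq> (0, 0) \<Longrightarrow> tri h (0, 1) u (0, 1) = 0"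
    and l: "tri h (1, 1) (1, 0) w = 0" "tri h (1, 1) (0, 1) w' = 0"
  shows "\<exists>a b. h = cst a * (gx ^ 2 * gy - cst (snd w / fst w) * gy * gx ^ 2)
    + cst b * (gx * gy ^ 2 - cst (snd w' / fst w') * gy ^ 2 * gx)"
proof -
  let ?c = "\<lambda>i j l. cf h [i, j, l]"
  have z: "?c Lx Lx Lx = 0" "?c Lx Ly Lx = 0" "?c Ly Lx Ly = 0" "?c Ly Ly Ly = 0"
    using v(1)[of "(1, 0)"] v(1)[of "(0, 1)"] v(2)[of "(1, 0)"] v(2)[of "(0, 1)"] by (simp_all add: tri_expand)
  have s: "?c Ly Lx Lx = - (snd w / fst w) * ?c Lx Lx Ly" "?c Ly Ly Lx = - (snd w' / fst w') * ?c Lx Ly Ly"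
    using l w by (intro linear_solve; simp add: tri_expand z add.commute)+
  let ?h = "cst (?c Lx Lx Ly) * (gx ^ 2 * gy - cst (snd w / fst w) * gy * gx ^ 2)
    + cst (?c Lx Ly Ly) * (gx * gy ^ 2 - cst (snd w' / fst w') * gy ^ 2 * gx)"
  have "h = ?h"
  proof (rule homogeneous_3_eqI[OF h])
    fix i j l show "?c i j l = cf ?h [i, j, l]"
      unfolding cf_comb by (cases i; cases j; cases l) (simp_all add: word_simps z s)
  qed (intro homogeneous_add homogeneous_cst; auto simp: homogeneous_iff word_simps)
  then show ?thesis by blast
qed

lemma relation_FL2:
  fixes h :: "'k::field_char_0 free_alg"
  assumes h: "homogeneous 3 h" and w: "fst w \<noteq> 0" "fst w' \<noteq> 0"
    and v: "\<And>u. u \<noteq> (0, 0) \<Longrightarrow> tri h (1, 0) u (0, 1) = 0" "\<And>u. u \<noteq> (0, 0) \<Longrightarrow> tri h (0, 1) u (1, 0) = 0"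
    and l: "tri h (1, 1) (1, 0) w = 0" "tri h (1, 1) (0, 1) w' = 0"
  shows "\<exists>a b. h = cst a * (gy * gx * gy - cst (snd w / fst w) * gx ^ 3)
    + cst b * (cst (snd w' / fst w') * gx * gy * gx - gy ^ 3)"
proof -
  let ?c = "\<lambda>i j l. cf h [i, j, l]"
  have z: "?c Lx Lx Ly = 0" "?c Lx Ly Ly = 0" "?c Ly Lx Lx = 0" "?c Ly Ly Lx = 0"
    using v(1)[of "(1, 0)"] v(1)[of "(0, 1)"] v(2)[of "(1, 0)"] v(2)[of "(0, 1)"] by (simp_all add: tri_expand)
  have s: "?c Lx Lx Lx = - (snd w / fst w) * ?c Ly Lx Ly" "?c Lx Ly Lx = - (snd w' / fst w') * ?c Ly Ly Ly"
    using l w by (intro linear_solve; simp add: tri_expand z add.commute)+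
  \<comment> \<open>The sign of the second coefficient matches the normal form, where
    \<open>y ^ 3\<close> occurs with coefficient \<open>- 1\<close>.\<close>
  let ?h = "cst (?c Ly Lx Ly) * (gy * gx * gy - cst (snd w / fst w) * gx ^ 3)
    + cst (- ?c Ly Ly Ly) * (cst (snd w' / fst w') * gx * gy * gx - gy ^ 3)"
  have "h = ?h"
  proof (rule homogeneous_3_eqI[OF h])
    fix i j l show "?c i j l = cf ?h [i, j, l]"
      unfolding cf_comb by (cases i; cases j; cases l) (simp_all add: word_simps z s)
  qed (intro homogeneous_add homogeneous_cst; auto simp: homogeneous_iff word_simps)
  then show ?thesis by blast
qed

text \<open>The hypotheses in working form: that \<open>A\<close> is geometric enters as the
  vanishing of the forms of \<open>g1\<close> and \<open>g2\<close> on the graph of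
  \<open>\<sigma>\<close>, and regularity as the value of \<open>gldim\<close>.\<close>

locale cubic_pair =
  fixes g1 g2 :: "'k::field_char_0 free_alg" and E :: "('k P1 \<times> 'k P1) set"
    and \<sigma> :: "'k P1 \<times> 'k P1 \<Rightarrow> 'k P1 \<times> 'k P1"
  assumes hom: "g \<in> {g1, g2} \<Longrightarrow> homogeneous 3 g"
    and scheme: "point_scheme g1 g2 E"
    and \<sigma>: "\<sigma> \<in> AutG E"
    and vanish: "\<lbrakk>g \<in> {g1, g2}; (p, q) \<in> E; u \<in> coords p; v \<in> coords q; w \<in> coords (snd (\<sigma> (p, q)))\<rbrakk>
      \<Longrightarrow> tri g u v w = 0"
    and regular: "gldim (presented {g1, g2}) = 3"
begin

lemma pullback_vanish:
  assumes "mdet B \<noteq> 0" "g \<in> {g1, g2}" "u \<noteq> (0, 0)" "v \<noteq> (0, 0)" "w \<noteq> (0, 0)"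
    and "(pv (mv B u), pv (mv B v)) \<in> E" "\<sigma> (pv (mv B u), pv (mv B v)) = (x, pv (mv B w))"
  shows "tri (subst (lin_subst B) g) u v w = 0"
  unfolding tri_subst[OF hom[OF assms(2)]]
  by (rule vanish[OF assms(2,6)]) (use assms in \<open>auto simp: mem_coords_iff mv_nonzero\<close>)

lemma pullback_homogeneous: "g \<in> {g1, g2} \<Longrightarrow> homogeneous 3 (subst (lin_subst B) g)"
  by (intro subst_homogeneous lin_subst_homogeneous hom)

text \<open>Injectivity of \<open>\<sigma>\<close> along a horizontal line, in coordinates. In the
  framed cases it gives the nonzero denominators of the parameters, and for Type S' also the nonzero
  parameter.\<close>

lemma cross_image:
  assumes "mdet B \<noteq> 0" "u \<noteq> (0, 0)" "u' \<noteq> (0, 0)" "w \<noteq> (0, 0)" "w' \<noteq> (0, 0)" "cross u u' \<noteq> 0"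
    and "(pv (mv B u), q) \<in> E" "(pv (mv B u'), q) \<in> E"
    and "\<sigma> (pv (mv B u), q) = (q, pv (mv B w))" "\<sigma> (pv (mv B u'), q) = (q, pv (mv B w'))"
  shows "cross w w' \<noteq> 0"
proof
  assume "cross w w' = 0"
  then have "\<sigma> (pv (mv B u), q) = \<sigma> (pv (mv B u'), q)"
    using pv_mv_eq_iff[OF assms(1,4,5)] assms(9,10) by simp
  then have "pv (mv B u) = pv (mv B u')" using AutG_D(2)[OF \<sigma> assms(7,8)] by simp
  then show False using pv_mv_eq_iff[OF assms(1-3)] assms(6) by simp
qed

lemma image_ex:
  assumes "mdet B \<noteq> 0" "(p, q) \<in> E"
  obtains w where "w \<noteq> (0, 0)" "\<sigma> (p, q) = (q, pv (mv B w))"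
  using pv_mvE[OF assms(1), of "snd (\<sigma> (p, q))"] AutG_eqI[OF \<sigma> assms(2)] by metis

section \<open>From the pulled-back relations to the normal forms\<close>

lemma framed_iso:
  assumes "framed B T E"
    and "\<And>g. g \<in> {g1, g2} \<Longrightarrow> \<exists>a b. subst (lin_subst B) g = cst a * h1 + cst b * h2"
  shows "presented {g1, g2} \<cong>\<^sub>g\<^sub>r presented {h1, h2}"
  by (rule presented_lin_subst_iso[OF framedD(1)[OF assms(1)]
        point_scheme_indep[OF scheme framed_not_UNIV[OF assms(1)]] assms(2)])

lemma framed_no_cube:
  assumes "framed B T E" "homogeneous 3 h"
    and "\<And>g. g \<in> {g1, g2} \<Longrightarrow> \<exists>a b. subst (lin_subst B) g = cst a * h + cst b * gy ^ 3"
  shows False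
  using lin_subst_cube_not_gldim_3[OF framedD(1)[OF assms(1)]
        point_scheme_indep[OF scheme framed_not_UNIV[OF assms(1)]] assms(2,3)] regular by blast

context
  fixes B T
  assumes fr: "framed B T E"
begin

lemma framed_mem:
  "w \<noteq> (0, 0) \<Longrightarrow> (pv (mv B (1, 0)), pv (mv B w)) \<in> E"
  "w \<noteq> (0, 0) \<Longrightarrow> (pv (mv B w), pv (mv B (1, 0))) \<in> E"
  "u \<noteq> (0, 0) \<Longrightarrow> (pv (mv B u), pv (mv B (mv T u))) \<in> E"
  using framedD(3)[OF fr, of "(1, 0)" w] framedD(3)[OF fr, of w "(1, 0)"]
    framedD(3)[OF fr, of u "mv T u"] mv_nonzero[OF framedD(2)[OF fr], of u] by simp_all

text \<open>\<open>w\<close> is the unknown value of \<open>\<sigma>\<close> at the point over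
  \<open>(1, 1)\<close> on the horizontal line. Where this line meets the other components
  \<open>\<sigma>\<close> is already known, and the last clause separates \<open>w\<close> from
  those values.\<close>

lemma hline_image:
  obtains w where "w \<noteq> (0, 0)" "\<sigma> (pv (mv B (1, 1)), pv (mv B (1, 0))) = (pv (mv B (1, 0)), pv (mv B w))"
    "\<And>g. g \<in> {g1, g2} \<Longrightarrow> tri (subst (lin_subst B) g) (1, 1) (1, 0) w = 0"
    "\<And>u' w'. \<lbrakk>u' \<noteq> (0, 0); w' \<noteq> (0, 0); cross (1, 1) u' \<noteq> 0;
      \<sigma> (pv (mv B u'), pv (mv B (1, 0))) = (pv (mv B (1, 0)), pv (mv B w'))\<rbrakk> \<Longrightarrow> cross w w' \<noteq> 0"
proof -
  note B = framedD(1)[OF fr]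
  have m: "(pv (mv B (1, 1)), pv (mv B (1, 0))) \<in> E" by (rule framed_mem) simp
  obtain w where w: "w \<noteq> (0, 0)" "\<sigma> (pv (mv B (1, 1)), pv (mv B (1, 0))) = (pv (mv B (1, 0)), pv (mv B w))"
    using image_ex[OF B m] by blast
  show thesis
  proof (rule that[OF w])
    show "tri (subst (lin_subst B) g) (1, 1) (1, 0) w = 0" if "g \<in> {g1, g2}" for g
      by (rule pullback_vanish[OF B that _ _ w(1) m w(2)]) simp_all
    show "cross w w' \<noteq> 0" if "u' \<noteq> (0, 0)" "w' \<noteq> (0, 0)" "cross (1, 1) u' \<noteq> 0"
      "\<sigma> (pv (mv B u'), pv (mv B (1, 0))) = (pv (mv B (1, 0)), pv (mv B w'))" for u' w'
      by (rule cross_image[OF B _ that(1) w(1) that(2,3) m framed_mem(2)[OF that(1)] w(2) that(4)]) simp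
  qed
qed

lemma framed_relations:
  obtains
    (fixed) "\<And>w. w \<noteq> (0, 0) \<Longrightarrow> \<sigma> (pv (mv B (1, 0)), pv (mv B w)) = (pv (mv B w), pv (mv B (1, 0)))"
      "\<And>u. u \<noteq> (0, 0) \<Longrightarrow> \<sigma> (pv (mv B u), pv (mv B (mv T u))) = (pv (mv B (mv T u)), pv (mv B (mv T (mv T u))))"
      "\<And>g u. g \<in> {g1, g2} \<Longrightarrow> u \<noteq> (0, 0) \<Longrightarrow> tri (subst (lin_subst B) g) (1, 0) u (1, 0) = 0"
      "\<And>g u. g \<in> {g1, g2} \<Longrightarrow> u \<noteq> (0, 0) \<Longrightarrow> tri (subst (lin_subst B) g) u (mv T u) (mv T (mv T u)) = 0"
  | (cyclic) "\<And>w. w \<noteq> (0, 0) \<Longrightarrow> \<sigma> (pv (mv B (1, 0)), pv (mv B w)) = (pv (mv B w), pv (mv B (mv T w)))"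
      "\<And>u. u \<noteq> (0, 0) \<Longrightarrow> \<sigma> (pv (mv B u), pv (mv B (mv T u))) = (pv (mv B (mv T u)), pv (mv B (1, 0)))"
      "\<And>g u. g \<in> {g1, g2} \<Longrightarrow> u \<noteq> (0, 0) \<Longrightarrow> tri (subst (lin_subst B) g) (1, 0) u (mv T u) = 0"
      "\<And>g u. g \<in> {g1, g2} \<Longrightarrow> u \<noteq> (0, 0) \<Longrightarrow> tri (subst (lin_subst B) g) u (mv T u) (1, 0) = 0"
proof -
  note B = framedD(1)[OF fr] and nz = mv_nonzero[OF framedD(2)[OF fr]]
  show thesis
  proof (rule framed_AutG_cases[OF fr \<sigma>], goal_cases)
    case 1
    show ?case
    proof (rule fixed[OF 1])
      fix g and u :: "'k \<times> 'k" assume g: "g \<in> {g1, g2}" and u: "u \<noteq> (0, 0)"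
      show "tri (subst (lin_subst B) g) (1, 0) u (1, 0) = 0"
        by (rule pullback_vanish[OF B g _ u _ framed_mem(1)[OF u] 1(1)[OF u]]) simp_all
      show "tri (subst (lin_subst B) g) u (mv T u) (mv T (mv T u)) = 0"
        by (rule pullback_vanish[OF B g u nz[OF u] nz[OF nz[OF u]] framed_mem(3)[OF u] 1(2)[OF u]])
    qed
  next
    case 2
    show ?case
    proof (rule cyclic[OF 2])
      fix g and u :: "'k \<times> 'k" assume g: "g \<in> {g1, g2}" and u: "u \<noteq> (0, 0)"
      show "tri (subst (lin_subst B) g) (1, 0) u (mv T u) = 0"
        by (rule pullback_vanish[OF B g _ u nz[OF u] framed_mem(1)[OF u] 2(1)[OF u]]) simp
      show "tri (subst (lin_subst B) g) u (mv T u) (1, 0) = 0"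
        by (rule pullback_vanish[OF B g u nz[OF u] _ framed_mem(3)[OF u] 2(2)[OF u]]) simp
    qed
  qed
qed

end

lemma type_S_iso:
  assumes fr: "framed B ((0, 1), (1, 0)) E"
  shows "\<exists>\<alpha>. \<alpha> \<noteq> 0 \<and> presented {g1, g2} \<cong>\<^sub>g\<^sub>r presented
    {gx ^ 2 * gy - cst \<alpha> * gy * gx ^ 2 + cst (\<alpha> - 1) * gy ^ 3, gx * gy ^ 2 - gy ^ 2 * gx}"
proof -
  let ?T = "((0, 1), (1, 0)) :: 'k mat2"
  have sw: "mv ?T u = (snd u, fst u)" and inv: "mv ?T (mv ?T u) = u" for u by (simp_all add: mv_def)
  obtain w where w: "w \<noteq> (0, 0)"
    "\<And>g. g \<in> {g1, g2} \<Longrightarrow> tri (subst (lin_subst B) g) (1, 1) (1, 0) w = 0"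
    "\<And>u' w'. \<lbrakk>u' \<noteq> (0, 0); w' \<noteq> (0, 0); cross (1, 1) u' \<noteq> 0;
      \<sigma> (pv (mv B u'), pv (mv B (1, 0))) = (pv (mv B (1, 0)), pv (mv B w'))\<rbrakk> \<Longrightarrow> cross w w' \<noteq> 0"
    using hline_image[OF fr] by metis
  show ?thesis
  proof (rule framed_relations[OF fr], goal_cases)
    case 1
    \<comment> \<open>The horizontal line meets the vertical line over \<open>(1, 0)\<close> and the
      conic over \<open>(0, 1)\<close>; the values of \<open>\<sigma>\<close> there are
      \<open>(1, 0)\<close> and \<open>(0, 1)\<close>, so \<open>w\<close> has no zero
      coordinate.\<close>
    have w0: "fst w \<noteq> 0" "snd w \<noteq> 0"
      using w(3)[of "(1, 0)" "(1, 0)"] w(3)[of "(0, 1)" "(0, 1)"] 1(1)[of "(1, 0)"] 1(2)[of "(0, 1)"]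
      by (simp_all add: cross_def sw)
    have "presented {g1, g2} \<cong>\<^sub>g\<^sub>r presented
      {gx ^ 2 * gy - cst (snd w / fst w) * gy * gx ^ 2 + cst (snd w / fst w - 1) * gy ^ 3, gx * gy ^ 2 - gy ^ 2 * gx}"
      by (rule framed_iso[OF fr], rule relation_S[OF pullback_homogeneous w0(1) 1(3) 1(4)[unfolded inv] w(2)])
    then show ?case using w0 by (intro exI[of _ "snd w / fst w"]) simp
  next
    case 2
    \<comment> \<open>In the cyclic case the value at the point of the conic over
      \<open>(0, 1)\<close> is \<open>(1, 0)\<close>, which keeps \<open>snd w\<close> from
      vanishing.\<close>
    have w0: "snd w \<noteq> 0"
      using w(3)[of "(0, 1)" "(1, 0)"] 2(2)[of "(0, 1)"] by (simp add: cross_def sw)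
    have False
      by (rule framed_no_cube[OF fr _ relation_S_cyclic[OF pullback_homogeneous w0 2(3,4) w(2)]])
        (auto simp: homogeneous_iff word_simps)
    then show ?case ..
  qed
qed

text \<open>The common point of the three components is fixed by \<open>\<sigma>\<close> in both
  cases, so injectivity separates \<open>w\<close> from \<open>(1, 0)\<close>.\<close>

lemma framed_fixed_point:
  assumes fr: "framed B T E" and T: "snd (mv T (1, 0)) = 0"
  obtains w where "snd w \<noteq> 0" "\<And>g. g \<in> {g1, g2} \<Longrightarrow> tri (subst (lin_subst B) g) (1, 1) (1, 0) w = 0"
proof -
  obtain w where w: "w \<noteq> (0, 0)"
    "\<And>g. g \<in> {g1, g2} \<Longrightarrow> tri (subst (lin_subst B) g) (1, 1) (1, 0) w = 0"
    "\<And>u' w'. \<lbrakk>u' \<noteq> (0, 0); w' \<noteq> (0, 0); cross (1, 1) u' \<noteq> 0;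
      \<sigma> (pv (mv B u'), pv (mv B (1, 0))) = (pv (mv B (1, 0)), pv (mv B w'))\<rbrakk> \<Longrightarrow> cross w w' \<noteq> 0"
    using hline_image[OF fr] by metis
  have "mv T (1, 0) \<noteq> (0, 0)" using mv_nonzero[OF framedD(2)[OF fr]] by simp
  then have "pv (mv B (mv T (1, 0))) = pv (mv B (1, 0))"
    using pv_mv_eq_1_0_iff[OF framedD(1)[OF fr]] T by blast
  then have "\<sigma> (pv (mv B (1, 0)), pv (mv B (1, 0))) = (pv (mv B (1, 0)), pv (mv B (1, 0)))"
  proof (rule_tac framed_relations[OF fr], goal_cases)
    case 1
    then show ?case by simp
  next
    case 2
    then show ?case by simp
  qed
  then have "snd w \<noteq> 0" using w(3)[of "(1, 0)" "(1, 0)"] by (simp add: cross_def)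
  then show thesis using w(2) that by blast
qed

lemma type_T1_iso:
  assumes fr: "framed B ((1, 0), (0, \<delta>)) E" and \<delta>: "\<delta> \<noteq> 0"
  shows "\<exists>\<alpha>. presented {g1, g2} \<cong>\<^sub>g\<^sub>r presented
    {gx ^ 2 * gy - cst (\<delta> ^ 2) * gy * gx ^ 2 + cst \<alpha> * gy * gx * gy - cst (\<alpha> * \<delta>) * gy ^ 2 * gx,
     gx * gy ^ 2 - cst (\<delta> ^ 2) * gy ^ 2 * gx}"
proof -
  obtain w where w: "snd w \<noteq> 0" "\<And>g. g \<in> {g1, g2} \<Longrightarrow> tri (subst (lin_subst B) g) (1, 1) (1, 0) w = 0"
    using framed_fixed_point[OF fr] by (auto simp: mv_def)
  show ?thesis
  proof (rule framed_relations[OF fr], goal_cases)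
    case 1
    have "presented {g1, g2} \<cong>\<^sub>g\<^sub>r presented
      {gx ^ 2 * gy - cst (\<delta> ^ 2) * gy * gx ^ 2 + cst (\<delta> ^ 2 * (fst w / snd w) - 1) * gy * gx * gy
         - cst ((\<delta> ^ 2 * (fst w / snd w) - 1) * \<delta>) * gy ^ 2 * gx,
       gx * gy ^ 2 - cst (\<delta> ^ 2) * gy ^ 2 * gx}"
      by (rule framed_iso[OF fr], rule relation_T1[OF pullback_homogeneous w(1) \<delta> 1(3,4) w(2)])
    then show ?case by blast
  next
    case 2
    have False
      by (rule framed_no_cube[OF fr _ relation_T1_cyclic[OF pullback_homogeneous w(1) \<delta> 2(3,4) w(2)]])
        (auto simp: homogeneous_iff word_simps)
    then show ?case ..
  qed
qed

lemma type_T2_iso: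
  assumes fr: "framed B ((1, 1), (0, 1)) E"
  shows "\<exists>\<alpha>. presented {g1, g2} \<cong>\<^sub>g\<^sub>r presented
    {gx ^ 2 * gy - gy * gx ^ 2 + cst \<alpha> * gy * gx * gy + cst (2 - \<alpha>) * gy ^ 2 * gx + cst (\<alpha> - 2) * gy ^ 3,
     gx * gy ^ 2 - gy ^ 2 * gx + cst 2 * gy ^ 3}"
proof -
  obtain w where w: "snd w \<noteq> 0" "\<And>g. g \<in> {g1, g2} \<Longrightarrow> tri (subst (lin_subst B) g) (1, 1) (1, 0) w = 0"
    using framed_fixed_point[OF fr] by (auto simp: mv_def)
  show ?thesis
  proof (rule framed_relations[OF fr], goal_cases)
    case 1
    have "presented {g1, g2} \<cong>\<^sub>g\<^sub>r presented
      {gx ^ 2 * gy - gy * gx ^ 2 + cst (fst w / snd w - 1) * gy * gx * gy + cst (2 - (fst w / snd w - 1)) * gy ^ 2 * gx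
         + cst (fst w / snd w - 1 - 2) * gy ^ 3,
       gx * gy ^ 2 - gy ^ 2 * gx + cst 2 * gy ^ 3}"
      by (rule framed_iso[OF fr], rule relation_T2[OF pullback_homogeneous w(1) 1(3,4) w(2)])
    then show ?case by blast
  next
    case 2
    have False
      by (rule framed_no_cube[OF fr _ relation_T2_cyclic[OF pullback_homogeneous w(1) 2(3,4) w(2)]])
        (auto simp: homogeneous_iff word_simps)
    then show ?case ..
  qed
qed

section \<open>Algebras of Type FL\<close>

context
  fixes P Q
  assumes PQ: "P \<noteq> Q" and FL: "E = FL_curve P Q"
begin

lemma FL_frame:
  obtains B where "mdet B \<noteq> 0" "P = pv (mv B (1, 0))" "Q = pv (mv B (0, 1))" "indep2 g1 g2"
proof -
  obtain e f where e: "e \<noteq> (0, 0)" "P = pv e" and f: "f \<noteq> (0, 0)" "Q = pv f" by (metis ex_pv)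
  define B where "B = ((fst e, fst f), (snd e, snd f))"
  have ef: "mv B (1, 0) = e" "mv B (0, 1) = f" by (simp_all add: B_def mv_def)
  have B: "mdet B \<noteq> 0"
    using pv_eq_iff[OF e(1) f(1)] PQ e(2) f(2) by (simp add: B_def mdet_def cross_def algebra_simps)
  \<comment> \<open>The point with both coordinates \<open>(1, 1)\<close> avoids all four lines, so
    \<open>E\<close> is a proper subset and the relations are independent.\<close>
  have "pv (mv B (1, 1)) \<noteq> P" "pv (mv B (1, 1)) \<noteq> Q"
    using pv_mv_eq_1_0_iff[OF B, of "(1, 1)"] pv_mv_eq_0_1_iff[OF B, of "(1, 1)"] e(2) f(2) ef by auto
  then have "(pv (mv B (1, 1)), pv (mv B (1, 1))) \<notin> E" by (simp add: FL mem_FL_curve)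
  then have "indep2 g1 g2" by (intro point_scheme_indep[OF scheme]) auto
  then show thesis using that B e(2) f(2) ef by metis
qed

text \<open>The hypothesis on sets covers FL1 and FL2 alike: on each horizontal line the points over
  \<open>P\<close> and \<open>Q\<close> have the values \<open>P\<close> and \<open>Q\<close> in
  some order, so by injectivity \<open>w\<close> and \<open>w'\<close> have nonzero coordinates.
  Their ratios become \<open>\<alpha>\<close> and \<open>\<beta>\<close>.\<close>

lemma FL_hline_images:
  assumes B: "mdet B \<noteq> 0" and P: "P = pv (mv B (1, 0))" and Q: "Q = pv (mv B (0, 1))"
    and PQ\<sigma>: "\<And>R. R = P \<or> R = Q \<Longrightarrow> {snd (\<sigma> (P, R)), snd (\<sigma> (Q, R))} = {P, Q}"
  shows "\<exists>w w'. fst w \<noteq> 0 \<and> snd w \<noteq> 0 \<and> fst w' \<noteq> 0 \<and> snd w' \<noteq> 0 \<and>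
    (\<forall>g\<in>{g1, g2}. tri (subst (lin_subst B) g) (1, 1) (1, 0) w = 0 \<and>
      tri (subst (lin_subst B) g) (1, 1) (0, 1) w' = 0)"
proof -
  let ?u = "pv (mv B (1, 1))"
  have uPQ: "?u \<noteq> P" "?u \<noteq> Q"
    using pv_mv_eq_1_0_iff[OF B, of "(1, 1)"] pv_mv_eq_0_1_iff[OF B, of "(1, 1)"] P Q by auto
  have image: "\<exists>w. fst w \<noteq> 0 \<and> snd w \<noteq> 0 \<and> \<sigma> (?u, R) = (R, pv (mv B w))" if R: "R = P \<or> R = Q" for R
  proof -
    have m: "(x, R) \<in> E" for x using R by (auto simp: FL mem_FL_curve)
    obtain w where w: "w \<noteq> (0, 0)" "\<sigma> (?u, R) = (R, pv (mv B w))" using image_ex[OF B m] by blast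
    have "snd (\<sigma> (?u, R)) \<noteq> snd (\<sigma> (x, R))" if "x \<noteq> ?u" for x
      using AutG_D(2)[OF \<sigma> m m, of ?u x] AutG_D(3)[OF \<sigma> m] that by (metis prod.collapse prod.inject snd_conv)
    then have "snd (\<sigma> (?u, R)) \<notin> {snd (\<sigma> (P, R)), snd (\<sigma> (Q, R))}" using uPQ by auto
    then have "pv (mv B w) \<noteq> P" "pv (mv B w) \<noteq> Q" unfolding PQ\<sigma>[OF R] using w(2) by auto
    then show ?thesis
      using w pv_mv_eq_1_0_iff[OF B w(1)] pv_mv_eq_0_1_iff[OF B w(1)] P Q by blast
  qed
  obtain w where w: "fst w \<noteq> 0" "snd w \<noteq> 0" "\<sigma> (?u, P) = (P, pv (mv B w))" using image by blast
  obtain w' where w': "fst w' \<noteq> 0" "snd w' \<noteq> 0" "\<sigma> (?u, Q) = (Q, pv (mv B w'))" using image by blast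
  show ?thesis
  proof (intro exI conjI ballI, rule w(1), rule w(2), rule w'(1), rule w'(2))
    fix g assume g: "g \<in> {g1, g2}"
    show "tri (subst (lin_subst B) g) (1, 1) (1, 0) w = 0"
      by (rule pullback_vanish[OF B g _ _ _ _ w(3)[unfolded P]]) (use w in \<open>auto simp: FL mem_FL_curve P\<close>)
    show "tri (subst (lin_subst B) g) (1, 1) (0, 1) w' = 0"
      by (rule pullback_vanish[OF B g _ _ _ _ w'(3)[unfolded Q]]) (use w' in \<open>auto simp: FL mem_FL_curve Q\<close>)
  qed
qed

lemma type_FL1_iso:
  assumes \<sigma>': "\<And>p. \<sigma> (P, p) = (p, P) \<and> \<sigma> (Q, p) = (p, Q)"
  shows "\<exists>\<alpha> \<beta>. \<alpha> * \<beta> \<noteq> 0 \<and> presented {g1, g2} \<cong>\<^sub>g\<^sub>r presented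
    {gx ^ 2 * gy - cst \<alpha> * gy * gx ^ 2, gx * gy ^ 2 - cst \<beta> * gy ^ 2 * gx}"
proof -
  obtain B where B: "mdet B \<noteq> 0" and P: "P = pv (mv B (1, 0))" and Q: "Q = pv (mv B (0, 1))" and ind: "indep2 g1 g2"
    by (rule FL_frame)
  have im: "{snd (\<sigma> (P, R)), snd (\<sigma> (Q, R))} = {P, Q}" for R
    using \<sigma>' by auto
  obtain w w' where w: "fst w \<noteq> 0" "snd w \<noteq> 0" "fst w' \<noteq> 0" "snd w' \<noteq> 0"
    "\<And>g. g \<in> {g1, g2} \<Longrightarrow> tri (subst (lin_subst B) g) (1, 1) (1, 0) w = 0"
    "\<And>g. g \<in> {g1, g2} \<Longrightarrow> tri (subst (lin_subst B) g) (1, 1) (0, 1) w' = 0"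
    using FL_hline_images[OF B P Q im] by blast
  have v: "tri (subst (lin_subst B) g) (1, 0) u (1, 0) = 0" "tri (subst (lin_subst B) g) (0, 1) u (0, 1) = 0"
    if "g \<in> {g1, g2}" "u \<noteq> (0, 0)" for g u
    by (rule pullback_vanish[OF B that(1) _ that(2)]; use \<sigma>' in \<open>auto simp: FL mem_FL_curve P Q\<close>)+
  have "presented {g1, g2} \<cong>\<^sub>g\<^sub>r presented
    {gx ^ 2 * gy - cst (snd w / fst w) * gy * gx ^ 2, gx * gy ^ 2 - cst (snd w' / fst w') * gy ^ 2 * gx}"
    by (rule presented_lin_subst_iso[OF B ind], rule relation_FL1[OF pullback_homogeneous w(1,3) v w(5,6)])
  then show ?thesis using w(1-4) by (intro exI[of _ "snd w / fst w"] exI[of _ "snd w' / fst w'"]) simp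
qed

lemma type_FL2_iso:
  assumes \<sigma>': "\<And>p. \<sigma> (P, p) = (p, Q) \<and> \<sigma> (Q, p) = (p, P)"
  shows "\<exists>\<alpha> \<beta>. \<alpha> * \<beta> \<noteq> 0 \<and> presented {g1, g2} \<cong>\<^sub>g\<^sub>r presented
    {gy * gx * gy - cst \<alpha> * gx ^ 3, cst \<beta> * gx * gy * gx - gy ^ 3}"
proof -
  obtain B where B: "mdet B \<noteq> 0" and P: "P = pv (mv B (1, 0))" and Q: "Q = pv (mv B (0, 1))" and ind: "indep2 g1 g2"
    by (rule FL_frame)
  have im: "{snd (\<sigma> (P, R)), snd (\<sigma> (Q, R))} = {P, Q}" for R
    using \<sigma>' by auto
  obtain w w' where w: "fst w \<noteq> 0" "snd w \<noteq> 0" "fst w' \<noteq> 0" "snd w' \<noteq> 0"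
    "\<And>g. g \<in> {g1, g2} \<Longrightarrow> tri (subst (lin_subst B) g) (1, 1) (1, 0) w = 0"
    "\<And>g. g \<in> {g1, g2} \<Longrightarrow> tri (subst (lin_subst B) g) (1, 1) (0, 1) w' = 0"
    using FL_hline_images[OF B P Q im] by blast
  have v: "tri (subst (lin_subst B) g) (1, 0) u (0, 1) = 0" "tri (subst (lin_subst B) g) (0, 1) u (1, 0) = 0"
    if "g \<in> {g1, g2}" "u \<noteq> (0, 0)" for g u
    by (rule pullback_vanish[OF B that(1) _ that(2)]; use \<sigma>' in \<open>auto simp: FL mem_FL_curve P Q\<close>)+
  have "presented {g1, g2} \<cong>\<^sub>g\<^sub>r presented
    {gy * gx * gy - cst (snd w / fst w) * gx ^ 3, cst (snd w' / fst w') * gx * gy * gx - gy ^ 3}"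
    by (rule presented_lin_subst_iso[OF B ind], rule relation_FL2[OF pullback_homogeneous w(1,3) v w(5,6)])
  then show ?thesis using w(1-4) by (intro exI[of _ "snd w / fst w"] exI[of _ "snd w' / fst w'"]) simp
qed

end

end

text \<open>Equality of the two quotient algebras gives equality of their ideals, so
  \<open>g1\<close> and \<open>g2\<close> lie in the ideal generated by the relation space and
  inherit its vanishing.\<close>

lemma cubic_AS_regular_pairE:
  fixes E :: "('k::field_char_0 P1 \<times> 'k P1) set"
  assumes "cubic_AS_regular_pair A E \<sigma>"
  obtains g1 g2 where "A = presented {g1, g2}" "cubic_pair g1 g2 E \<sigma>"
proof -
  obtain g1 g2 where g: "homogeneous 3 g1" "homogeneous 3 g2" "A = presented {g1, g2}" "point_scheme g1 g2 E"
    and reg: "AS_regular 3 A" and \<sigma>: "\<sigma> \<in> AutG E" "A = geometric_algebra E \<sigma>"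
    using assms unfolding cubic_AS_regular_pair_def by blast
  have I: "genideal FA {g1, g2} = genideal FA (relation_space E \<sigma>)"
    using g(3) \<sigma>(2) unfolding geometric_algebra_def by (intro presented_eq_genideal) simp
  have "cubic_pair g1 g2 E \<sigma>"
  proof
    fix g assume "g \<in> {g1, g2}"
    then show "homogeneous 3 g" using g by auto
    have "g \<in> genideal FA (relation_space E \<sigma>)"
      using genideal_FA_gen[OF \<open>g \<in> {g1, g2}\<close>] unfolding I .
    then show "tri g u v w = 0" if "(p, q) \<in> E" "u \<in> coords p" "v \<in> coords q" "w \<in> coords (snd (\<sigma> (p, q)))" for p q u v w
      using that by (rule genideal_relation_space)
  next
    show "gldim (presented {g1, g2}) = 3"
      using reg g(3) by (simp add: AS_regular_def numeral_eq_enat)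
  qed (rule g \<sigma>)+
  then show thesis using g(3) that by blast
qed

theorem theorem3p3:
  fixes A :: "('k::{alg_closed_field, field_char_0}, 'k free_alg set) graded_algebra"
    and E :: "('k P1 \<times> 'k P1) set"
    and \<sigma> :: "'k P1 \<times> 'k P1 \<Rightarrow> 'k P1 \<times> 'k P1"
  assumes "cubic_AS_regular_pair A E \<sigma>"
    and "type_S E \<or> type_T E \<or> type_FL E"
  shows
    "(type_S E \<longrightarrow>
        (\<exists>\<alpha>. \<alpha> \<noteq> 0 \<and>
          A \<cong>\<^sub>g\<^sub>r presented
            {gx ^ 2 * gy - cst \<alpha> * gy * gx ^ 2 + cst (\<alpha> - 1) * gy ^ 3,
             gx * gy ^ 2 - gy ^ 2 * gx}))
     \<and> (type_T E \<longrightarrow> type_T1 E \<or> type_T2 E)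
     \<and> (type_T1 E \<longrightarrow>
        (\<exists>\<alpha> \<delta>. \<delta> \<noteq> 0 \<and>
          A \<cong>\<^sub>g\<^sub>r presented
            {gx ^ 2 * gy - cst (\<delta> ^ 2) * gy * gx ^ 2 + cst \<alpha> * gy * gx * gy
               - cst (\<alpha> * \<delta>) * gy ^ 2 * gx,
             gx * gy ^ 2 - cst (\<delta> ^ 2) * gy ^ 2 * gx}))
     \<and> (type_T2 E \<longrightarrow>
        (\<exists>\<alpha>.
          A \<cong>\<^sub>g\<^sub>r presented
            {gx ^ 2 * gy - gy * gx ^ 2 + cst \<alpha> * gy * gx * gy
               + cst (2 - \<alpha>) * gy ^ 2 * gx + cst (\<alpha> - 2) * gy ^ 3,
             gx * gy ^ 2 - gy ^ 2 * gx + cst 2 * gy ^ 3}))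
     \<and> (type_FL E \<longrightarrow> type_FL1 E \<sigma> \<or> type_FL2 E \<sigma>)
     \<and> (type_FL1 E \<sigma> \<longrightarrow>
        (\<exists>\<alpha> \<beta>. \<alpha> * \<beta> \<noteq> 0 \<and>
          A \<cong>\<^sub>g\<^sub>r presented
            {gx ^ 2 * gy - cst \<alpha> * gy * gx ^ 2,
             gx * gy ^ 2 - cst \<beta> * gy ^ 2 * gx}))
     \<and> (type_FL2 E \<sigma> \<longrightarrow>
        (\<exists>\<alpha> \<beta>. \<alpha> * \<beta> \<noteq> 0 \<and>
          A \<cong>\<^sub>g\<^sub>r presented
            {gy * gx * gy - cst \<alpha> * gx ^ 3,
             cst \<beta> * gx * gy * gx - gy ^ 3}))"
proof -
  obtain g1 g2 where A: "A = presented {g1, g2}" and "cubic_pair g1 g2 E \<sigma>"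
    using cubic_AS_regular_pairE[OF assms(1)] by blast
  interpret cubic_pair g1 g2 E \<sigma> by fact
  have T1: "two_equivalent E (hline (pt 1 0) \<union> vline (pt 1 0) \<union> graph_curve (proj_map 1 0 0 \<delta>)) \<longleftrightarrow>
      (\<exists>B. framed B ((1, 0), (0, \<delta>)) E)" if "\<delta> \<noteq> 0" for \<delta>
    using that by (intro two_equivalent_framed) simp
  have T2: "two_equivalent E (hline (pt 1 0) \<union> vline (pt 1 0) \<union> graph_curve (proj_map 1 1 0 1)) \<longleftrightarrow>
      (\<exists>B. framed B ((1, 1), (0, 1)) E)"
    by (intro two_equivalent_framed) simp
  show ?thesis
    unfolding A
  proof (intro conjI impI, goal_cases)
    case 1
    then show ?case using type_S_framed[OF _ \<sigma>] type_S_iso by blast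
  next
    case 2
    then show ?case using type_T_framed[OF _ \<sigma>] T1 T2 unfolding type_T1_def type_T2_def by blast
  next
    case 3
    then obtain B \<delta> where "\<delta> \<noteq> 0" "framed B ((1, 0), (0, \<delta>)) E" using T1 unfolding type_T1_def by blast
    then show ?case using type_T1_iso by blast
  next
    case 4
    then show ?case using T2 type_T2_iso unfolding type_T2_def by blast
  next
    case 5
    then obtain P Q where "P \<noteq> Q" "E = FL_curve P Q" using type_FL_curve[OF _ \<sigma>] by blast
    then show ?case
      using FL_curve_AutG_cases[OF _ _ \<sigma>] unfolding type_FL1_def type_FL2_def FL_curve_def by metis
  next
    case 6
    then obtain P Q where "P \<noteq> Q" "E = FL_curve P Q" "\<And>p. \<sigma> (P, p) = (p, P) \<and> \<sigma> (Q, p) = (p, Q)"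
      unfolding type_FL1_def FL_curve_def by blast
    then show ?case by (rule type_FL1_iso)
  next
    case 7
    then obtain P Q where "P \<noteq> Q" "E = FL_curve P Q" "\<And>p. \<sigma> (P, p) = (p, Q) \<and> \<sigma> (Q, p) = (p, P)"
      unfolding type_FL2_def FL_curve_def by blast
    then show ?case by (rule type_FL2_iso)
  qed
qed

end
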